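(* Let $\mathcal{S}:\mathbb{C}^{N\times N}\to\mathbb{C}^{N\times N}$ be a linear operator that is symmetric with respect to the Hilbert--Schmidt scalar product, $\mathrm{Tr}\,R^*\mathcal{S}[T]=\mathrm{Tr}\,\mathcal{S}[R]^*T$ for all $R,T\in\mathbb{C}^{N\times N}$, positivity preserving ($\mathcal{S}[R]\ge0$ whenever $R\ge0$), and flat: there are constants $0<c\le C$, independent of $N$, with $$c\,\langle R\rangle\le\mathcal{S}[R]\le C\,\langle R\rangle\qquad\text{for all } R\ge0 .$$ For $z\in\mathbb{H}$ let $M=M(z)\in\mathbb{C}^{N\times N}$ be the unique solution of the matrix Dyson equation $$I+(z+\mathcal{S}[M])M=0,\qquad \mathrm{Im}\,M>0 .$$ Then there is a universal constant $\kappa$ ($\kappa=100$ would do) such that for all $z\in\mathbb{H}$ with $|z|\le C'$ (where $C'$ is any fixed constant) $$\Big\|\big(1-\mathcal{C}_{M(z)}\mathcal{S}\big)^{-1}\Big\|_{\mathrm{sp}}\lesssim\frac{1}{\big[\varrho(z)+\mathrm{dist}(z,\mathrm{supp}\,\varrho)\big]^{\kappa}} .$$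
   Context: $\mathbb{H}=\{z\in\mathbb{C}:\mathrm{Im}\,z>0\}$. For a matrix $R\in\mathbb{C}^{N\times N}$: $\langle R\rangle=\frac1N\mathrm{Tr}\,R$, $\mathrm{Im}\,R=\frac1{2i}(R-R^* )$; inequalities between hermitian matrices are in the sense of quadratic forms, and scalars are identified with multiples of the identity $I$. For every $z\in\mathbb{H}$ the matrix Dyson equation has a unique solution $M(z)$ with $\mathrm{Im}\,M>0$; it is analytic in $z$ and $M(z)=\int_{\mathbb{R}}\frac{V(d\tau)}{\tau-z}$ for a positive semidefinite matrix-valued measure $V$ on $\mathbb{R}$ with $V(\mathbb{R})=I$ and compact support. The self-consistent density of states $\varrho$ is the probability measure on $\mathbb{R}$ whose Stieltjes transform is $\langle M(z)\rangle$, i.e. $\varrho(d\tau)=\langle V(d\tau)\rangle$; $\mathrm{supp}\,\varrho$ is its support, and its harmonic extension to $\mathbb{H}$ is $\varrho(z)=\frac1\pi\langle\mathrm{Im}\,M(z)\rangle$. For a matrix $T$, $\mathcal{C}_T$ is the sandwiching operator $\mathcal{C}_T[R]=TRT$, so $(1-\mathcal{C}_M\mathcal{S})[R]=R-M\mathcal{S}[R]M$. $\|\cdot\|_{\mathrm{sp}}$ is the operator norm of linear maps on $\mathbb{C}^{N\times N}$ equipped with the Hilbert--Schmidt norm $\|R\|_{\mathrm{hs}}=(\frac1N\mathrm{Tr}\,RR^* )^{1/2}$. $A\lesssim B$ means $A\le KB$ with a constant $K$ independent of $N$ and $z$, depending only on $c$, $C$, $C'$. *)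

theory Defs
  imports "HOL-Probability.Probability" "Jordan_Normal_Form.Schur_Decomposition"
begin

definition mat_trace :: "complex mat \<Rightarrow> complex" where
  "mat_trace A = (\<Sum>i<dim_row A. A $$ (i, i))"

definition norm_trace :: "nat \<Rightarrow> complex mat \<Rightarrow> complex" where
  "norm_trace N A = mat_trace A / of_nat N"

definition hs_norm :: "nat \<Rightarrow> complex mat \<Rightarrow> real" where
  "hs_norm N R = sqrt (Re (norm_trace N (R * mat_adjoint R)))"

definition im_mat :: "complex mat \<Rightarrow> complex mat" where
  "im_mat R = (1 / (2 * \<i>)) \<cdot>\<^sub>m (R - mat_adjoint R)"

definition herm_mat :: "nat \<Rightarrow> complex mat \<Rightarrow> bool" where
  "herm_mat N A \<longleftrightarrow> A \<in> carrier_mat N N \<and> mat_adjoint A = A"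

definition quad_form :: "complex mat \<Rightarrow> complex vec \<Rightarrow> real" where
  "quad_form A v = Re ((A *\<^sub>v v) \<bullet>c v)"

(* The order class instance on type mat is entrywise, so \<le> and < on matrices must not be used
   for the order of quadratic forms. *)
definition loewner_le :: "nat \<Rightarrow> complex mat \<Rightarrow> complex mat \<Rightarrow> bool" where
  "loewner_le N A B \<longleftrightarrow> herm_mat N A \<and> herm_mat N B \<and>
     (\<forall>v\<in>carrier_vec N. quad_form A v \<le> quad_form B v)"

definition loewner_less :: "nat \<Rightarrow> complex mat \<Rightarrow> complex mat \<Rightarrow> bool" where
  "loewner_less N A B \<longleftrightarrow> herm_mat N A \<and> herm_mat N B \<and>
     (\<forall>v\<in>carrier_vec N. v \<noteq> 0\<^sub>v N \<longrightarrow> quad_form A v < quad_form B v)"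

definition linear_op :: "nat \<Rightarrow> (complex mat \<Rightarrow> complex mat) \<Rightarrow> bool" where
  "linear_op N T \<longleftrightarrow>
     (\<forall>R\<in>carrier_mat N N. T R \<in> carrier_mat N N) \<and>
     (\<forall>R\<in>carrier_mat N N. \<forall>Q\<in>carrier_mat N N. T (R + Q) = T R + T Q) \<and>
     (\<forall>a. \<forall>R\<in>carrier_mat N N. T (a \<cdot>\<^sub>m R) = a \<cdot>\<^sub>m T R)"

definition hs_symmetric :: "nat \<Rightarrow> (complex mat \<Rightarrow> complex mat) \<Rightarrow> bool" where
  "hs_symmetric N T \<longleftrightarrow>
     (\<forall>R\<in>carrier_mat N N. \<forall>Q\<in>carrier_mat N N.
        mat_trace (mat_adjoint R * T Q) = mat_trace (mat_adjoint (T R) * Q))"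

definition positivity_preserving :: "nat \<Rightarrow> (complex mat \<Rightarrow> complex mat) \<Rightarrow> bool" where
  "positivity_preserving N T \<longleftrightarrow>
     (\<forall>R\<in>carrier_mat N N. loewner_le N (0\<^sub>m N N) R \<longrightarrow> loewner_le N (0\<^sub>m N N) (T R))"

definition flat_op :: "nat \<Rightarrow> real \<Rightarrow> real \<Rightarrow> (complex mat \<Rightarrow> complex mat) \<Rightarrow> bool" where
  "flat_op N c C T \<longleftrightarrow>
     (\<forall>R\<in>carrier_mat N N. loewner_le N (0\<^sub>m N N) R \<longrightarrow>
        loewner_le N ((of_real c * norm_trace N R) \<cdot>\<^sub>m 1\<^sub>m N) (T R) \<and>
        loewner_le N (T R) ((of_real C * norm_trace N R) \<cdot>\<^sub>m 1\<^sub>m N))"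

(* The operator norm for hs_norm, formed like onorm, which needs a normed space as a type;
   the quotient at R = 0 is 0 / 0 = 0. *)
definition sp_norm :: "nat \<Rightarrow> (complex mat \<Rightarrow> complex mat) \<Rightarrow> real" where
  "sp_norm N T = (SUP R\<in>carrier_mat N N. hs_norm N (T R) / hs_norm N R)"

definition mde_solution ::
  "nat \<Rightarrow> (complex mat \<Rightarrow> complex mat) \<Rightarrow> complex \<Rightarrow> complex mat \<Rightarrow> bool" where
  "mde_solution N S z M \<longleftrightarrow> M \<in> carrier_mat N N \<and>
     1\<^sub>m N + (z \<cdot>\<^sub>m 1\<^sub>m N + S M) * M = 0\<^sub>m N N \<and>
     loewner_less N (0\<^sub>m N N) (im_mat M)"

definition upper_half_plane :: "complex set" where
  "upper_half_plane = {z. 0 < Im z}"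

definition self_consistent_dos :: "nat \<Rightarrow> (complex \<Rightarrow> complex mat) \<Rightarrow> real measure \<Rightarrow> bool" where
  "self_consistent_dos N M \<rho> \<longleftrightarrow> real_distribution \<rho> \<and>
     (\<forall>z\<in>upper_half_plane. norm_trace N (M z) = (\<integral>\<tau>. 1 / (complex_of_real \<tau> - z) \<partial>\<rho>))"

definition measure_support :: "real measure \<Rightarrow> real set" where
  "measure_support \<mu> = {x. \<forall>U. open U \<and> x \<in> U \<longrightarrow> 0 < emeasure \<mu> U}"

definition dos_extension :: "nat \<Rightarrow> (complex \<Rightarrow> complex mat) \<Rightarrow> complex \<Rightarrow> real" where
  "dos_extension N M z = Re (norm_trace N (im_mat (M z))) / pi"

definition stability_op ::
  "(complex mat \<Rightarrow> complex mat) \<Rightarrow> complex mat \<Rightarrow> complex mat \<Rightarrow> complex mat" where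
  "stability_op S M R = R - M * S R * M"

end

theory Submission
  imports Defs "HOL-Complex_Analysis.Complex_Analysis" "Jordan_Normal_Form.Spectral_Radius"
begin

text \<open>
  Write \<open>\<eta> = Im z\<close>, \<open>\<tau> = \<langle>Im M\<rangle> = \<pi> \<rho>(z)\<close>, \<open>d = dist (z, supp \<rho>)\<close> and \<open>A = \<eta> + S[Im M]\<close>.
  The imaginary part of the Dyson equation is \<open>Im M = M\<^sup>* A M\<close>, and flatness places \<open>A\<close> between
  \<open>\<eta> + c \<tau>\<close> and \<open>\<eta> + C \<tau>\<close>. Hence \<open>\<parallel>M\<parallel> \<le> 1 / (\<eta> + c \<tau>)\<close>, while \<open>\<langle>M\<^sup>* M\<rangle> \<le> 1 / c\<close> bounds \<open>S[M]\<close>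
  in operator norm and so gives \<open>\<parallel>M\<^sup>-\<^sup>1\<parallel> \<le> |z| + 2 C / \<surd>c\<close>.

  Since \<open>Im M > 0\<close>, one can factor \<open>M = B\<^sup>* U B\<close> with \<open>B\<close> invertible and \<open>U\<close> diagonal and unitary
  (\<open>balanced_decomposition\<close>). Substituting \<open>R = B\<^sup>* X B\<close> turns the stability operator into
  \<open>X \<mapsto> X - U F[X] U\<close>, where \<open>F[X] = B S[B\<^sup>* X B] B\<^sup>*\<close> is symmetric and positivity preserving, and the imaginary
  part of the Dyson equation into \<open>F[D] = D - \<eta> B B\<^sup>*\<close> with \<open>D = Im U > 0\<close>. The passage between the two pictures
  costs the ratio of the bounds on \<open>B B\<^sup>*\<close>, which the bounds on \<open>M\<close> and \<open>M\<^sup>-\<^sup>1\<close> control. By a Perron--Frobenius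
  argument (\<open>positive_map_norm_le\<close>) the subsolution \<open>D\<close> yields
  \<open>\<parallel>F\<parallel> \<le> 1 - \<eta> / (\<eta> + C \<tau>)\<close>, and \<open>X - U F[X] U\<close> is bounded below by \<open>\<eta> / (\<eta> + C \<tau>)\<close>.

  Inside the spectrum this degenerates as \<open>\<eta>\<close> tends to zero. There flatness provides a spectral gap of \<open>F\<close> below
  its top eigenvector, which is \<open>D\<close> up to an error of order \<open>\<eta>\<close>; and \<open>D\<close> itself is moved by the rotation
  \<open>X \<mapsto> U X U\<close>, because \<open>Im U = D\<close> is bounded away from zero in terms of \<open>\<tau>\<close> (\<open>rotated_subsolution_gap\<close>).
  The resulting bound on the inverse is polynomial in \<open>1 / \<tau>\<close> and serves the case \<open>\<rho>(z) > d\<close>.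

  In the opposite case \<open>\<tau> \<le> \<eta> / d\<^sup>2\<close>, so that the contraction rate \<open>\<eta> / (\<eta> + C \<tau>)\<close> is at least
  \<open>1 / (1 + C / d\<^sup>2)\<close>; what is missing is a bound on \<open>\<parallel>M\<parallel>\<close> by a power of \<open>1 / d\<close> that does not depend on \<open>N\<close>.
  The functions \<open>\<langle>M(z) v, v\<rangle>\<close> map the half-plane to itself, are at most \<open>\<parallel>v\<parallel>\<^sup>2 / \<eta>\<close>, and continue analytically
  across the gap because their imaginary part is at most \<open>N \<tau> \<parallel>v\<parallel>\<^sup>2\<close>, which is of order \<open>\<eta>\<close> there. The factor \<open>N\<close> is irrelevant for the existence
  of the continuation, to which the maximum principle then applies (\<open>nevanlinna_gap_bound\<close>).

  This last step needs \<open>M\<close> to be analytic, although the hypothesis only gives a solution for each single \<open>z\<close>.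
  Through every solution there passes an analytic one, a limit of fixed point iterates, and all of them agree for
  large \<open>Im z\<close>, where solutions are unique; so they are one and the same function (\<open>solution_holomorphic\<close>).
\<close>

text \<open>Vectors of fixed dimension and formal power series also use the symbol \<open>$\<close>; here it only denotes the entries of
  vectors of variable dimension.\<close>
unbundle no vec_syntax
no_notation fps_nth (infixl \<open>$\<close> 75)

section \<open>Adjoints, inner products and quadratic forms\<close>

lemma mat_adjoint_dim [simp]:
  "dim_row (mat_adjoint A) = dim_col A" "dim_col (mat_adjoint A) = dim_row A"
  by (auto simp: mat_adjoint_def)

lemma mat_adjoint_index [simp]:
  fixes A :: "complex mat"
  assumes "i < dim_col A" "j < dim_row A"
  shows "mat_adjoint A $$ (i, j) = cnj (A $$ (j, i))"
  using assms by (auto simp: mat_adjoint_def mat_of_rows_def)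

lemma mat_adjoint_carrier [simp]: "mat_adjoint A \<in> carrier_mat m n \<longleftrightarrow> A \<in> carrier_mat n m"
  by (metis carrier_matD carrier_matI mat_adjoint_dim)

lemma mat_adjoint_adjoint [simp]: "mat_adjoint (mat_adjoint A) = (A :: complex mat)"
  by (rule eq_matI) auto

lemma mat_adjoint_zero [simp]: "mat_adjoint (0\<^sub>m m n) = (0\<^sub>m n m :: complex mat)"
  by (rule eq_matI) auto

lemma mat_adjoint_one [simp]: "mat_adjoint (1\<^sub>m n) = (1\<^sub>m n :: complex mat)"
  by (rule eq_matI) auto

lemma mat_adjoint_smult [simp]: "mat_adjoint (a \<cdot>\<^sub>m A) = cnj a \<cdot>\<^sub>m mat_adjoint A"
  by (rule eq_matI) auto

lemma mat_adjoint_add: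
  fixes A B :: "complex mat"
  assumes "A \<in> carrier_mat m n" "B \<in> carrier_mat m n"
  shows "mat_adjoint (A + B) = mat_adjoint A + mat_adjoint B"
  using assms by (intro eq_matI) auto

lemma mat_adjoint_minus:
  fixes A B :: "complex mat"
  assumes "A \<in> carrier_mat m n" "B \<in> carrier_mat m n"
  shows "mat_adjoint (A - B) = mat_adjoint A - mat_adjoint B"
  using assms by (intro eq_matI) auto

lemma mat_adjoint_mult:
  fixes A B :: "complex mat"
  assumes "A \<in> carrier_mat m n" "B \<in> carrier_mat n k"
  shows "mat_adjoint (A * B) = mat_adjoint B * mat_adjoint A"
  using assms by (intro eq_matI) (auto simp: scalar_prod_def mult.commute)

lemma mat_adjoint_diag [simp]: "mat_adjoint (mat_diag n f) = mat_diag n (\<lambda>i. cnj (f i))"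
  by (rule eq_matI) (auto simp: mat_diag_def)

lemma cinner_sum: "v \<in> carrier_vec n \<Longrightarrow> w \<in> carrier_vec n \<Longrightarrow>
    v \<bullet>c w = (\<Sum>i<n. v $ i * cnj (w $ i))" for v w :: "complex vec"
  by (auto simp: scalar_prod_def atLeast0LessThan)

lemma cinner_adjoint:
  fixes A :: "complex mat"
  assumes "A \<in> carrier_mat m n" "v \<in> carrier_vec n" "w \<in> carrier_vec m"
  shows "(A *\<^sub>v v) \<bullet>c w = v \<bullet>c (mat_adjoint A *\<^sub>v w)"
proof -
  have "(A *\<^sub>v v) \<bullet>c w = (\<Sum>i<m. \<Sum>j<n. A $$ (i,j) * v $ j * cnj (w $ i))"
    using assms by (subst cinner_sum[of _ m]) (auto simp: scalar_prod_def atLeast0LessThan sum_distrib_right)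
  also have "\<dots> = (\<Sum>j<n. \<Sum>i<m. A $$ (i,j) * v $ j * cnj (w $ i))" by (rule sum.swap)
  also have "\<dots> = v \<bullet>c (mat_adjoint A *\<^sub>v w)"
    using assms
    by (subst cinner_sum[of _ n]) (auto simp: scalar_prod_def atLeast0LessThan sum_distrib_left intro!: sum.cong)
  finally show ?thesis .
qed

definition vnorm :: "complex vec \<Rightarrow> real" where
  "vnorm v = L2_set (\<lambda>i. cmod (v $ i)) {..<dim_vec v}"

lemma vnorm_nonneg [simp]: "0 \<le> vnorm v" by (simp add: vnorm_def)

lemma vnorm_sq: "(vnorm v)\<^sup>2 = (\<Sum>i<dim_vec v. (cmod (v $ i))\<^sup>2)"
  by (simp add: vnorm_def L2_set_def sum_nonneg)

lemma cinner_self: "v \<bullet>c v = of_real ((vnorm v)\<^sup>2)"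
  by (subst cinner_sum[of _ "dim_vec v"]) (auto simp: vnorm_sq complex_norm_square[symmetric] simp del: of_real_power)

lemma vnorm_eq_0 [simp]: "v \<in> carrier_vec n \<Longrightarrow> vnorm v = 0 \<longleftrightarrow> v = 0\<^sub>v n"
  using conjugate_square_eq_0_vec[of v n] by (simp add: cinner_self)

lemma vnorm_pos: "v \<in> carrier_vec n \<Longrightarrow> v \<noteq> 0\<^sub>v n \<Longrightarrow> 0 < vnorm v"
  by (metis vnorm_eq_0 vnorm_nonneg less_eq_real_def)

lemma vnorm_smult [simp]: "vnorm (a \<cdot>\<^sub>v v) = cmod a * vnorm v"
  by (auto simp: vnorm_def norm_mult L2_set_right_distrib intro!: L2_set_cong)

lemma vnorm_triangle:
  assumes "v \<in> carrier_vec n" "w \<in> carrier_vec n"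
  shows "vnorm (v + w) \<le> vnorm v + vnorm w"
proof -
  have "vnorm (v + w) \<le> L2_set (\<lambda>i. cmod (v $ i) + cmod (w $ i)) {..<n}"
    unfolding vnorm_def using assms by (auto intro!: L2_set_mono norm_triangle_ineq)
  also have "\<dots> \<le> vnorm v + vnorm w"
    unfolding vnorm_def using assms L2_set_triangle_ineq[of "\<lambda>i. cmod (v $ i)" "\<lambda>i. cmod (w $ i)" "{..<n}"] by auto
  finally show ?thesis .
qed

lemma cinner_le:
  assumes "v \<in> carrier_vec n" "w \<in> carrier_vec n"
  shows "cmod (v \<bullet>c w) \<le> vnorm v * vnorm w"
proof -
  have "cmod (v \<bullet>c w) \<le> (\<Sum>i<n. cmod (v $ i) * cmod (w $ i))"
    by (subst cinner_sum[OF assms]) (rule order_trans[OF norm_sum], simp add: norm_mult)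
  also have "\<dots> \<le> vnorm v * vnorm w"
    using L2_set_mult_ineq[of "\<lambda>i. cmod (v $ i)" "\<lambda>i. cmod (w $ i)" "{..<n}"] assms
    by (simp add: vnorm_def)
  finally show ?thesis .
qed

lemma vnorm_unit [simp]: "i < n \<Longrightarrow> vnorm (unit_vec n i) = 1"
proof -
  assume i: "i < n"
  have "(vnorm (unit_vec n i))\<^sup>2 = (\<Sum>j<n. if j = i then 1 else 0)"
    unfolding vnorm_sq by (rule sum.cong) (use i in \<open>auto simp: unit_vec_def\<close>)
  also have "\<dots> = 1" using i by simp
  finally show ?thesis using vnorm_nonneg[of "unit_vec n i"] by (smt (verit) power2_eq_1_iff)
qed

lemma quad_form_sum:
  assumes "A \<in> carrier_mat n n" "v \<in> carrier_vec n"
  shows "quad_form A v = (\<Sum>i<n. \<Sum>j<n. Re (A $$ (i,j) * v $ j * cnj (v $ i)))"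
  unfolding quad_form_def using assms
  by (subst cinner_sum[of _ n]) (auto simp: scalar_prod_def atLeast0LessThan sum_distrib_right)

lemma quad_form_add:
  assumes "A \<in> carrier_mat n n" "B \<in> carrier_mat n n" "v \<in> carrier_vec n"
  shows "quad_form (A + B) v = quad_form A v + quad_form B v"
  using assms by (simp add: quad_form_sum[of _ n] sum.distrib[symmetric] algebra_simps)

lemma quad_form_minus:
  assumes "A \<in> carrier_mat n n" "B \<in> carrier_mat n n" "v \<in> carrier_vec n"
  shows "quad_form (A - B) v = quad_form A v - quad_form B v"
  using assms by (simp add: quad_form_sum[of _ n] minus_carrier_mat sum_subtractf[symmetric] algebra_simps)

lemma quad_form_smult:
  assumes "A \<in> carrier_mat n n" "v \<in> carrier_vec n"
  shows "quad_form (complex_of_real a \<cdot>\<^sub>m A) v = a * quad_form A v"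
  using assms by (simp add: quad_form_sum[of _ n] sum_distrib_left algebra_simps)

lemma quad_form_one [simp]: "v \<in> carrier_vec n \<Longrightarrow> quad_form (1\<^sub>m n) v = (vnorm v)\<^sup>2"
  by (simp add: quad_form_def cinner_self)

lemma quad_form_zero [simp]: "v \<in> carrier_vec n \<Longrightarrow> quad_form (0\<^sub>m n n) v = 0"
  by (simp add: quad_form_sum[of _ n])

lemma quad_form_scalar:
  "v \<in> carrier_vec n \<Longrightarrow> quad_form (complex_of_real a \<cdot>\<^sub>m 1\<^sub>m n) v = a * (vnorm v)\<^sup>2"
  by (simp add: quad_form_smult[of _ n])

lemma quad_form_congruence:
  assumes "A \<in> carrier_mat n n" "B \<in> carrier_mat n m" "v \<in> carrier_vec m"
  shows "quad_form (mat_adjoint B * A * B) v = quad_form A (B *\<^sub>v v)"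
proof -
  note c = mult_carrier_mat[of "mat_adjoint B" m n A n] mult_mat_vec_carrier[of B n m v]
    mult_mat_vec_carrier[of A n n "B *\<^sub>v v"]
  have "(mat_adjoint B * A * B) *\<^sub>v v = mat_adjoint B *\<^sub>v (A *\<^sub>v (B *\<^sub>v v))"
    using assms c assoc_mult_mat_vec[of "mat_adjoint B * A" m n B m v]
      assoc_mult_mat_vec[of "mat_adjoint B" m n A n "B *\<^sub>v v"] by simp
  thus ?thesis unfolding quad_form_def using assms c 
    cinner_adjoint[of "mat_adjoint B" m n "A *\<^sub>v (B *\<^sub>v v)" v] by simp
qed

lemma quad_form_diag:
  assumes "v \<in> carrier_vec n"
  shows "quad_form (mat_diag n f) v = (\<Sum>i<n. Re (f i) * (cmod (v $ i))\<^sup>2)"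
proof -
  have "quad_form (mat_diag n f) v = (\<Sum>i<n. \<Sum>j<n. Re (mat_diag n f $$ (i,j) * v $ j * cnj (v $ i)))"
    using assms by (subst quad_form_sum[of _ n]) auto
  also have "\<dots> = (\<Sum>i<n. \<Sum>j<n. if j = i then Re (f i * v $ i * cnj (v $ i)) else 0)"
    by (intro sum.cong refl) (auto simp: mat_diag_def)
  also have "\<dots> = (\<Sum>i<n. Re (f i * v $ i * cnj (v $ i)))" by simp
  finally show ?thesis by (simp add: mult.assoc complex_norm_square[symmetric] del: of_real_power)
qed

lemma quad_form_le:
  assumes "A \<in> carrier_mat n n" "v \<in> carrier_vec n" 
  shows "\<bar>quad_form A v\<bar> \<le> vnorm (A *\<^sub>v v) * vnorm v"
  unfolding quad_form_def using cinner_le[of "A *\<^sub>v v" n v] assms abs_Re_le_cmod order_trans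
  by (metis mult_mat_vec_carrier)

abbreviation psd :: "nat \<Rightarrow> complex mat \<Rightarrow> bool" where
  "psd n A \<equiv> loewner_le n (0\<^sub>m n n) A"

lemma psd_iff: "psd n A \<longleftrightarrow> herm_mat n A \<and> (\<forall>v\<in>carrier_vec n. 0 \<le> quad_form A v)"
  by (auto simp: loewner_le_def herm_mat_def)

lemma psd_carrier: "psd n A \<Longrightarrow> A \<in> carrier_mat n n"
  by (auto simp: psd_iff herm_mat_def)

lemma herm_mat_add: "herm_mat n A \<Longrightarrow> herm_mat n B \<Longrightarrow> herm_mat n (A + B)"
  by (auto simp: herm_mat_def mat_adjoint_add[of _ n n])

lemma herm_mat_minus: "herm_mat n A \<Longrightarrow> herm_mat n B \<Longrightarrow> herm_mat n (A - B)"
  by (auto simp: herm_mat_def mat_adjoint_minus[of _ n n] minus_carrier_mat)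

lemma herm_mat_smult: "herm_mat n A \<Longrightarrow> herm_mat n (complex_of_real a \<cdot>\<^sub>m A)"
  by (auto simp: herm_mat_def)

lemma herm_mat_one [simp]: "herm_mat n (1\<^sub>m n)" and herm_mat_zero [simp]: "herm_mat n (0\<^sub>m n n)"
  by (auto simp: herm_mat_def)

lemma herm_mat_congruence:
  assumes "herm_mat n A" "B \<in> carrier_mat n m"
  shows "herm_mat m (mat_adjoint B * A * B)"
  using assms unfolding herm_mat_def
  by (auto simp: mat_adjoint_mult[of _ m n _ m] mat_adjoint_mult[of A n n B m] assoc_mult_mat[of _ m n _ n _ m])

lemma psd_congruence:
  assumes "psd n A" "B \<in> carrier_mat n m"
  shows "psd m (mat_adjoint B * A * B)"
  using assms herm_mat_congruence[of n A B m] 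
  by (auto simp: psd_iff quad_form_congruence[of _ n _ m] herm_mat_def)

lemma psd_minus_iff: "psd n (B - A) \<longleftrightarrow> loewner_le n A B"
  if "herm_mat n A" "herm_mat n B"
  using that herm_mat_minus[OF that(2,1)] by (auto simp: psd_iff loewner_le_def herm_mat_def quad_form_minus[of _ n])

lemma psd_add: "psd n A \<Longrightarrow> psd n B \<Longrightarrow> psd n (A + B)"
  by (auto simp: psd_iff herm_mat_add quad_form_add[of _ n] herm_mat_def mat_adjoint_add[of _ n n])

lemma psd_smult: "psd n A \<Longrightarrow> 0 \<le> a \<Longrightarrow> psd n (complex_of_real a \<cdot>\<^sub>m A)"
  by (auto simp: psd_iff herm_mat_smult quad_form_smult[of _ n] herm_mat_def)

lemma psd_one [simp]: "psd n (1\<^sub>m n)"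
  by (auto simp: psd_iff)

lemma psd_gram: "B \<in> carrier_mat m n \<Longrightarrow> psd n (mat_adjoint B * B)"
  using psd_congruence[OF psd_one, of B m n] by (simp add: right_mult_one_mat[of _ n m])

lemma psd_diag: "(\<And>i. i < n \<Longrightarrow> 0 \<le> f i) \<Longrightarrow> psd n (mat_diag n (\<lambda>i. complex_of_real (f i)))"
  by (auto simp: psd_iff herm_mat_def quad_form_diag intro!: sum_nonneg)

section \<open>Diagonalisation by congruence\<close>

lemma invertible_of_injective:
  fixes A :: "complex mat"
  assumes A: "A \<in> carrier_mat n n"
    and inj: "\<And>v. v \<in> carrier_vec n \<Longrightarrow> A *\<^sub>v v = 0\<^sub>v n \<Longrightarrow> v = 0\<^sub>v n"
  obtains B where "B \<in> carrier_mat n n" "A * B = 1\<^sub>m n" "B * A = 1\<^sub>m n"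
proof -
  have d: "Determinant.det A \<noteq> 0" using inj det_0_iff_vec_prod_zero[OF A] by blast
  let ?B = "(1 / Determinant.det A) \<cdot>\<^sub>m adj_mat A"
  have "A * ?B = 1\<^sub>m n" "?B * A = 1\<^sub>m n" 
    using adj_mat[OF A] A d by (auto simp: mult_smult_distrib[of _ n n _ n] mult_smult_assoc_mat[of _ n n _ n] intro!: eq_matI)
  moreover have "?B \<in> carrier_mat n n" using adj_mat[OF A] by simp
  ultimately show ?thesis using that by blast
qed

lemma mult_mat_vec_zero [simp]: "A \<in> carrier_mat m n \<Longrightarrow> A *\<^sub>v 0\<^sub>v n = (0\<^sub>v m :: complex vec)"
  by (rule eq_vecI) auto

lemma congruence_index:
  fixes M T :: "complex mat"
  assumes "M \<in> carrier_mat n n" "T \<in> carrier_mat n m" "i < m" "j < m"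
  shows "(mat_adjoint T * M * T) $$ (i,j) = (M *\<^sub>v col T j) \<bullet>c col T i"
proof -
  have "(mat_adjoint T * M * T) $$ (i,j) = (mat_adjoint T * (M * T)) $$ (i,j)"
    using assms by (simp add: assoc_mult_mat[of _ m n _ n _ m])
  also have "\<dots> = row (mat_adjoint T) i \<bullet> col (M * T) j" using assms by auto
  also have "col (M * T) j = M *\<^sub>v col T j" using assms by (intro eq_vecI) auto
  also have "row (mat_adjoint T) i = conjugate (col T i)" using assms by (intro eq_vecI) auto
  also have "conjugate (col T i) \<bullet> (M *\<^sub>v col T j) = (M *\<^sub>v col T j) \<bullet>c col T i"
    using assms by (intro comm_scalar_prod[of _ n]) (simp_all add: carrier_dim_vec)
  finally show ?thesis .
qed

lemma cinner_commute: "v \<in> carrier_vec n \<Longrightarrow> w \<in> carrier_vec n \<Longrightarrow> v \<bullet>c w = cnj (w \<bullet>c v)"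
  for v w :: "complex vec"
  by (simp add: cinner_sum mult.commute)

lemma cinner_smult_left: "v \<in> carrier_vec n \<Longrightarrow> w \<in> carrier_vec n \<Longrightarrow> (a \<cdot>\<^sub>v v) \<bullet>c w = a * (v \<bullet>c w)"
  for v w :: "complex vec"
  by (simp add: cinner_sum[of _ n] sum_distrib_left mult.assoc)

lemma vec_nonzero_entry:
  fixes v :: "complex vec"
  assumes "v \<in> carrier_vec n" "v \<noteq> 0\<^sub>v n"
  obtains k where "k < n" "v $ k \<noteq> 0"
proof -
  have "\<exists>k<n. v $ k \<noteq> 0"
  proof (rule ccontr)
    assume "\<not> ?thesis"
    then have "v = 0\<^sub>v n" using assms(1) by (intro eq_vecI) auto
    then show False using assms(2) by blast
  qed
  then show ?thesis using that by blast
qed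

text \<open>The matrix \<open>M\<^sup>*\<close> is injective because \<open>\<langle>M v, v\<rangle> \<noteq> 0\<close>, so \<open>(M\<^sup>*)\<^sup>-\<^sup>1 M\<close> exists and has an eigenvector.\<close>
lemma generalized_eigenvector:
  fixes M :: "complex mat"
  assumes M: "M \<in> carrier_mat n n" and n: "0 < n"
    and pos: "\<And>v. v \<in> carrier_vec n \<Longrightarrow> v \<noteq> 0\<^sub>v n \<Longrightarrow> 0 < Im ((M *\<^sub>v v) \<bullet>c v)"
  obtains v l where "v \<in> carrier_vec n" "v \<noteq> 0\<^sub>v n" "M *\<^sub>v v = l \<cdot>\<^sub>v (mat_adjoint M *\<^sub>v v)"
proof -
  have inj: "v = 0\<^sub>v n" if v: "v \<in> carrier_vec n" and "mat_adjoint M *\<^sub>v v = 0\<^sub>v n" for v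
  proof (rule ccontr)
    assume "v \<noteq> 0\<^sub>v n"
    then have "0 < Im ((M *\<^sub>v v) \<bullet>c v)" using pos v by blast
    also have "(M *\<^sub>v v) \<bullet>c v = v \<bullet>c 0\<^sub>v n" using cinner_adjoint[OF M v v] that(2) by simp
    also have "\<dots> = 0" using v by (simp add: cinner_sum[of _ n])
    finally show False by simp
  qed
  obtain W where W: "W \<in> carrier_mat n n" "mat_adjoint M * W = 1\<^sub>m n" "W * mat_adjoint M = 1\<^sub>m n"
    using invertible_of_injective[of "mat_adjoint M" n, OF _ inj] M unfolding mat_adjoint_carrier by blast
  have K: "W * M \<in> carrier_mat n n" using W M by simp
  obtain l where "eigenvalue (W * M) l" using spectrum_non_empty[OF K n] by (auto simp: spectrum_def)
  then obtain v where v: "v \<in> carrier_vec n" "v \<noteq> 0\<^sub>v n" "(W * M) *\<^sub>v v = l \<cdot>\<^sub>v v"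
    using K unfolding eigenvalue_def eigenvector_def by auto
  have "M *\<^sub>v v = (1\<^sub>m n * M) *\<^sub>v v" using M by simp
  also have "\<dots> = (mat_adjoint M * (W * M)) *\<^sub>v v" 
    unfolding W(2)[symmetric] using assoc_mult_mat[of "mat_adjoint M" n n W n M n] W(1) M by simp
  also have "\<dots> = mat_adjoint M *\<^sub>v ((W * M) *\<^sub>v v)"
    by (rule assoc_mult_mat_vec[of _ n n]) (use M K v in auto)
  also have "\<dots> = l \<cdot>\<^sub>v (mat_adjoint M *\<^sub>v v)" using v M by (simp add: mult_mat_vec[of _ n n])
  finally show ?thesis using that v by blast
qed

text \<open>A vector \<open>v\<close> with \<open>M v = l M\<^sup>* v\<close> splits off a one-dimensional block: on the kernel of \<open>w \<mapsto> \<langle>M w, v\<rangle>\<close>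
  also \<open>\<langle>M v, w\<rangle>\<close> vanishes, and \<open>v\<close> does not lie in this kernel.\<close>
lemma deflation:
  fixes M :: "complex mat"
  assumes M: "M \<in> carrier_mat (Suc m) (Suc m)"
    and pos: "\<And>v. v \<in> carrier_vec (Suc m) \<Longrightarrow> v \<noteq> 0\<^sub>v (Suc m) \<Longrightarrow> 0 < Im ((M *\<^sub>v v) \<bullet>c v)"
  obtains T where "T \<in> carrier_mat (Suc m) (Suc m)"
    "\<And>x. x \<in> carrier_vec (Suc m) \<Longrightarrow> T *\<^sub>v x = 0\<^sub>v (Suc m) \<Longrightarrow> x = 0\<^sub>v (Suc m)"
    "\<And>j. 0 < j \<Longrightarrow> j < Suc m \<Longrightarrow> (mat_adjoint T * M * T) $$ (0, j) = 0"
    "\<And>j. 0 < j \<Longrightarrow> j < Suc m \<Longrightarrow> (mat_adjoint T * M * T) $$ (j, 0) = 0"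
proof -
  let ?n = "Suc m"
  obtain v l where v: "v \<in> carrier_vec ?n" "v \<noteq> 0\<^sub>v ?n" "M *\<^sub>v v = l \<cdot>\<^sub>v (mat_adjoint M *\<^sub>v v)"
    using generalized_eigenvector[OF M _ pos] by auto
  define f where "f w = (M *\<^sub>v w) \<bullet>c v" for w
  have fv: "f v \<noteq> 0" using pos[OF v(1,2)] by (auto simp: f_def)
  obtain k where k: "k < ?n" "v $ k \<noteq> 0"
    using vec_nonzero_entry[OF v(1,2)] .
  \<comment> \<open>For positive \<open>j\<close> the index \<open>s j\<close> runs through all indices except \<open>k\<close>, and \<open>c j\<close> is chosen to put \<open>w j\<close> into the kernel of \<open>f\<close>.\<close>
  define s where "s j = (if j \<le> k then j - 1 else j)" for j :: nat
  define c where "c j = f (unit_vec ?n (s j)) / f v" for j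
  define w where "w j = (if j = 0 then v else unit_vec ?n (s j) - c j \<cdot>\<^sub>v v)" for j
  define T where "T = mat ?n ?n (\<lambda>(i,j). w j $ i)"
  have T: "T \<in> carrier_mat ?n ?n" by (simp add: T_def)
  have wc: "w j \<in> carrier_vec ?n" for j using v(1) by (auto simp: w_def)
  have colT: "col T j = w j" if "j < ?n" for j using that wc[of j] by (auto simp: T_def)
  have fw: "f (w j) = 0" if "0 < j" "j < ?n" for j
  proof -
    have "M *\<^sub>v w j = M *\<^sub>v unit_vec ?n (s j) - c j \<cdot>\<^sub>v (M *\<^sub>v v)"
      using that M v(1) by (auto simp: w_def mult_minus_distrib_mat_vec[of M ?n ?n] mult_mat_vec[of M ?n ?n])
    then have "f (w j) = f (unit_vec ?n (s j)) - c j * f v"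
      unfolding f_def using M v(1) by (simp add: minus_scalar_prod_distrib[of _ ?n] cinner_smult_left[of _ ?n])
    then show ?thesis using fv by (simp add: c_def)
  qed
  have r0: "(mat_adjoint T * M * T) $$ (0, j) = 0" if "0 < j" "j < ?n" for j
    using fw[OF that] that by (subst congruence_index[OF M T]) (auto simp: colT f_def w_def)
  have c0: "(mat_adjoint T * M * T) $$ (j, 0) = 0" if "0 < j" "j < ?n" for j
  proof -
    have "(mat_adjoint T * M * T) $$ (j, 0) = (M *\<^sub>v v) \<bullet>c w j"
      using that by (subst congruence_index[OF M T]) (auto simp: colT w_def)
    also have "\<dots> = l * ((mat_adjoint M *\<^sub>v v) \<bullet>c w j)" 
      unfolding v(3) using M v(1) wc[of j] by (intro cinner_smult_left[of _ ?n]) auto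
    also have "(mat_adjoint M *\<^sub>v v) \<bullet>c w j = v \<bullet>c (M *\<^sub>v w j)" 
      using M v(1) wc[of j] by (subst cinner_adjoint[of _ ?n ?n]) auto
    also have "\<dots> = cnj (f (w j))" unfolding f_def using M v(1) wc[of j] by (intro cinner_commute[of _ ?n]) auto
    finally show ?thesis using fw[OF that] by simp
  qed
  have inj: "x = 0\<^sub>v ?n" if x: "x \<in> carrier_vec ?n" and Tx: "T *\<^sub>v x = 0\<^sub>v ?n" for x
  proof -
    have TM: "mat_adjoint T * M \<in> carrier_mat ?n ?n" using T M by simp
    have "(mat_adjoint T * M * T) *\<^sub>v x = (mat_adjoint T * M) *\<^sub>v (T *\<^sub>v x)"
      using T TM x by (intro assoc_mult_mat_vec)
    also have "\<dots> = 0\<^sub>v ?n" unfolding Tx using TM by simp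
    finally have "((mat_adjoint T * M * T) *\<^sub>v x) $ 0 = 0" by simp
    also have "((mat_adjoint T * M * T) *\<^sub>v x) $ 0 = (\<Sum>j<?n. (mat_adjoint T * M * T) $$ (0,j) * x $ j)"
      using T M x by (auto simp: scalar_prod_def atLeast0LessThan)
    also have "\<dots> = (mat_adjoint T * M * T) $$ (0,0) * x $ 0"
      using r0 by (subst sum.lessThan_Suc_shift) (auto intro!: sum.neutral)
    also have "(mat_adjoint T * M * T) $$ (0,0) = f v" 
      by (subst congruence_index[OF M T]) (auto simp: colT w_def f_def)
    finally have x0: "x $ 0 = 0" using fv by simp
    have ent: "(\<Sum>j<m. x $ Suc j * w (Suc j) $ i) = 0" if i: "i < ?n" for i
    proof -
      have "(T *\<^sub>v x) $ i = (\<Sum>j<?n. T $$ (i,j) * x $ j)"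
        using T x i by (auto simp: scalar_prod_def atLeast0LessThan)
      also have "\<dots> = (\<Sum>j<?n. x $ j * w j $ i)" using i by (intro sum.cong) (auto simp: T_def)
      also have "\<dots> = (\<Sum>j<m. x $ Suc j * w (Suc j) $ i)" using x0 by (subst sum.lessThan_Suc_shift) simp
      finally show ?thesis using Tx i by simp
    qed
    define q where "q = (\<Sum>j<m. x $ Suc j * c (Suc j))"
    have wS: "w (Suc j) $ i = (if i = s (Suc j) then 1 else 0) - c (Suc j) * v $ i" if "i < ?n" "j < m" for i j
      using that v(1) by (auto simp: w_def unit_vec_def)
    have ent': "(\<Sum>j<m. if i = s (Suc j) then x $ Suc j else 0) = v $ i * q" if i: "i < ?n" for i
    proof -
      have "(\<Sum>j<m. x $ Suc j * w (Suc j) $ i) = (\<Sum>j<m. (if i = s (Suc j) then x $ Suc j else 0) - v $ i * (x $ Suc j * c (Suc j)))"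
        using i by (intro sum.cong) (auto simp: wS algebra_simps)
      with ent[OF i] show ?thesis by (simp add: sum_subtractf q_def sum_distrib_left)
    qed
    have sk: "s (Suc j) \<noteq> k" for j by (auto simp: s_def)
    have "(\<Sum>j<m. if k = s (Suc j) then x $ Suc j else 0) = 0" by (intro sum.neutral ballI) (metis sk)
    then have "v $ k * q = 0" using ent'[OF k(1)] by simp
    then have q0: "q = 0" using k by simp
    have xS: "x $ Suc j0 = 0" if j0: "j0 < m" for j0
    proof -
      have si: "s (Suc j0) = s (Suc j) \<longleftrightarrow> j = j0" for j by (auto simp: s_def split: if_splits)
      have "s (Suc j0) < ?n" using j0 k by (auto simp: s_def)
      from ent'[OF this] q0 have "(\<Sum>j<m. if j = j0 then x $ Suc j else 0) = 0"
        by (simp add: si)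
      then show ?thesis using j0 by simp
    qed
    show ?thesis
    proof (rule eq_vecI)
      fix i assume "i < dim_vec (0\<^sub>v ?n :: complex vec)"
      then show "x $ i = 0\<^sub>v ?n $ i" using x0 xS by (cases i) auto
    qed (use x in auto)
  qed
  show ?thesis using that[OF T inj r0 c0] by blast
qed

text \<open>This is the simultaneous diagonalisation of the real and the imaginary part by congruence,
  obtained here by splitting off one dimension at a time.\<close>
lemma positive_im_congruence_diagonal:
  fixes M :: "complex mat"
  assumes "M \<in> carrier_mat n n"
    and "\<And>v. v \<in> carrier_vec n \<Longrightarrow> v \<noteq> 0\<^sub>v n \<Longrightarrow> 0 < Im ((M *\<^sub>v v) \<bullet>c v)"
  shows "\<exists>T d. T \<in> carrier_mat n n \<and> (\<forall>x\<in>carrier_vec n. T *\<^sub>v x = 0\<^sub>v n \<longrightarrow> x = 0\<^sub>v n) \<and>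
     mat_adjoint T * M * T = mat_diag n d"
  using assms
proof (induction n arbitrary: M)
  case 0
  show ?case by (intro exI[of _ "1\<^sub>m 0"] exI[of _ "\<lambda>_. 0"]) (use 0 in \<open>auto intro!: eq_matI eq_vecI simp: mat_diag_def\<close>)
next
  case (Suc m)
  let ?n = "Suc m"
  note M = Suc.prems(1)
  obtain T where T: "T \<in> carrier_mat ?n ?n"
    and inj: "\<And>x. x \<in> carrier_vec ?n \<Longrightarrow> T *\<^sub>v x = 0\<^sub>v ?n \<Longrightarrow> x = 0\<^sub>v ?n"
    and r0: "\<And>j. 0 < j \<Longrightarrow> j < ?n \<Longrightarrow> (mat_adjoint T * M * T) $$ (0, j) = 0"
    and c0: "\<And>j. 0 < j \<Longrightarrow> j < ?n \<Longrightarrow> (mat_adjoint T * M * T) $$ (j, 0) = 0"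
    using deflation[OF Suc.prems] by metis
  define G where "G = mat_adjoint T * M * T"
  have G: "G \<in> carrier_mat ?n ?n" using T M by (simp add: G_def)
  define g where "g = G $$ (0,0)"
  define G' where "G' = mat m m (\<lambda>(i,j). G $$ (Suc i, Suc j))"
  have G': "G' \<in> carrier_mat m m" by (simp add: G'_def)
  have Gblock: "G = four_block_mat (mat 1 1 (\<lambda>_. g)) (0\<^sub>m 1 m) (0\<^sub>m m 1) G'"
    using G r0 c0 by (intro eq_matI) (auto simp: G'_def g_def G_def[symmetric] less_Suc_eq_0_disj)
  have posG': "0 < Im ((G' *\<^sub>v x) \<bullet>c x)" if x: "x \<in> carrier_vec m" "x \<noteq> 0\<^sub>v m" for x
  proof -
    define y where "y = vec ?n (\<lambda>i. if i = 0 then 0 else x $ (i - 1))"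
    have y: "y \<in> carrier_vec ?n" by (simp add: y_def)
    obtain i where "i < m" "x $ i \<noteq> 0" using vec_nonzero_entry[OF x] .
    then have "y $ Suc i \<noteq> 0" "Suc i < ?n" by (auto simp: y_def)
    then have "y \<noteq> 0\<^sub>v ?n" by (metis index_zero_vec(1))
    then have "T *\<^sub>v y \<noteq> 0\<^sub>v ?n" using inj y by blast
    then have "0 < Im ((M *\<^sub>v (T *\<^sub>v y)) \<bullet>c (T *\<^sub>v y))" using Suc.prems(2) T y by simp
    also have "(M *\<^sub>v (T *\<^sub>v y)) \<bullet>c (T *\<^sub>v y) = (G *\<^sub>v y) \<bullet>c y"
    proof -
      have "G *\<^sub>v y = mat_adjoint T *\<^sub>v (M *\<^sub>v (T *\<^sub>v y))"
        unfolding G_def using T M y assoc_mult_mat_vec[of "mat_adjoint T * M" ?n ?n T ?n y]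
          assoc_mult_mat_vec[of "mat_adjoint T" ?n ?n M ?n "T *\<^sub>v y"] by simp
      then show ?thesis using cinner_adjoint[of "mat_adjoint T" ?n ?n "M *\<^sub>v (T *\<^sub>v y)" y] T M y by simp
    qed
    also have "(G *\<^sub>v y) \<bullet>c y = (\<Sum>i<?n. (\<Sum>j<?n. G $$ (i,j) * y $ j) * cnj (y $ i))"
      using G y by (subst cinner_sum[of _ ?n]) (auto simp: scalar_prod_def atLeast0LessThan)
    also have "\<dots> = (\<Sum>i<m. (\<Sum>j<m. G' $$ (i,j) * x $ j) * cnj (x $ i))"
      by (subst sum.lessThan_Suc_shift, subst (2) sum.lessThan_Suc_shift) (simp add: y_def G'_def)
    also have "\<dots> = (G' *\<^sub>v x) \<bullet>c x"
      using G' x by (subst cinner_sum[of _ m]) (auto simp: scalar_prod_def atLeast0LessThan)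
    finally show ?thesis .
  qed
  from Suc.IH[OF G' posG'] obtain S d where S: "S \<in> carrier_mat m m"
    and injS: "\<And>x. x \<in> carrier_vec m \<Longrightarrow> S *\<^sub>v x = 0\<^sub>v m \<Longrightarrow> x = 0\<^sub>v m"
    and Sd: "mat_adjoint S * G' * S = mat_diag m d" by blast
  define T2 where "T2 = four_block_mat (1\<^sub>m 1) (0\<^sub>m 1 m) (0\<^sub>m m 1) S"
  have T2: "T2 \<in> carrier_mat ?n ?n" using four_block_carrier_mat[OF one_carrier_mat[of 1] S] by (simp add: T2_def)
  have aT2: "mat_adjoint T2 = four_block_mat (1\<^sub>m 1) (0\<^sub>m 1 m) (0\<^sub>m m 1) (mat_adjoint S)"
    unfolding T2_def using S by (intro eq_matI) auto
  have mG: "mat 1 1 (\<lambda>_. g) \<in> carrier_mat 1 1" by simp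
  have aS: "mat_adjoint S \<in> carrier_mat m m" "mat_adjoint S * G' \<in> carrier_mat m m" using S G' by auto
  have "mat_adjoint T2 * G * T2 = four_block_mat (mat 1 1 (\<lambda>_. g)) (0\<^sub>m 1 m) (0\<^sub>m m 1) (mat_adjoint S * G' * S)"
    unfolding aT2 unfolding Gblock T2_def using S G' aS mG
    by (subst mult_four_block_mat[OF one_carrier_mat zero_carrier_mat zero_carrier_mat aS(1) mG zero_carrier_mat zero_carrier_mat G'],
        subst mult_four_block_mat[of _ 1 1 _ m _ m _ _ 1 _ m]) (auto simp: Sd)
  also have "\<dots> = mat_diag ?n (\<lambda>i. if i = 0 then g else d (i - 1))"
    unfolding Sd by (intro eq_matI) (auto simp: mat_diag_def)
  finally have D: "mat_adjoint T2 * G * T2 = mat_diag ?n (\<lambda>i. if i = 0 then g else d (i - 1))" .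
  have "mat_adjoint (T * T2) * M * (T * T2) = mat_adjoint T2 * G * T2"
    unfolding G_def using T T2 M
    by (simp add: mat_adjoint_mult[OF T T2] assoc_mult_mat[of _ ?n ?n _ ?n _ ?n])
  moreover have "x = 0\<^sub>v ?n" if x: "x \<in> carrier_vec ?n" and "(T * T2) *\<^sub>v x = 0\<^sub>v ?n" for x
  proof -
    have "T *\<^sub>v (T2 *\<^sub>v x) = 0\<^sub>v ?n" using that T T2 by simp
    then have t2: "T2 *\<^sub>v x = 0\<^sub>v ?n" using inj T2 x by simp
    define x' where "x' = vec m (\<lambda>i. x $ Suc i)"
    have e: "(\<Sum>j<?n. T2 $$ (i,j) * x $ j) = 0" if "i < ?n" for i
    proof -
      have "(T2 *\<^sub>v x) $ i = (\<Sum>j<?n. T2 $$ (i,j) * x $ j)" using that T2 x by (auto simp: scalar_prod_def atLeast0LessThan)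
      then show ?thesis using t2 that by simp
    qed
    have "x $ 0 = 0" using e[of 0] S unfolding sum.lessThan_Suc_shift by (simp add: T2_def)
    moreover have "S *\<^sub>v x' = 0\<^sub>v m"
    proof (rule eq_vecI)
      fix i assume "i < dim_vec (0\<^sub>v m :: complex vec)"
      then show "(S *\<^sub>v x') $ i = 0\<^sub>v m $ i" using e[of "Suc i"] S 
        unfolding sum.lessThan_Suc_shift by (auto simp: T2_def x'_def scalar_prod_def atLeast0LessThan)
    qed (use S in auto)
    then have "x' = 0\<^sub>v m" using injS by (simp add: x'_def)
    then have "x $ Suc i = 0" if "i < m" for i using that unfolding x'_def by (metis index_vec index_zero_vec(1))
    ultimately show ?thesis using x by (intro eq_vecI) (auto simp: less_Suc_eq_0_disj)
  qed
  ultimately show ?case using D T T2 mult_carrier_mat[OF T T2] by metis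
qed

section \<open>Traces and the Hilbert--Schmidt inner product\<close>

lemma mat_trace_add: "A \<in> carrier_mat n n \<Longrightarrow> B \<in> carrier_mat n n \<Longrightarrow> mat_trace (A + B) = mat_trace A + mat_trace B"
  by (simp add: mat_trace_def sum.distrib)

lemma mat_trace_minus: "A \<in> carrier_mat n n \<Longrightarrow> B \<in> carrier_mat n n \<Longrightarrow> mat_trace (A - B) = mat_trace A - mat_trace B"
  by (simp add: mat_trace_def sum_subtractf)

lemma mat_trace_smult: "A \<in> carrier_mat n n \<Longrightarrow> mat_trace (a \<cdot>\<^sub>m A) = a * mat_trace A"
  by (simp add: mat_trace_def sum_distrib_left)

lemma mat_trace_adjoint: "A \<in> carrier_mat n n \<Longrightarrow> mat_trace (mat_adjoint A) = cnj (mat_trace A)"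
  by (simp add: mat_trace_def)

lemma mat_trace_one [simp]: "mat_trace (1\<^sub>m n) = of_nat n"
  by (simp add: mat_trace_def)

lemma mat_trace_mult_sum:
  "A \<in> carrier_mat n m \<Longrightarrow> B \<in> carrier_mat m n \<Longrightarrow> mat_trace (A * B) = (\<Sum>i<n. \<Sum>j<m. A $$ (i,j) * B $$ (j,i))"
  by (auto simp: mat_trace_def scalar_prod_def atLeast0LessThan)

lemma mat_trace_commute:
  assumes "A \<in> carrier_mat n m" "B \<in> carrier_mat m n"
  shows "mat_trace (A * B) = mat_trace (B * A)"
  unfolding mat_trace_mult_sum[OF assms] mat_trace_mult_sum[OF assms(2,1)]
  by (subst sum.swap) (simp add: mult.commute)

lemma mat_trace_quad_form:
  assumes "A \<in> carrier_mat n n"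
  shows "Re (mat_trace A) = (\<Sum>i<n. quad_form A (unit_vec n i))"
proof -
  have "quad_form A (unit_vec n i) = Re (A $$ (i,i))" if "i < n" for i
  proof -
    have "A *\<^sub>v unit_vec n i = col A i" using assms that by (intro eq_vecI) auto
    then have "(A *\<^sub>v unit_vec n i) \<bullet>c unit_vec n i = (\<Sum>k<n. A $$ (k,i) * cnj (if k = i then 1 else 0))"
      using assms that by (subst cinner_sum[of _ n]) auto
    also have "\<dots> = (\<Sum>k<n. if k = i then A $$ (k,i) else 0)" by (intro sum.cong) auto
    finally have "(A *\<^sub>v unit_vec n i) \<bullet>c unit_vec n i = A $$ (i,i)" using that by simp
    then show ?thesis using that by (simp add: quad_form_def)
  qed
  then show ?thesis using assms by (simp add: mat_trace_def)
qed

lemma psd_trace_nonneg: "psd n A \<Longrightarrow> 0 \<le> Re (mat_trace A)"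
  by (auto simp: mat_trace_quad_form[OF psd_carrier] psd_iff intro!: sum_nonneg)

lemma herm_trace_real: "herm_mat n A \<Longrightarrow> Im (mat_trace A) = 0"
  using mat_trace_adjoint[of A n] unfolding herm_mat_def by (metis complex_cnj_cancel_iff cnj.simps(2) neg_equal_zero)

lemma mat_trace_diag_mult:
  assumes "A \<in> carrier_mat n n"
  shows "mat_trace (mat_diag n f * A) = (\<Sum>i<n. f i * A $$ (i,i))"
  using assms by (simp add: mat_diag_mult_left mat_trace_def)

lemma quad_form_im:
  assumes "herm_mat n A" "v \<in> carrier_vec n"
  shows "Im ((A *\<^sub>v v) \<bullet>c v) = 0"
proof -
  have A: "A \<in> carrier_mat n n" "mat_adjoint A = A" using assms by (auto simp: herm_mat_def)
  have "(A *\<^sub>v v) \<bullet>c v = v \<bullet>c (A *\<^sub>v v)" using cinner_adjoint[OF A(1) assms(2) assms(2)] A(2) by simp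
  also have "\<dots> = cnj ((A *\<^sub>v v) \<bullet>c v)" using A assms(2) by (intro cinner_commute[of _ n]) auto
  finally show ?thesis by (metis cnj.simps(2) neg_equal_zero)
qed

text \<open>Up to an arbitrarily small multiple of the identity, \<open>X\<close> has the form \<open>B\<^sup>* d B\<close> with \<open>d\<close> diagonal and positive, and
  the trace of \<open>B\<^sup>* d B Y\<close> is the sum of the products of \<open>d\<^sub>i\<close> with the diagonal entries of \<open>B Y B\<^sup>*\<close>.\<close>
lemma psd_trace_mult_nonneg:
  assumes X: "psd n X" and Y: "psd n Y"
  shows "0 \<le> Re (mat_trace (X * Y))"
proof -
  have Xc: "X \<in> carrier_mat n n" and Yc: "Y \<in> carrier_mat n n" using X Y psd_carrier by auto
  have main: "0 \<le> Re (mat_trace (X * Y)) + e * Re (mat_trace Y)" if e: "0 < e" for e :: real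
  proof -
    define Z where "Z = X + complex_of_real e \<cdot>\<^sub>m 1\<^sub>m n"
    have Z: "Z \<in> carrier_mat n n" "herm_mat n Z"
      using X unfolding Z_def by (auto simp: psd_iff herm_mat_add herm_mat_smult herm_mat_def mat_adjoint_add[of _ n n])
    have qZ: "0 < quad_form Z v" if "v \<in> carrier_vec n" "v \<noteq> 0\<^sub>v n" for v
    proof -
      have "quad_form Z v = quad_form X v + e * (vnorm v)\<^sup>2"
        unfolding Z_def using that Xc by (simp add: quad_form_add[of _ n] quad_form_scalar)
      moreover have "0 \<le> quad_form X v" using X that by (simp add: psd_iff)
      ultimately show ?thesis using e vnorm_pos[OF that] by (simp add: add_nonneg_pos)
    qed
    \<comment> \<open>Diagonalisation by congruence asks for a positive imaginary part, hence the factor \<open>\<i>\<close>.\<close>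
    have pos: "0 < Im (((\<i> \<cdot>\<^sub>m Z) *\<^sub>v v) \<bullet>c v)" if "v \<in> carrier_vec n" "v \<noteq> 0\<^sub>v n" for v
    proof -
      have "(\<i> \<cdot>\<^sub>m Z) *\<^sub>v v = \<i> \<cdot>\<^sub>v (Z *\<^sub>v v)" using Z that by (intro eq_vecI) auto
      then have "((\<i> \<cdot>\<^sub>m Z) *\<^sub>v v) \<bullet>c v = \<i> * ((Z *\<^sub>v v) \<bullet>c v)"
        using Z that by (simp add: cinner_smult_left[of _ n])
      then show ?thesis using qZ[OF that] by (simp add: quad_form_def)
    qed
    have iZ: "\<i> \<cdot>\<^sub>m Z \<in> carrier_mat n n" using Z by simp
    obtain T d where T: "T \<in> carrier_mat n n" and inj: "\<forall>x\<in>carrier_vec n. T *\<^sub>v x = 0\<^sub>v n \<longrightarrow> x = 0\<^sub>v n"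
      and Td: "mat_adjoint T * (\<i> \<cdot>\<^sub>m Z) * T = mat_diag n d"
      using positive_im_congruence_diagonal[OF iZ pos] by blast
    obtain B where B: "B \<in> carrier_mat n n" "T * B = 1\<^sub>m n" "B * T = 1\<^sub>m n"
      using invertible_of_injective[OF T] inj by blast
    have aB: "mat_adjoint B * mat_adjoint T = 1\<^sub>m n"
      using B T by (simp add: mat_adjoint_mult[OF T B(1), symmetric])
    note assoc = assoc_mult_mat[of _ n n _ n _ n]
    have TZT: "mat_adjoint T * Z * T = mat_diag n (\<lambda>i. - \<i> * d i)"
    proof -
      have "mat_adjoint T * (\<i> \<cdot>\<^sub>m Z) * T = \<i> \<cdot>\<^sub>m (mat_adjoint T * Z * T)"
        using T Z by (simp add: mult_smult_distrib[of _ n n _ n] mult_smult_assoc_mat[of _ n n _ n])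
      with Td have e: "\<i> \<cdot>\<^sub>m (mat_adjoint T * Z * T) = mat_diag n d" by simp
      show ?thesis
      proof (rule eq_matI)
        fix i j assume ij: "i < dim_row (mat_diag n (\<lambda>i. - \<i> * d i))" "j < dim_col (mat_diag n (\<lambda>i. - \<i> * d i))"
        then have "\<i> * (mat_adjoint T * Z * T) $$ (i,j) = mat_diag n d $$ (i,j)" 
          using e T Z by (metis (no_types, lifting) carrier_matD index_smult_mat(1) mat_adjoint_dim(1) index_mult_mat(2,3) mat_diag_dim)
        then show "(mat_adjoint T * Z * T) $$ (i,j) = mat_diag n (\<lambda>i. - \<i> * d i) $$ (i,j)"
          using ij by (auto simp: mat_diag_def complex_eq_iff)
      qed (use T in \<open>auto simp: mat_diag_def\<close>)
    qed
    have Zd: "Z = mat_adjoint B * mat_diag n (\<lambda>i. - \<i> * d i) * B"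
    proof -
      have "mat_adjoint B * (mat_adjoint T * Z * T) * B = (mat_adjoint B * mat_adjoint T) * Z * (T * B)"
        using T B(1) Z by (simp add: assoc)
      then show ?thesis unfolding TZT aB B(2) using Z by simp
    qed
    have dpos: "0 < Re (- \<i> * d i)" if "i < n" for i
    proof -
      have c: "col T i \<in> carrier_vec n" using T that by auto
      have "T *\<^sub>v unit_vec n i \<noteq> 0\<^sub>v n" using inj that by (metis unit_vec_carrier unit_vec_nonzero)
      moreover have "T *\<^sub>v unit_vec n i = col T i" using T that by (intro eq_vecI) auto
      ultimately have "0 < quad_form Z (col T i)" using qZ c by simp
      also have "quad_form Z (col T i) = Re ((mat_adjoint T * Z * T) $$ (i,i))"
        using that by (simp add: congruence_index[OF Z(1) T] quad_form_def)
      finally show ?thesis unfolding TZT using that by (simp add: mat_diag_def)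
    qed
    have W: "psd n (B * Y * mat_adjoint B)" using psd_congruence[OF Y, of "mat_adjoint B" n] B by simp
    have Wc: "B * Y * mat_adjoint B \<in> carrier_mat n n" using psd_carrier[OF W] .
    define D where "D = mat_diag n (\<lambda>i. - \<i> * d i)"
    have D: "D \<in> carrier_mat n n" by (simp add: D_def)
    have "mat_trace (Z * Y) = mat_trace (mat_adjoint B * (D * B * Y))"
      unfolding Zd D_def[symmetric] using B(1) Yc D by (simp add: assoc)
    also have "\<dots> = mat_trace ((D * B * Y) * mat_adjoint B)"
      using B(1) Yc D by (intro mat_trace_commute[of _ n n]) auto
    also have "\<dots> = mat_trace (D * (B * Y * mat_adjoint B))"
      using B(1) Yc D by (simp add: assoc)
    also have "\<dots> = (\<Sum>i<n. (- \<i> * d i) * (B * Y * mat_adjoint B) $$ (i,i))" unfolding D_def by (rule mat_trace_diag_mult[OF Wc])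
    finally have tr: "mat_trace (Z * Y) = \<dots>" .
    have "0 \<le> Re ((- \<i> * d i) * (B * Y * mat_adjoint B) $$ (i,i))" if "i < n" for i
    proof -
      have ci: "col (mat_adjoint B) i \<in> carrier_vec n" using B that by auto
      have "(B * Y * mat_adjoint B) $$ (i,i) = (Y *\<^sub>v col (mat_adjoint B) i) \<bullet>c col (mat_adjoint B) i"
        using congruence_index[OF Yc, of "mat_adjoint B" n i i] B that by simp
      moreover have "Im \<dots> = 0" using quad_form_im[OF _ ci] Y by (auto simp: psd_iff)
      moreover have "0 \<le> quad_form Y (col (mat_adjoint B) i)" using Y ci by (auto simp: psd_iff)
      ultimately have "Im ((B * Y * mat_adjoint B) $$ (i,i)) = 0" "0 \<le> Re ((B * Y * mat_adjoint B) $$ (i,i))"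
        by (simp_all add: quad_form_def)
      then show ?thesis using dpos[OF that] by (simp del: index_mult_mat)
    qed
    then have "0 \<le> Re (mat_trace (Z * Y))" unfolding tr Re_sum by (intro sum_nonneg) auto
    also have "mat_trace (Z * Y) = mat_trace (X * Y) + complex_of_real e * mat_trace Y"
      unfolding Z_def using Xc Yc
      by (simp add: add_mult_distrib_mat[of _ n n _ _ n] mat_trace_add[of _ n] mult_smult_assoc_mat[of _ n n _ n] mat_trace_smult[of _ n])
    finally show ?thesis by simp
  qed
  show ?thesis
  proof (rule field_le_epsilon)
    fix e :: real assume e: "0 < e"
    define t where "t = Re (mat_trace Y)"
    have t: "0 \<le> t" using psd_trace_nonneg[OF Y] by (simp add: t_def)
    have "0 \<le> Re (mat_trace (X * Y)) + (e / (t + 1)) * t" using main[of "e / (t + 1)"] e t by (simp add: t_def)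
    also have "(e / (t + 1)) * t \<le> e" using e t by (simp add: field_simps)
    finally show "0 \<le> Re (mat_trace (X * Y)) + e" by simp
  qed
qed

definition hs_ip :: "complex mat \<Rightarrow> complex mat \<Rightarrow> complex" where
  "hs_ip A B = mat_trace (mat_adjoint A * B)"

lemma hs_ip_sum:
  assumes "A \<in> carrier_mat n n" "B \<in> carrier_mat n n"
  shows "hs_ip A B = (\<Sum>i<n. \<Sum>j<n. cnj (A $$ (i,j)) * B $$ (i,j))"
proof -
  have "hs_ip A B = (\<Sum>j<n. \<Sum>i<n. cnj (A $$ (i,j)) * B $$ (i,j))"
    unfolding hs_ip_def using assms by (subst mat_trace_mult_sum[of _ n n]) auto
  then show ?thesis by (subst sum.swap) simp
qed

lemma hs_ip_add_right: "A \<in> carrier_mat n n \<Longrightarrow> B \<in> carrier_mat n n \<Longrightarrow> C \<in> carrier_mat n n \<Longrightarrow> hs_ip A (B + C) = hs_ip A B + hs_ip A C"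
  by (simp add: hs_ip_sum[of _ n] sum.distrib algebra_simps)
lemma hs_ip_add_left: "A \<in> carrier_mat n n \<Longrightarrow> B \<in> carrier_mat n n \<Longrightarrow> C \<in> carrier_mat n n \<Longrightarrow> hs_ip (A + B) C = hs_ip A C + hs_ip B C"
  by (simp add: hs_ip_sum[of _ n] sum.distrib algebra_simps)
lemma hs_ip_smult_right: "A \<in> carrier_mat n n \<Longrightarrow> B \<in> carrier_mat n n \<Longrightarrow> hs_ip A (a \<cdot>\<^sub>m B) = a * hs_ip A B"
  by (simp add: hs_ip_sum[of _ n] sum_distrib_left algebra_simps)
lemma hs_ip_smult_left: "A \<in> carrier_mat n n \<Longrightarrow> B \<in> carrier_mat n n \<Longrightarrow> hs_ip (a \<cdot>\<^sub>m A) B = cnj a * hs_ip A B"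
  by (simp add: hs_ip_sum[of _ n] sum_distrib_left algebra_simps)
lemma hs_ip_minus_right: "A \<in> carrier_mat n n \<Longrightarrow> B \<in> carrier_mat n n \<Longrightarrow> C \<in> carrier_mat n n \<Longrightarrow> hs_ip A (B - C) = hs_ip A B - hs_ip A C"
  by (simp add: hs_ip_sum[of _ n] minus_carrier_mat sum_subtractf algebra_simps)
lemma hs_ip_minus_left: "A \<in> carrier_mat n n \<Longrightarrow> B \<in> carrier_mat n n \<Longrightarrow> C \<in> carrier_mat n n \<Longrightarrow> hs_ip (A - B) C = hs_ip A C - hs_ip B C"
  by (simp add: hs_ip_sum[of _ n] minus_carrier_mat sum_subtractf algebra_simps)
lemma hs_ip_commute: "A \<in> carrier_mat n n \<Longrightarrow> B \<in> carrier_mat n n \<Longrightarrow> hs_ip A B = cnj (hs_ip B A)"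
  by (simp add: hs_ip_sum[of _ n] mult.commute)

lemma hs_ip_mult_left:
  assumes "A \<in> carrier_mat n n" "B \<in> carrier_mat n n" "C \<in> carrier_mat n n"
  shows "hs_ip A (C * B) = hs_ip (mat_adjoint C * A) B"
  unfolding hs_ip_def using assms by (simp add: mat_adjoint_mult[of "mat_adjoint C" n n A n] assoc_mult_mat[of _ n n _ n _ n])

lemma hs_ip_mult_right:
  assumes "A \<in> carrier_mat n n" "B \<in> carrier_mat n n" "C \<in> carrier_mat n n"
  shows "hs_ip A (B * C) = hs_ip (A * mat_adjoint C) B"
proof -
  have "hs_ip A (B * C) = mat_trace ((mat_adjoint A * B) * C)"
    unfolding hs_ip_def using assms by (simp add: assoc_mult_mat[of _ n n _ n _ n])
  also have "\<dots> = mat_trace (C * (mat_adjoint A * B))" using assms by (intro mat_trace_commute[of _ n n]) auto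
  also have "\<dots> = hs_ip (A * mat_adjoint C) B" unfolding hs_ip_def
    using assms by (simp add: mat_adjoint_mult[of A n n "mat_adjoint C" n] assoc_mult_mat[of _ n n _ n _ n])
  finally show ?thesis .
qed

lemma hs_ip_psd_nonneg:
  assumes "psd n A" "psd n B"
  shows "0 \<le> Re (hs_ip A B)" "Im (hs_ip A B) = 0"
proof -
  have A: "A \<in> carrier_mat n n" "mat_adjoint A = A" and B: "B \<in> carrier_mat n n" "mat_adjoint B = B"
    using assms by (auto simp: psd_iff herm_mat_def)
  show "0 \<le> Re (hs_ip A B)" using psd_trace_mult_nonneg[OF assms] A by (simp add: hs_ip_def)
  have "hs_ip A B = mat_trace (B * A)" using A B mat_trace_commute[of A n n B] by (simp add: hs_ip_def)
  also have "\<dots> = cnj (hs_ip A B)" using hs_ip_commute[OF A(1) B(1)] B by (simp add: hs_ip_def)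
  finally show "Im (hs_ip A B) = 0" by (metis cnj.simps(2) neg_equal_zero)
qed

definition frob :: "nat \<Rightarrow> complex mat \<Rightarrow> real" where
  "frob n A = L2_set (\<lambda>(i,j). cmod (A $$ (i,j))) ({..<n} \<times> {..<n})"

lemma frob_nonneg [simp]: "0 \<le> frob n A" by (simp add: frob_def)

lemma frob_sq: "(frob n A)\<^sup>2 = (\<Sum>i<n. \<Sum>j<n. (cmod (A $$ (i,j)))\<^sup>2)"
  by (simp add: frob_def L2_set_def sum_nonneg case_prod_unfold sum.cartesian_product)

lemma hs_ip_self: "A \<in> carrier_mat n n \<Longrightarrow> hs_ip A A = of_real ((frob n A)\<^sup>2)"
  by (simp add: hs_ip_sum[of _ n] frob_sq complex_norm_square mult.commute del: of_real_power)

lemma hs_ip_le: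
  assumes "A \<in> carrier_mat n n" "B \<in> carrier_mat n n"
  shows "cmod (hs_ip A B) \<le> frob n A * frob n B"
proof -
  have "hs_ip A B = (\<Sum>(i,j)\<in>{..<n}\<times>{..<n}. cnj (A $$ (i,j)) * B $$ (i,j))"
    by (simp add: hs_ip_sum[OF assms] sum.cartesian_product)
  also have "cmod \<dots> \<le> (\<Sum>p\<in>{..<n}\<times>{..<n}. \<bar>(\<lambda>(i,j). cmod (A $$ (i,j))) p\<bar> * \<bar>(\<lambda>(i,j). cmod (B $$ (i,j))) p\<bar>)"
    by (rule order_trans[OF norm_sum]) (auto simp: norm_mult intro!: sum_mono)
  also have "\<dots> \<le> frob n A * frob n B" unfolding frob_def by (rule L2_set_mult_ineq)
  finally show ?thesis .
qed

lemma frob_entry_le: "i < n \<Longrightarrow> j < n \<Longrightarrow> cmod (A $$ (i,j)) \<le> frob n A"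
  unfolding frob_def using member_le_L2_set[of "{..<n}\<times>{..<n}" "(i,j)" "\<lambda>(i,j). cmod (A $$ (i,j))"] by simp

lemma frob_le_entries:
  assumes "\<And>i j. i < n \<Longrightarrow> j < n \<Longrightarrow> cmod (A $$ (i,j)) \<le> b" "0 \<le> b"
  shows "frob n A \<le> n * b"
proof -
  have "(frob n A)\<^sup>2 \<le> (\<Sum>i<n. \<Sum>j<n. b\<^sup>2)" unfolding frob_sq using assms by (intro sum_mono power_mono) auto
  also have "\<dots> = (n * b)\<^sup>2" by (simp add: power2_eq_square)
  finally show ?thesis using assms(2) by (meson mult_nonneg_nonneg of_nat_0_le_iff power2_le_imp_le)
qed

lemma frob_eq_0: "A \<in> carrier_mat n n \<Longrightarrow> frob n A = 0 \<Longrightarrow> A = 0\<^sub>m n n"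
  using frob_entry_le[of _ n _ A] by (intro eq_matI) auto

lemma frob_smult: "A \<in> carrier_mat n n \<Longrightarrow> frob n (a \<cdot>\<^sub>m A) = cmod a * frob n A"
  by (auto simp: frob_def norm_mult L2_set_right_distrib intro!: L2_set_cong)

lemma frob_triangle:
  assumes "A \<in> carrier_mat n n" "B \<in> carrier_mat n n"
  shows "frob n (A + B) \<le> frob n A + frob n B"
proof -
  have "frob n (A + B) \<le> L2_set (\<lambda>p. (case p of (i,j) \<Rightarrow> cmod (A $$ (i,j))) + (case p of (i,j) \<Rightarrow> cmod (B $$ (i,j)))) ({..<n} \<times> {..<n})"
    unfolding frob_def using assms by (intro L2_set_mono) (auto intro!: norm_triangle_ineq)
  also have "\<dots> \<le> frob n A + frob n B" unfolding frob_def by (rule L2_set_triangle_ineq)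
  finally show ?thesis .
qed

lemma frob_triangle_minus:
  assumes "A \<in> carrier_mat n n" "B \<in> carrier_mat n n"
  shows "frob n (A - B) \<le> frob n A + frob n B" 
proof -
  have "A - B = A + (-1) \<cdot>\<^sub>m B" using assms by (intro eq_matI) auto
  then show ?thesis using frob_triangle[of A n "(-1) \<cdot>\<^sub>m B"] frob_smult[of B n "-1"] assms by simp
qed

lemma frob_triangle_diff:
  assumes "A \<in> carrier_mat n n" "B \<in> carrier_mat n n"
  shows "frob n A \<le> frob n B + frob n (A - B)"
proof -
  have "A = B + (A - B)" using assms by (intro eq_matI) auto
  then show ?thesis using frob_triangle[of B n "A - B"] assms by (metis minus_carrier_mat)
qed

lemma frob_adjoint: "A \<in> carrier_mat n n \<Longrightarrow> frob n (mat_adjoint A) = frob n A"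
proof -
  assume A: "A \<in> carrier_mat n n"
  have "(frob n (mat_adjoint A))\<^sup>2 = (frob n A)\<^sup>2"
    unfolding frob_sq using A by (subst sum.swap) simp
  then show ?thesis by (simp add: power2_eq_iff_nonneg)
qed

lemma frob_cols: "A \<in> carrier_mat n n \<Longrightarrow> (frob n A)\<^sup>2 = (\<Sum>j<n. (vnorm (col A j))\<^sup>2)"
  unfolding frob_sq vnorm_sq by (subst sum.swap) simp

lemma col_mult_vec: "A \<in> carrier_mat n n \<Longrightarrow> B \<in> carrier_mat n n \<Longrightarrow> j < n \<Longrightarrow> col (A * B) j = A *\<^sub>v col B j"
  by (intro eq_vecI) auto

lemma frob_mult_left_le:
  assumes A: "A \<in> carrier_mat n n" and X: "X \<in> carrier_mat n n" and a: "0 \<le> a"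
    and b: "\<And>v. v \<in> carrier_vec n \<Longrightarrow> vnorm (A *\<^sub>v v) \<le> a * vnorm v"
  shows "frob n (A * X) \<le> a * frob n X"
proof -
  have "(frob n (A * X))\<^sup>2 = (\<Sum>j<n. (vnorm (A *\<^sub>v col X j))\<^sup>2)"
    unfolding frob_cols[OF mult_carrier_mat[OF A X]] by (intro sum.cong refl) (simp only: lessThan_iff col_mult_vec[OF A X])
  also have "\<dots> \<le> (\<Sum>j<n. (a * vnorm (col X j))\<^sup>2)" using b X by (intro sum_mono power_mono) auto
  also have "\<dots> = (a * frob n X)\<^sup>2" by (simp add: power_mult_distrib frob_cols[OF X] sum_distrib_left)
  finally show ?thesis using a by (meson frob_nonneg mult_nonneg_nonneg power2_le_imp_le)
qed

lemma frob_mult_left_ge: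
  assumes A: "A \<in> carrier_mat n n" and X: "X \<in> carrier_mat n n" and a: "0 \<le> a"
    and b: "\<And>v. v \<in> carrier_vec n \<Longrightarrow> a * vnorm v \<le> vnorm (A *\<^sub>v v)"
  shows "a * frob n X \<le> frob n (A * X)"
proof -
  have "(a * frob n X)\<^sup>2 = (\<Sum>j<n. (a * vnorm (col X j))\<^sup>2)" by (simp add: power_mult_distrib frob_cols[OF X] sum_distrib_left)
  also have "\<dots> \<le> (\<Sum>j<n. (vnorm (A *\<^sub>v col X j))\<^sup>2)" using b X a by (intro sum_mono power_mono) auto
  also have "\<dots> = (frob n (A * X))\<^sup>2"
    unfolding frob_cols[OF mult_carrier_mat[OF A X]] by (intro sum.cong refl) (simp only: lessThan_iff col_mult_vec[OF A X])
  finally show ?thesis by (meson frob_nonneg power2_le_imp_le)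
qed

lemma frob_mult_right_adjoint:
  "A \<in> carrier_mat n n \<Longrightarrow> X \<in> carrier_mat n n \<Longrightarrow> frob n (X * A) = frob n (mat_adjoint A * mat_adjoint X)"
  by (subst frob_adjoint[symmetric]) (auto simp: mat_adjoint_mult[of _ n n])

lemma frob_sandwich_le:
  assumes A: "A \<in> carrier_mat n n" and X: "X \<in> carrier_mat n n" and a: "0 \<le> a"
    and b: "\<And>v. v \<in> carrier_vec n \<Longrightarrow> vnorm (mat_adjoint A *\<^sub>v v) \<le> a * vnorm v"
  shows "frob n (mat_adjoint A * X * A) \<le> a\<^sup>2 * frob n X"
proof -
  have aA: "mat_adjoint A \<in> carrier_mat n n" using A by simp
  have "frob n (mat_adjoint A * X * A) = frob n (mat_adjoint A * mat_adjoint (mat_adjoint A * X))"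
    using A X by (intro frob_mult_right_adjoint) auto
  also have "\<dots> \<le> a * frob n (mat_adjoint (mat_adjoint A * X))"
    using A X a b by (intro frob_mult_left_le) auto
  also have "\<dots> = a * frob n (mat_adjoint A * X)" using A X by (subst frob_adjoint) auto
  also have "\<dots> \<le> a * (a * frob n X)" using A X a b by (intro mult_left_mono frob_mult_left_le) auto
  finally show ?thesis by (simp add: power2_eq_square mult.assoc)
qed

lemma frob_sandwich_ge:
  assumes A: "A \<in> carrier_mat n n" and X: "X \<in> carrier_mat n n" and a: "0 \<le> a"
    and b: "\<And>v. v \<in> carrier_vec n \<Longrightarrow> a * vnorm v \<le> vnorm (mat_adjoint A *\<^sub>v v)"
  shows "a\<^sup>2 * frob n X \<le> frob n (mat_adjoint A * X * A)"
proof -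
  have aA: "mat_adjoint A \<in> carrier_mat n n" using A by simp
  have "a\<^sup>2 * frob n X = a * (a * frob n X)" by (simp add: power2_eq_square mult.assoc)
  also have "\<dots> \<le> a * frob n (mat_adjoint A * X)" using A X a b by (intro mult_left_mono frob_mult_left_ge) auto
  also have "\<dots> = a * frob n (mat_adjoint (mat_adjoint A * X))" using A X by (subst frob_adjoint) auto
  also have "\<dots> \<le> frob n (mat_adjoint A * mat_adjoint (mat_adjoint A * X))"
    using A X a b by (intro frob_mult_left_ge) auto
  also have "\<dots> = frob n (mat_adjoint A * X * A)"
    using A X by (intro frob_mult_right_adjoint[symmetric]) auto
  finally show ?thesis .
qed

lemma hs_norm_frob:
  assumes "A \<in> carrier_mat n n"
  shows "hs_norm n A = frob n A / sqrt n"
proof -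
  have "mat_trace (A * mat_adjoint A) = hs_ip A A" 
    unfolding hs_ip_def using assms by (intro mat_trace_commute[of _ n n]) auto
  then show ?thesis by (simp add: hs_norm_def norm_trace_def hs_ip_self[OF assms] real_sqrt_divide)
qed

section \<open>Linear maps on matrices\<close>

lemma linear_opD:
  assumes "linear_op n T"
  shows "R \<in> carrier_mat n n \<Longrightarrow> T R \<in> carrier_mat n n"
    and "R \<in> carrier_mat n n \<Longrightarrow> Q \<in> carrier_mat n n \<Longrightarrow> T (R + Q) = T R + T Q"
    and "R \<in> carrier_mat n n \<Longrightarrow> T (a \<cdot>\<^sub>m R) = a \<cdot>\<^sub>m T R"
  using assms by (auto simp: linear_op_def)

lemma linear_op_minus:
  assumes T: "linear_op n T" and R: "R \<in> carrier_mat n n" and Q: "Q \<in> carrier_mat n n"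
  shows "T (R - Q) = T R - T Q"
proof -
  have e: "R - Q = R + (-1) \<cdot>\<^sub>m Q" using R Q by (intro eq_matI) auto
  have "T (R - Q) = T R + (-1) \<cdot>\<^sub>m T Q" unfolding e using linear_opD[OF T] R Q by simp
  also have "\<dots> = T R - T Q" using linear_opD(1)[OF T] R Q by (intro eq_matI) (auto simp: carrier_matD[OF linear_opD(1)[OF T R]] carrier_matD[OF linear_opD(1)[OF T Q]])
  finally show ?thesis .
qed

lemma linear_op_zero:
  assumes T: "linear_op n T"
  shows "T (0\<^sub>m n n) = 0\<^sub>m n n"
proof -
  have "T (0\<^sub>m n n) = T (0 \<cdot>\<^sub>m 0\<^sub>m n n)" by simp
  also have "\<dots> = 0 \<cdot>\<^sub>m T (0\<^sub>m n n)" by (rule linear_opD(3)[OF T]) simp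
  also have "\<dots> = 0\<^sub>m n n" using linear_opD(1)[OF T, of "0\<^sub>m n n"] by (intro eq_matI) auto
  finally show ?thesis .
qed

definition unit_mat :: "nat \<Rightarrow> nat \<times> nat \<Rightarrow> complex mat" where
  "unit_mat n p = mat n n (\<lambda>q. if q = p then 1 else 0)"

lemma linear_op_entries:
  assumes T: "linear_op n T" and X: "X \<in> carrier_mat n n" and ij: "i < n" "j < n"
  shows "T X $$ (i,j) = (\<Sum>p\<in>{..<n}\<times>{..<n}. X $$ p * T (unit_mat n p) $$ (i,j))"
proof -
  define R where "R P = mat n n (\<lambda>q. if q \<in> P then X $$ q else 0)" for P
  have Rc: "R P \<in> carrier_mat n n" for P by (simp add: R_def)
  have Ec: "unit_mat n p \<in> carrier_mat n n" for p by (simp add: unit_mat_def)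
  note Tc = linear_opD(1)[OF T]
  have "T (R P) $$ (i,j) = (\<Sum>p\<in>P. X $$ p * T (unit_mat n p) $$ (i,j))"
    if "finite P" "P \<subseteq> {..<n}\<times>{..<n}" for P
    using that
  proof (induction P)
    case empty
    have "R {} = 0\<^sub>m n n" by (intro eq_matI) (auto simp: R_def)
    then show ?case using linear_op_zero[OF T] ij by simp
  next
    case (insert p P)
    have "R (insert p P) = R P + X $$ p \<cdot>\<^sub>m unit_mat n p"
      using insert.hyps by (intro eq_matI) (auto simp: R_def unit_mat_def)
    then have "T (R (insert p P)) = T (R P) + X $$ p \<cdot>\<^sub>m T (unit_mat n p)"
      using linear_opD[OF T] Rc Ec by simp
    then show ?case using insert ij carrier_matD[OF Tc[OF Rc[of P]]] carrier_matD[OF Tc[OF Ec[of p]]] by simp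
  qed
  from this[of "{..<n}\<times>{..<n}"] have "T (R ({..<n}\<times>{..<n})) $$ (i,j) = (\<Sum>p\<in>{..<n}\<times>{..<n}. X $$ p * T (unit_mat n p) $$ (i,j))"
    by simp
  moreover have "R ({..<n}\<times>{..<n}) = X" using X by (intro eq_matI) (auto simp: R_def)
  ultimately show ?thesis by simp
qed

lemma linear_op_bounded:
  assumes T: "linear_op n T"
  obtains K where "0 \<le> K" "\<And>X. X \<in> carrier_mat n n \<Longrightarrow> frob n (T X) \<le> K * frob n X"
proof -
  define K0 where "K0 = (\<Sum>p\<in>{..<n}\<times>{..<n}. frob n (T (unit_mat n p)))"
  have K0: "0 \<le> K0" by (auto simp: K0_def intro!: sum_nonneg)
  have "frob n (T X) \<le> (real n * K0) * frob n X" if X: "X \<in> carrier_mat n n" for X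
  proof -
    have "frob n (T X) \<le> real n * (K0 * frob n X)"
    proof (rule frob_le_entries)
      fix i j assume ij: "i < n" "j < n"
      have "cmod (T X $$ (i,j)) \<le> (\<Sum>p\<in>{..<n}\<times>{..<n}. cmod (X $$ p) * cmod (T (unit_mat n p) $$ (i,j)))"
        unfolding linear_op_entries[OF T X ij] by (rule order_trans[OF norm_sum]) (simp add: norm_mult)
      also have "\<dots> \<le> (\<Sum>p\<in>{..<n}\<times>{..<n}. frob n X * frob n (T (unit_mat n p)))"
        using ij by (intro sum_mono mult_mono) (auto intro!: frob_entry_le)
      finally show "cmod (T X $$ (i,j)) \<le> K0 * frob n X" by (simp add: K0_def sum_distrib_left mult.commute)
    qed (use K0 in auto)
    then show ?thesis by (simp add: mult.assoc)
  qed
  then show ?thesis using that[of "real n * K0"] K0 by simp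
qed

lemma frob_tendsto_zero:
  assumes "\<And>i j. i < n \<Longrightarrow> j < n \<Longrightarrow> (\<lambda>k. X k $$ (i,j)) \<longlonglongrightarrow> L $$ (i,j)"
    and "\<And>k. X k \<in> carrier_mat n n" "L \<in> carrier_mat n n"
  shows "(\<lambda>k. frob n (X k - L)) \<longlonglongrightarrow> 0"
proof (rule Lim_null_comparison)
  show "\<forall>\<^sub>F k in sequentially. norm (frob n (X k - L)) \<le> (\<Sum>p\<in>{..<n}\<times>{..<n}. cmod (X k $$ p - L $$ p))"
  proof (rule always_eventually, rule allI)
    fix k
    have "frob n (X k - L) \<le> (\<Sum>p\<in>{..<n}\<times>{..<n}. (\<lambda>(i,j). cmod ((X k - L) $$ (i,j))) p)"
      unfolding frob_def by (rule L2_set_le_sum) auto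
    also have "\<dots> = (\<Sum>p\<in>{..<n}\<times>{..<n}. cmod (X k $$ p - L $$ p))"
      using assms(2)[of k] assms(3) by (intro sum.cong) auto
    finally show "norm (frob n (X k - L)) \<le> (\<Sum>p\<in>{..<n}\<times>{..<n}. cmod (X k $$ p - L $$ p))" by simp
  qed
  have "(\<lambda>k. \<Sum>p\<in>{..<n}\<times>{..<n}. cmod (X k $$ p - L $$ p)) \<longlonglongrightarrow> (\<Sum>p\<in>{..<n}\<times>{..<n}. 0)"
    by (intro tendsto_sum) (auto intro!: tendsto_norm_zero LIM_zero assms(1))
  then show "(\<lambda>k. \<Sum>p\<in>{..<n}\<times>{..<n}. cmod (X k $$ p - L $$ p)) \<longlonglongrightarrow> 0" by simp
qed

lemma neumann_solution:
  assumes G: "linear_op n G" and q: "0 \<le> q" "q < 1"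
    and contr: "\<And>X. X \<in> carrier_mat n n \<Longrightarrow> frob n (G X) \<le> q * frob n X"
    and Y: "Y \<in> carrier_mat n n"
  shows "\<exists>X\<in>carrier_mat n n. X - G X = Y"
proof -
  define X where "X k = ((\<lambda>R. Y + G R) ^^ k) Y" for k
  have X0: "X 0 = Y" and XS: "X (Suc k) = Y + G (X k)" for k by (simp_all add: X_def)
  have Xc: "X k \<in> carrier_mat n n" for k
    by (induction k) (use Y linear_opD(1)[OF G] in \<open>auto simp: X0 XS\<close>)
  have Gc: "G (X k) \<in> carrier_mat n n" for k using linear_opD(1)[OF G Xc] .
  have step: "frob n (X (Suc k) - X k) \<le> q ^ Suc k * frob n Y" for k
  proof (induction k)
    case 0
    have "X (Suc 0) - X 0 = G Y" using Y Gc[of 0] by (intro eq_matI) (auto simp: X0 XS)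
    then show ?case using contr[OF Y] by simp
  next
    case (Suc k)
    have "X (Suc (Suc k)) - X (Suc k) = (Y + G (X (Suc k))) - (Y + G (X k))"
      by (simp only: XS)
    also have "\<dots> = G (X (Suc k)) - G (X k)"
      using Y carrier_matD[OF Gc[of k]] carrier_matD[OF Gc[of "Suc k"]] by (intro eq_matI) auto
    also have "\<dots> = G (X (Suc k) - X k)" using linear_op_minus[OF G Xc Xc] by simp
    finally have "frob n (X (Suc (Suc k)) - X (Suc k)) \<le> q * frob n (X (Suc k) - X k)"
      using contr[of "X (Suc k) - X k"] Xc by (simp add: minus_carrier_mat)
    also have "\<dots> \<le> q * (q ^ Suc k * frob n Y)" using Suc q by (intro mult_left_mono) auto
    finally show ?case by (simp add: mult.assoc)
  qed
  have conv: "convergent (\<lambda>k. X k $$ (i,j))" if ij: "i < n" "j < n" for i j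
  proof -
    have "summable (\<lambda>k. X (Suc k) $$ (i,j) - X k $$ (i,j))"
    proof (rule summable_comparison_test'[where N = 0])
      show "summable (\<lambda>k. q ^ Suc k * frob n Y)" using q by (intro summable_mult2) (simp add: summable_mult)
      fix k :: nat assume "0 \<le> k"
      have "norm (X (Suc k) $$ (i,j) - X k $$ (i,j)) = cmod ((X (Suc k) - X k) $$ (i,j))"
        using ij carrier_matD[OF Xc[of k]] carrier_matD[OF Xc[of "Suc k"]] by simp
      also have "\<dots> \<le> q ^ Suc k * frob n Y" using frob_entry_le[OF ij] step order_trans by blast
      finally show "norm (X (Suc k) $$ (i,j) - X k $$ (i,j)) \<le> q ^ Suc k * frob n Y" .
    qed
    then have "convergent (\<lambda>m. X m $$ (i,j) - X 0 $$ (i,j))"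
      unfolding summable_iff_convergent by (simp add: sum_lessThan_telescope[of "\<lambda>m. X m $$ (i,j)"])
    then show ?thesis by (simp add: convergent_diff_const_right_iff)
  qed
  define L where "L = mat n n (\<lambda>p. lim (\<lambda>k. X k $$ p))"
  have L: "L \<in> carrier_mat n n" by (simp add: L_def)
  have lim: "(\<lambda>k. frob n (X k - L)) \<longlonglongrightarrow> 0"
    by (rule frob_tendsto_zero[OF _ Xc L]) (use conv in \<open>simp add: L_def convergent_LIMSEQ_iff\<close>)
  have GL: "G L \<in> carrier_mat n n" using linear_opD(1)[OF G L] .
  have bd: "frob n (L - G L - Y) \<le> frob n (X (Suc k) - L) + q * frob n (X k - L)" for k
  proof -
    have "L - G L - Y = G (X k - L) - (X (Suc k) - L)"
      unfolding linear_op_minus[OF G Xc L] XS using L GL Gc[of k] Y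
      by (intro eq_matI) (auto simp: carrier_matD[OF GL] carrier_matD[OF Gc[of k]])
    then have "frob n (L - G L - Y) \<le> frob n (G (X k - L)) + frob n (X (Suc k) - L)"
      using frob_triangle_minus[of "G (X k - L)" n "X (Suc k) - L"] linear_opD(1)[OF G, of "X k - L"] Xc L
      by (simp add: minus_carrier_mat)
    also have "frob n (G (X k - L)) \<le> q * frob n (X k - L)" using contr Xc L by (simp add: minus_carrier_mat)
    finally show ?thesis by simp
  qed
  have "(\<lambda>k. frob n (X (Suc k) - L) + q * frob n (X k - L)) \<longlonglongrightarrow> 0 + q * 0"
    by (intro tendsto_add tendsto_mult tendsto_const lim LIMSEQ_Suc[OF lim])
  then have "frob n (L - G L - Y) \<le> 0" using bd by (intro LIMSEQ_le_const[where X="\<lambda>k. frob n (X (Suc k) - L) + q * frob n (X k - L)"]) auto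
  then have "L - G L - Y = 0\<^sub>m n n" using frob_eq_0[of "L - G L - Y" n] L GL Y frob_nonneg[of n "L - G L - Y"]
    by (simp add: minus_carrier_mat)
  then have e: "(L - G L - Y) $$ (i,j) = 0" if "i < n" "j < n" for i j using that by simp
  have "L - G L = Y"
  proof (rule eq_matI)
    fix i j assume "i < dim_row Y" "j < dim_col Y"
    then show "(L - G L) $$ (i,j) = Y $$ (i,j)" using e[of i j] Y L GL by simp
  qed (use Y GL in auto)
  then show ?thesis using L by blast
qed

section \<open>Symmetric positivity preserving maps\<close>

lemma vnorm_mult_le_frob:
  assumes A: "A \<in> carrier_mat n n" and v: "v \<in> carrier_vec n"
  shows "vnorm (A *\<^sub>v v) \<le> frob n A * vnorm v"
proof -
  have "(vnorm (A *\<^sub>v v))\<^sup>2 = (\<Sum>i<n. (cmod (\<Sum>j<n. A $$ (i,j) * v $ j))\<^sup>2)"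
    unfolding vnorm_sq using A v by (auto simp: scalar_prod_def atLeast0LessThan)
  also have "\<dots> \<le> (\<Sum>i<n. (\<Sum>j<n. (cmod (A $$ (i,j)))\<^sup>2) * (vnorm v)\<^sup>2)"
  proof (rule sum_mono)
    fix i
    have "cmod (\<Sum>j<n. A $$ (i,j) * v $ j) \<le> (\<Sum>j<n. \<bar>cmod (A $$ (i,j))\<bar> * \<bar>cmod (v $ j)\<bar>)"
      by (rule order_trans[OF norm_sum]) (simp add: norm_mult)
    also have "\<dots> \<le> L2_set (\<lambda>j. cmod (A $$ (i,j))) {..<n} * L2_set (\<lambda>j. cmod (v $ j)) {..<n}"
      by (rule L2_set_mult_ineq)
    finally have "(cmod (\<Sum>j<n. A $$ (i,j) * v $ j))\<^sup>2 \<le> (L2_set (\<lambda>j. cmod (A $$ (i,j))) {..<n} * vnorm v)\<^sup>2"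
      using v by (intro power_mono) (auto simp: vnorm_def)
    then show "(cmod (\<Sum>j<n. A $$ (i,j) * v $ j))\<^sup>2 \<le> (\<Sum>j<n. (cmod (A $$ (i,j)))\<^sup>2) * (vnorm v)\<^sup>2"
      by (simp add: power_mult_distrib L2_set_def sum_nonneg)
  qed
  also have "\<dots> = (frob n A * vnorm v)\<^sup>2" by (simp add: power_mult_distrib frob_sq sum_distrib_right)
  finally show ?thesis by (meson frob_nonneg mult_nonneg_nonneg power2_le_imp_le vnorm_nonneg)
qed

lemma herm_shift_psd:
  assumes H: "herm_mat n H" and D: "herm_mat n D" and d: "0 < d"
    and lb: "\<And>v. v \<in> carrier_vec n \<Longrightarrow> d * (vnorm v)\<^sup>2 \<le> quad_form D v"
  shows "psd n (complex_of_real (frob n H / d) \<cdot>\<^sub>m D + H)" "psd n (complex_of_real (frob n H / d) \<cdot>\<^sub>m D - H)"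
proof -
  have Hc: "H \<in> carrier_mat n n" and Dc: "D \<in> carrier_mat n n" using H D by (auto simp: herm_mat_def)
  define r where "r = frob n H / d"
  have b: "\<bar>quad_form H v\<bar> \<le> r * quad_form D v" if v: "v \<in> carrier_vec n" for v
  proof -
    have "\<bar>quad_form H v\<bar> \<le> vnorm (H *\<^sub>v v) * vnorm v" by (rule quad_form_le[OF Hc v])
    also have "\<dots> \<le> frob n H * vnorm v * vnorm v" using vnorm_mult_le_frob[OF Hc v] by (intro mult_right_mono) auto
    also have "\<dots> = frob n H / d * (d * (vnorm v)\<^sup>2)" using d by (simp add: power2_eq_square)
    also have "\<dots> \<le> frob n H / d * quad_form D v" using lb[OF v] d by (intro mult_left_mono) auto
    finally show ?thesis by (simp add: r_def)
  qed
  have b1: "0 \<le> r * quad_form D v + quad_form H v" if "v \<in> carrier_vec n" for v using b[OF that] by linarith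
  note hr = herm_mat_smult[OF D, of r]
  show "psd n (complex_of_real (frob n H / d) \<cdot>\<^sub>m D + H)"
    unfolding psd_iff r_def[symmetric] using herm_mat_add[OF hr H] Hc Dc b1
    by (auto simp: quad_form_add[of _ n] quad_form_smult[of _ n] abs_le_iff)
  show "psd n (complex_of_real (frob n H / d) \<cdot>\<^sub>m D - H)"
    unfolding psd_iff r_def[symmetric] using herm_mat_minus[OF hr H] Hc Dc b
    by (auto simp: quad_form_minus[of _ n] quad_form_smult[of _ n] abs_le_iff)
qed

definition re_mat :: "complex mat \<Rightarrow> complex mat" where
  "re_mat R = (1/2) \<cdot>\<^sub>m (R + mat_adjoint R)"

lemma re_im_mat:
  assumes R: "R \<in> carrier_mat n n"
  shows "herm_mat n (re_mat R)" "herm_mat n (im_mat R)" "R = re_mat R + \<i> \<cdot>\<^sub>m im_mat R"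
    "(frob n R)\<^sup>2 = (frob n (re_mat R))\<^sup>2 + (frob n (im_mat R))\<^sup>2"
proof -
  show "herm_mat n (re_mat R)" unfolding herm_mat_def re_mat_def
    using R by (auto intro!: eq_matI)
  show "herm_mat n (im_mat R)" unfolding herm_mat_def im_mat_def
    using R by (auto intro!: eq_matI simp: field_simps)
  show "R = re_mat R + \<i> \<cdot>\<^sub>m im_mat R" unfolding re_mat_def im_mat_def
    using R by (intro eq_matI) (auto simp: field_simps)
  have 1: "(frob n R)\<^sup>2 = (\<Sum>i<n. \<Sum>j<n. ((cmod (R $$ (i,j)))\<^sup>2 + (cmod (R $$ (j,i)))\<^sup>2) / 2)"
    unfolding sum_divide_distrib[symmetric] sum.distrib frob_sq
    by (subst (3) sum.swap) simp
  have p: "(cmod ((1/2) * (a + cnj b)))\<^sup>2 + (cmod (1 / (2 * \<i>) * (a - cnj b)))\<^sup>2 = ((cmod a)\<^sup>2 + (cmod b)\<^sup>2) / 2" for a b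
    by (simp add: norm_mult norm_divide cmod_power2 power_mult_distrib power_divide) (simp add: power2_eq_square field_simps)
  have "(frob n (re_mat R))\<^sup>2 + (frob n (im_mat R))\<^sup>2
      = (\<Sum>i<n. \<Sum>j<n. (cmod ((1/2) * (R $$ (i,j) + cnj (R $$ (j,i)))))\<^sup>2 + (cmod (1 / (2 * \<i>) * (R $$ (i,j) - cnj (R $$ (j,i)))))\<^sup>2)"
    unfolding frob_sq sum.distrib[symmetric] re_mat_def im_mat_def using R by (intro sum.cong) auto
  then show "(frob n R)\<^sup>2 = (frob n (re_mat R))\<^sup>2 + (frob n (im_mat R))\<^sup>2" unfolding p 1 by simp
qed

lemma frob_re_im:
  assumes "herm_mat n H" "herm_mat n K"
  shows "(frob n (H + \<i> \<cdot>\<^sub>m K))\<^sup>2 = (frob n H)\<^sup>2 + (frob n K)\<^sup>2"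
proof -
  have c: "H \<in> carrier_mat n n" "K \<in> carrier_mat n n" "mat_adjoint H = H" "mat_adjoint K = K" using assms by (auto simp: herm_mat_def)
  have h: "cnj (H $$ (j,i)) = H $$ (i,j)" "cnj (K $$ (j,i)) = K $$ (i,j)" if "i < n" "j < n" for i j
    using c that by (metis carrier_matD mat_adjoint_index)+
  let ?R = "H + \<i> \<cdot>\<^sub>m K"
  have "re_mat ?R = H" "im_mat ?R = K" unfolding re_mat_def im_mat_def
    using c(1,2) h by (auto intro!: eq_matI simp: field_simps)
  then show ?thesis using re_im_mat(4)[of ?R n] c by simp
qed

text \<open>A hermitian matrix is a difference of two positive semidefinite ones.\<close>
lemma positive_linear_herm:
  assumes T: "linear_op n T" "positivity_preserving n T" and H: "herm_mat n H"
  shows "herm_mat n (T H)"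
proof -
  have Hc: "H \<in> carrier_mat n n" using H by (auto simp: herm_mat_def)
  let ?k = "complex_of_real (frob n H / 1)"
  have p: "psd n (?k \<cdot>\<^sub>m 1\<^sub>m n + H)" by (rule herm_shift_psd(1)[OF H]) auto
  have e: "H = (?k \<cdot>\<^sub>m 1\<^sub>m n + H) - ?k \<cdot>\<^sub>m 1\<^sub>m n" using Hc by (intro eq_matI) auto
  have "T H = T (?k \<cdot>\<^sub>m 1\<^sub>m n + H) - ?k \<cdot>\<^sub>m T (1\<^sub>m n)"
    by (subst e, subst linear_op_minus[OF T(1)]) (use Hc linear_opD(3)[OF T(1)] in auto)
  moreover have "psd n (T (?k \<cdot>\<^sub>m 1\<^sub>m n + H))" "psd n (T (1\<^sub>m n))"
    using T(2) p psd_carrier[OF p] unfolding positivity_preserving_def by auto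
  ultimately show ?thesis using herm_mat_minus herm_mat_smult by (simp add: psd_iff)
qed

lemma positive_linear_adjoint:
  assumes T: "linear_op n T" "positivity_preserving n T" and R: "R \<in> carrier_mat n n"
  shows "T (mat_adjoint R) = mat_adjoint (T R)"
proof -
  note d = re_im_mat[OF R]
  have c: "re_mat R \<in> carrier_mat n n" "im_mat R \<in> carrier_mat n n" "mat_adjoint (re_mat R) = re_mat R" "mat_adjoint (im_mat R) = im_mat R"
    using d(1,2) by (auto simp: herm_mat_def)
  have t: "T (re_mat R) \<in> carrier_mat n n" "T (im_mat R) \<in> carrier_mat n n" "mat_adjoint (T (re_mat R)) = T (re_mat R)" "mat_adjoint (T (im_mat R)) = T (im_mat R)"
    using positive_linear_herm[OF T d(1)] positive_linear_herm[OF T d(2)] by (auto simp: herm_mat_def)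
  have "mat_adjoint R = re_mat R + (-\<i>) \<cdot>\<^sub>m im_mat R"
    by (subst d(3)) (use c in \<open>simp add: mat_adjoint_add[of _ n n]\<close>)
  then have "T (mat_adjoint R) = T (re_mat R) + (-\<i>) \<cdot>\<^sub>m T (im_mat R)" using linear_opD[OF T(1)] c by simp
  also have "\<dots> = mat_adjoint (T (re_mat R) + \<i> \<cdot>\<^sub>m T (im_mat R))" using t by (simp add: mat_adjoint_add[of _ n n])
  also have "T (re_mat R) + \<i> \<cdot>\<^sub>m T (im_mat R) = T R"
    by (subst (3) d(3)) (use linear_opD[OF T(1)] c in simp)
  finally show ?thesis .
qed

text \<open>Log-convexity makes the ratios of consecutive terms increase; a first ratio above \<open>q\<close>
  would therefore force growth at a rate above \<open>q\<close>.\<close>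
lemma log_convex_decay:
  fixes a :: "nat \<Rightarrow> real"
  assumes nn: "\<And>k. 0 \<le> a k" and conv: "\<And>k. (a (Suc k))\<^sup>2 \<le> a k * a (Suc (Suc k))"
    and bd: "\<And>k. a k \<le> K * q ^ k" and q: "0 \<le> q"
  shows "a 1 \<le> q * a 0"
proof (rule ccontr)
  assume "\<not> ?thesis"
  then have gt: "q * a 0 < a 1" by simp
  then have a1: "0 < a 1" using q nn[of 0] by (meson le_less_trans mult_nonneg_nonneg)
  have a0: "0 < a 0"
  proof (rule ccontr)
    assume "\<not> 0 < a 0"
    then have "a 0 = 0" using nn[of 0] by simp
    then show False using conv[of 0] a1 by simp
  qed
  define r where "r = a 1 / a 0"
  have rq: "q < r" and r0: "0 < r" using gt a0 a1 by (auto simp: r_def field_simps)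
  have ind: "0 < a k \<and> r * a k \<le> a (Suc k)" for k
  proof (induction k)
    case 0 then show ?case using a0 by (simp add: r_def)
  next
    case (Suc k)
    then have p: "0 < a (Suc k)" using r0 by (meson less_le_trans mult_pos_pos)
    have "r * a (Suc k) * a k \<le> a (Suc k) * a (Suc k)" using Suc p by (metis mult.assoc mult.commute mult_left_mono less_imp_le)
    also have "\<dots> \<le> a (Suc (Suc k)) * a k" using conv[of k] by (simp add: power2_eq_square mult.commute)
    finally show ?case using Suc p by simp
  qed
  have low: "r ^ k * a 0 \<le> a k" for k
  proof (induction k)
    case (Suc k)
    have "r ^ Suc k * a 0 = r * (r ^ k * a 0)" by simp
    also have "\<dots> \<le> r * a k" using Suc r0 by (intro mult_left_mono) auto
    also have "\<dots> \<le> a (Suc k)" using ind by simp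
    finally show ?case .
  qed simp
  show False
  proof (cases "q = 0")
    case True
    then show False using bd[of 1] a1 by simp
  next
    case False
    then have q0: "0 < q" using q by simp
    have "1 < r / q" using rq q0 by simp
    then obtain k where k: "K / a 0 < (r / q) ^ k" using real_arch_pow by blast
    have "K < (r / q) ^ k * a 0" using k a0 by (simp add: field_simps)
    then have "K * q ^ k < r ^ k * a 0" using q0 by (simp add: field_simps power_divide)
    then show False using low[of k] bd[of k] by linarith
  qed
qed

text \<open>This is the part of Perron--Frobenius theory that is used: a strictly positive \<open>D\<close> with \<open>T D \<le> q D\<close> bounds the
  iterates of \<open>T\<close> on hermitian matrices by a multiple of \<open>q\<^sup>k\<close>, and for a symmetric map the norms of the iterates are
  log-convex, so that their growth rate already bounds the first step.\<close>
lemma positive_map_norm_le: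
  assumes lin: "linear_op n T" and sym: "hs_symmetric n T" and pos: "positivity_preserving n T"
    and D: "herm_mat n D" and d: "0 < d" and lb: "\<And>v. v \<in> carrier_vec n \<Longrightarrow> d * (vnorm v)\<^sup>2 \<le> quad_form D v"
    and q: "0 \<le> q" and sub: "psd n (complex_of_real q \<cdot>\<^sub>m D - T D)"
    and X: "X \<in> carrier_mat n n"
  shows "frob n (T X) \<le> q * frob n X"
proof -
  have Dc: "D \<in> carrier_mat n n" using D by (auto simp: herm_mat_def)
  note Tc = linear_opD(1)[OF lin]
  have TD: "T D \<in> carrier_mat n n" using Tc[OF Dc] .
  have posT: "psd n A \<Longrightarrow> psd n (T A)" for A using pos psd_carrier unfolding positivity_preserving_def by blast
  have step: "psd n (complex_of_real (q * s) \<cdot>\<^sub>m D - T Z)"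
    if Z: "Z \<in> carrier_mat n n" and s: "0 \<le> s" and p: "psd n (complex_of_real s \<cdot>\<^sub>m D - Z)" for Z s
  proof -
    have "complex_of_real (q * s) \<cdot>\<^sub>m D - T Z = complex_of_real s \<cdot>\<^sub>m (complex_of_real q \<cdot>\<^sub>m D - T D) + T (complex_of_real s \<cdot>\<^sub>m D - Z)"
      unfolding linear_op_minus[OF lin smult_carrier_mat[OF Dc] Z] linear_opD(3)[OF lin Dc]
      using Dc TD Tc[OF Z] by (intro eq_matI) (auto simp: carrier_matD[OF TD] carrier_matD[OF Tc[OF Z]] algebra_simps)
    then show ?thesis using psd_add[OF psd_smult[OF sub s] posT[OF p]] by simp
  qed
  have herm_case: "frob n (T H) \<le> q * frob n H" if H: "herm_mat n H" for H
  proof -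
    have Hc: "H \<in> carrier_mat n n" using H by (auto simp: herm_mat_def)
    define Z where "Z k = (T ^^ k) H" for k
    have ZS: "Z (Suc k) = T (Z k)" for k by (simp add: Z_def)
    have Zh: "herm_mat n (Z k)" for k
      by (induction k) (use H positive_linear_herm[OF lin pos] in \<open>auto simp: Z_def\<close>)
    have Zc: "Z k \<in> carrier_mat n n" for k using Zh[of k] by (auto simp: herm_mat_def)
    define t where "t = frob n H / d"
    have t0: "0 \<le> t" using d by (simp add: t_def)
    have bounds: "psd n (complex_of_real (q ^ k * t) \<cdot>\<^sub>m D - Z k) \<and> psd n (complex_of_real (q ^ k * t) \<cdot>\<^sub>m D - (-1) \<cdot>\<^sub>m Z k)" for k
    proof (induction k)
      case 0
      have "complex_of_real t \<cdot>\<^sub>m D - (-1) \<cdot>\<^sub>m H = complex_of_real t \<cdot>\<^sub>m D + H" using Hc Dc by (intro eq_matI) auto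
      then show ?case using herm_shift_psd[OF H D d lb] by (simp add: Z_def t_def)
    next
      case (Suc k)
      have "0 \<le> q ^ k * t" using q t0 by simp
      note s = step[OF Zc[of k] this] step[OF _ this, of "(-1) \<cdot>\<^sub>m Z k"]
      have "T ((-1) \<cdot>\<^sub>m Z k) = (-1) \<cdot>\<^sub>m Z (Suc k)" using linear_opD(3)[OF lin Zc] by (simp add: ZS)
      then show ?case using s Suc Zc by (simp add: ZS mult.assoc)
    qed
    have Zb: "frob n (Z k) \<le> (t * frob n D) * q ^ k" for k
    proof -
      define A where "A = complex_of_real (q ^ k * t) \<cdot>\<^sub>m D"
      have A: "A \<in> carrier_mat n n" "mat_adjoint A = A" using D by (auto simp: A_def herm_mat_def)
      have Za: "mat_adjoint (Z k) = Z k" using Zh[of k] by (auto simp: herm_mat_def)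
      have mz: "(-1) \<cdot>\<^sub>m Z k \<in> carrier_mat n n" using Zc by simp
      \<comment> \<open>From \<open>-A \<le> Z \<le> A\<close> one gets \<open>\<parallel>Z\<parallel> \<le> \<parallel>A\<parallel>\<close> by pairing \<open>A - Z\<close> with \<open>A + Z\<close>; the cross terms cancel.\<close>
      have "0 \<le> Re (hs_ip (A - Z k) (A - (-1) \<cdot>\<^sub>m Z k))"
        using hs_ip_psd_nonneg(1) bounds[of k] unfolding A_def by blast
      also have "hs_ip (A - Z k) (A - (-1) \<cdot>\<^sub>m Z k) = hs_ip A A + hs_ip A (Z k) - hs_ip (Z k) A - hs_ip (Z k) (Z k)"
        using A(1) Zc[of k] by (simp add: hs_ip_minus_left[of _ n] hs_ip_minus_right[of _ n] hs_ip_smult_right[of _ n] minus_carrier_mat)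
      also have "Re \<dots> = (frob n A)\<^sup>2 - (frob n (Z k))\<^sup>2"
        unfolding hs_ip_self[OF A(1)] hs_ip_self[OF Zc] hs_ip_commute[OF A(1) Zc[of k]] by simp
      finally have "(frob n (Z k))\<^sup>2 \<le> (frob n A)\<^sup>2" by simp
      then have "frob n (Z k) \<le> frob n A" by (rule power2_le_imp_le) simp
      also have "frob n A = (t * frob n D) * q ^ k" unfolding A_def frob_smult[OF Dc] norm_of_real using q t0 by simp
      finally show ?thesis .
    qed
    have "frob n (Z 1) \<le> q * frob n (Z 0)"
    proof (rule log_convex_decay[where a = "\<lambda>k. frob n (Z k)", OF _ _ Zb q])
      fix k
      have "complex_of_real ((frob n (Z (Suc k)))\<^sup>2) = hs_ip (T (Z k)) (Z (Suc k))"
        using hs_ip_self[OF Zc[of "Suc k"]] by (simp add: ZS)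
      also have "\<dots> = hs_ip (Z k) (T (Z (Suc k)))" using sym Zc unfolding hs_symmetric_def hs_ip_def by metis
      finally have "(frob n (Z (Suc k)))\<^sup>2 = cmod (hs_ip (Z k) (Z (Suc (Suc k))))" by (metis ZS norm_of_real abs_of_nonneg zero_le_power2)
      also have "\<dots> \<le> frob n (Z k) * frob n (Z (Suc (Suc k)))" by (rule hs_ip_le[OF Zc Zc])
      finally show "(frob n (Z (Suc k)))\<^sup>2 \<le> frob n (Z k) * frob n (Z (Suc (Suc k)))" .
    qed simp
    then show ?thesis by (simp add: Z_def)
  qed
  note dec = re_im_mat[OF X]
  have c: "re_mat X \<in> carrier_mat n n" "im_mat X \<in> carrier_mat n n" using dec(1,2) by (auto simp: herm_mat_def)
  have "T X = T (re_mat X) + \<i> \<cdot>\<^sub>m T (im_mat X)"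
    by (subst dec(3)) (use linear_opD[OF lin] c in simp)
  then have "(frob n (T X))\<^sup>2 = (frob n (T (re_mat X)))\<^sup>2 + (frob n (T (im_mat X)))\<^sup>2"
    using frob_re_im positive_linear_herm[OF lin pos] dec(1,2) by simp
  also have "\<dots> \<le> (q * frob n (re_mat X))\<^sup>2 + (q * frob n (im_mat X))\<^sup>2"
    using herm_case dec(1,2) by (intro add_mono power_mono) auto
  also have "\<dots> = (q * frob n X)\<^sup>2" unfolding power_mult_distrib dec(4) by (simp add: algebra_simps)
  finally show ?thesis using q by (meson frob_nonneg mult_nonneg_nonneg power2_le_imp_le)
qed

section \<open>Stability of a rotated Perron--Frobenius operator\<close>

lemma diag_sandwich_index:
  assumes "Y \<in> carrier_mat n n" "i < n" "j < n"
  shows "(mat_diag n u * Y * mat_diag n u) $$ (i,j) = u i * Y $$ (i,j) * u j"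
proof -
  show ?thesis using assms by (simp add: mat_diag_mult_left[OF assms(1)] mat_diag_mult_right[of _ n n])
qed

lemma diag_sandwich_carrier [simp]:
  "Y \<in> carrier_mat n n \<Longrightarrow> mat_diag n u * Y * mat_diag n u \<in> carrier_mat n n"
  by (intro mult_carrier_mat[of _ n n] mat_diag_dim)

lemma mat_minus_index:
  assumes "A \<in> carrier_mat n n" "B \<in> carrier_mat n n" "i < n" "j < n"
  shows "(A - B) $$ (i,j) = A $$ (i,j) - B $$ (i,j)"
  using assms by simp

lemma frob_unitary_sandwich:
  assumes "Y \<in> carrier_mat n n" "\<And>i. i < n \<Longrightarrow> cmod (u i) = 1"
  shows "frob n (mat_diag n u * Y * mat_diag n u) = frob n Y"
  unfolding frob_def using assms
  by (intro L2_set_cong refl) (auto simp: diag_sandwich_index norm_mult)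

lemma rotated_contraction_lower_bound:
  assumes "X \<in> carrier_mat n n" "F X \<in> carrier_mat n n" "\<And>i. i < n \<Longrightarrow> cmod (u i) = 1"
    and "frob n (F X) \<le> q * frob n X"
  shows "(1 - q) * frob n X \<le> frob n (X - mat_diag n u * F X * mat_diag n u)"
  using frob_triangle_diff[of X n "mat_diag n u * F X * mat_diag n u"] assms
  by (simp add: frob_unitary_sandwich algebra_simps)

definition rank_one_update :: "(complex mat \<Rightarrow> complex mat) \<Rightarrow> real \<Rightarrow> complex mat \<Rightarrow> complex mat \<Rightarrow> complex mat" where
  "rank_one_update T c A X = T X + (complex_of_real c * hs_ip A X) \<cdot>\<^sub>m A"

lemma rank_one_update_linear:
  assumes T: "linear_op n T" and A: "A \<in> carrier_mat n n"
  shows "linear_op n (rank_one_update T c A)"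
  unfolding linear_op_def rank_one_update_def
proof (intro conjI ballI allI)
  fix R :: "complex mat" assume R: "R \<in> carrier_mat n n"
  note TR = linear_opD(1)[OF T R]
  show "T R + (complex_of_real c * hs_ip A R) \<cdot>\<^sub>m A \<in> carrier_mat n n" using TR A by simp
  show "T (a \<cdot>\<^sub>m R) + (complex_of_real c * hs_ip A (a \<cdot>\<^sub>m R)) \<cdot>\<^sub>m A = a \<cdot>\<^sub>m (T R + (complex_of_real c * hs_ip A R) \<cdot>\<^sub>m A)" for a
    unfolding linear_opD(3)[OF T R] hs_ip_smult_right[OF A R] using TR A
    by (intro eq_matI) (auto simp: algebra_simps)
  fix Q :: "complex mat" assume Q: "Q \<in> carrier_mat n n"
  note TQ = linear_opD(1)[OF T Q]
  show "T (R + Q) + (complex_of_real c * hs_ip A (R + Q)) \<cdot>\<^sub>m A =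
    T R + (complex_of_real c * hs_ip A R) \<cdot>\<^sub>m A + (T Q + (complex_of_real c * hs_ip A Q) \<cdot>\<^sub>m A)"
    unfolding linear_opD(2)[OF T R Q] hs_ip_add_right[OF A R Q] using TR TQ A
    by (intro eq_matI) (auto simp: carrier_matD[OF TR] carrier_matD[OF TQ] algebra_simps)
qed

lemma rank_one_update_symmetric:
  assumes T: "linear_op n T" "hs_symmetric n T" and A: "A \<in> carrier_mat n n"
  shows "hs_symmetric n (rank_one_update T c A)"
  unfolding hs_symmetric_def hs_ip_def[symmetric] rank_one_update_def
proof (intro ballI)
  fix R Q :: "complex mat" assume R: "R \<in> carrier_mat n n" and Q: "Q \<in> carrier_mat n n"
  note TR = linear_opD(1)[OF T(1) R] and TQ = linear_opD(1)[OF T(1) Q]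
  have "hs_ip R (T Q) = hs_ip (T R) Q" using T(2) R Q by (simp add: hs_symmetric_def hs_ip_def)
  then show "hs_ip R (T Q + (complex_of_real c * hs_ip A Q) \<cdot>\<^sub>m A) = hs_ip (T R + (complex_of_real c * hs_ip A R) \<cdot>\<^sub>m A) Q"
    using R Q A TR TQ hs_ip_commute[OF A R]
    by (simp add: hs_ip_add_right[of _ n] hs_ip_add_left[of _ n] hs_ip_smult_right[of _ n] hs_ip_smult_left[of _ n])
qed

lemma complex_of_real_Re: "Im z = 0 \<Longrightarrow> z = complex_of_real (Re z)"
  by (simp add: complex_eq_iff)

lemma rank_one_update_quad_form:
  assumes T: "linear_op n T" and A: "psd n A" and X: "psd n X" and v: "v \<in> carrier_vec n"
  shows "quad_form (rank_one_update T c A X) v = quad_form (T X) v + c * Re (hs_ip A X) * quad_form A v"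
proof -
  have r: "hs_ip A X = complex_of_real (Re (hs_ip A X))" using complex_of_real_Re[OF hs_ip_psd_nonneg(2)[OF A X]] .
  have "rank_one_update T c A X = T X + complex_of_real (c * Re (hs_ip A X)) \<cdot>\<^sub>m A"
    unfolding rank_one_update_def by (subst r) simp
  then show ?thesis using linear_opD(1)[OF T psd_carrier[OF X]] psd_carrier[OF A] v
    by (simp add: quad_form_add[of _ n] quad_form_smult[of _ n] del: of_real_mult)
qed

lemma rank_one_update_herm:
  assumes T: "herm_mat n (T X)" and A: "psd n A" and X: "psd n X"
  shows "herm_mat n (rank_one_update T c A X)"
proof -
  have r: "hs_ip A X = complex_of_real (Re (hs_ip A X))" using complex_of_real_Re[OF hs_ip_psd_nonneg(2)[OF A X]] .
  have "rank_one_update T c A X = T X + complex_of_real (c * Re (hs_ip A X)) \<cdot>\<^sub>m A"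
    unfolding rank_one_update_def by (subst r) simp
  then show ?thesis using herm_mat_add[OF T herm_mat_smult[of n A "c * Re (hs_ip A X)"]] A by (simp add: psd_iff del: of_real_mult)
qed

lemma positivity_preservingI:
  assumes "\<And>X. psd n X \<Longrightarrow> psd n (T X)"
  shows "positivity_preserving n T"
  using assms by (simp add: positivity_preserving_def)

lemma positivity_preservingD: "positivity_preserving n T \<Longrightarrow> psd n X \<Longrightarrow> psd n (T X)"
  using psd_carrier by (auto simp: positivity_preserving_def)

lemma frob_orthogonal:
  assumes "A \<in> carrier_mat n n" "B \<in> carrier_mat n n" "hs_ip A B = 0"
  shows "(frob n (a \<cdot>\<^sub>m A + B))\<^sup>2 = (cmod a * frob n A)\<^sup>2 + (frob n B)\<^sup>2"
proof -
  have aA: "a \<cdot>\<^sub>m A \<in> carrier_mat n n" and s: "a \<cdot>\<^sub>m A + B \<in> carrier_mat n n" using assms by auto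
  have "hs_ip B A = 0" using hs_ip_commute[OF assms(2,1)] assms(3) by simp
  then have "hs_ip (a \<cdot>\<^sub>m A + B) (a \<cdot>\<^sub>m A + B) = hs_ip (a \<cdot>\<^sub>m A) (a \<cdot>\<^sub>m A) + hs_ip B B"
    using assms aA s by (simp add: hs_ip_add_left[of _ n] hs_ip_add_right[of _ n] hs_ip_smult_left[of _ n] hs_ip_smult_right[of _ n])
  then have "complex_of_real ((frob n (a \<cdot>\<^sub>m A + B))\<^sup>2) = complex_of_real ((frob n (a \<cdot>\<^sub>m A))\<^sup>2 + (frob n B)\<^sup>2)"
    unfolding hs_ip_self[OF s] hs_ip_self[OF aA] hs_ip_self[OF assms(2)] by simp
  then show ?thesis using assms(1) by (simp only: of_real_eq_iff frob_smult)
qed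

text \<open>Here \<open>T\<close>, \<open>a\<close> and \<open>x\<close> are the norms of a matrix \<open>X\<close>, of its component along \<open>D\<close> and of the orthogonal rest,
  \<open>W\<close> is the norm of \<open>F X\<close> and \<open>\<delta>\<close> that of \<open>X - U (F X) U\<close>. If \<open>x\<close> is not small compared to \<open>T\<close>, the spectral gap
  \<open>\<epsilon>\<close> makes \<open>W\<close> smaller than \<open>T\<close>; otherwise \<open>X\<close> is nearly parallel to \<open>D\<close> and the rotation takes over.\<close>
lemma gap_arithmetic:
  fixes a x \<delta> W T \<epsilon> m :: real
  assumes a: "0 \<le> a" and x: "0 \<le> x" and T: "0 \<le> T" and pyth: "T\<^sup>2 = a\<^sup>2 + x\<^sup>2" and tri: "T \<le> \<delta> + W"
    and W: "W\<^sup>2 \<le> T\<^sup>2 - \<epsilon> * x\<^sup>2" and rot: "2 * m * a \<le> \<delta> + 2 * x"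
    and m: "0 < m" "m \<le> 1" and e: "0 \<le> \<epsilon>" "\<epsilon> \<le> 1"
  shows "\<epsilon> * m\<^sup>2 / 8 * T \<le> \<delta>"
proof (cases "m * T / 2 \<le> x")
  case True
  define y where "y = \<epsilon> * m\<^sup>2 / 8"
  have m2: "m\<^sup>2 \<le> 1" using m by (simp add: power_le_one)
  then have em: "0 \<le> \<epsilon> * m\<^sup>2" "\<epsilon> * m\<^sup>2 \<le> 1" using e by (simp, intro mult_le_one) auto
  then have y: "0 \<le> y" "y \<le> 1/8" unfolding y_def by linarith+
  have "(m * T / 2)\<^sup>2 \<le> x\<^sup>2" by (rule power_mono[OF True]) (use m T in simp)
  then have "\<epsilon> * (m * T / 2)\<^sup>2 \<le> \<epsilon> * x\<^sup>2" using e(1) by (rule mult_left_mono)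
  moreover have "\<epsilon> * (m * T / 2)\<^sup>2 = 2 * y * T\<^sup>2" by (simp add: y_def power2_eq_square)
  moreover have "(T * (1 - y))\<^sup>2 = T\<^sup>2 - 2 * y * T\<^sup>2 + (T * y)\<^sup>2" by (simp add: power2_eq_square algebra_simps)
  moreover have "0 \<le> (T * y)\<^sup>2" by simp
  ultimately have "W\<^sup>2 \<le> (T * (1 - y))\<^sup>2" using W by linarith
  then have "W \<le> T * (1 - y)" by (rule power2_le_imp_le) (use y T in simp)
  then show ?thesis using tri unfolding y_def[symmetric] by (simp add: algebra_simps)
next
  case False
  then have xs: "x < m * T / 2" by simp
  have mT: "m * T \<le> T" "0 \<le> m * T" using m T by (simp_all add: mult_left_le_one_le)
  have "x \<le> T / 2" using xs mT by linarith
  then have "x\<^sup>2 \<le> (T / 2)\<^sup>2" by (rule power_mono) (rule x)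
  moreover have "(T / 2)\<^sup>2 = T\<^sup>2 / 4" "(4/5 * T)\<^sup>2 = 16/25 * T\<^sup>2" by (simp_all add: power2_eq_square)
  moreover have "0 \<le> T\<^sup>2" by simp
  ultimately have "(4/5 * T)\<^sup>2 \<le> a\<^sup>2" using pyth by linarith
  then have "4/5 * T \<le> a" by (rule power2_le_imp_le) (rule a)
  then have "m * (4/5 * T) \<le> m * a" using m by (intro mult_left_mono) auto
  then have d: "3/5 * (m * T) \<le> \<delta>" using rot xs by (simp add: algebra_simps)
  have mm: "m * m \<le> m" "0 \<le> m * m" using m by (simp_all add: mult_left_le_one_le)
  have "\<epsilon> * (m * m) \<le> 1 * (m * m)" by (rule mult_right_mono[OF e(2) mm(2)])
  then have "\<epsilon> * (m * m) \<le> m" using mm by linarith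
  then have "\<epsilon> * (m * m) * T \<le> m * T" using T by (rule mult_right_mono)
  then show ?thesis using d mT by (simp add: power2_eq_square)
qed

text \<open>Subtracting \<open>g\<close> times the rank-one map along the eigenvector \<open>D\<close> keeps the map positivity preserving, so that
  the Perron--Frobenius bound applies again and yields a spectral gap. A matrix that is almost fixed by the rotated
  map is therefore almost parallel to \<open>D\<close>, but \<open>D\<close> itself is moved by the rotation because \<open>D = Im U\<close>.\<close>
lemma rotated_eigenvector_gap:
  assumes n: "0 < n" and F: "linear_op n F" "hs_symmetric n F" "positivity_preserving n F"
    and d: "\<And>i. i < n \<Longrightarrow> m \<le> d i \<and> d i \<le> 1" and m: "0 < m"
    and D: "D = mat_diag n (\<lambda>i. complex_of_real (d i))" and FD: "F D = D"
    and g: "0 \<le> g" and low: "\<And>X v. psd n X \<Longrightarrow> v \<in> carrier_vec n \<Longrightarrow> g * Re (mat_trace X) * (vnorm v)\<^sup>2 \<le> quad_form (F X) v"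
    and u: "\<And>i. i < n \<Longrightarrow> cmod (u i) = 1 \<and> Im (u i) = d i"
    and X: "X \<in> carrier_mat n n"
  shows "g * n * m ^ 4 / 8 * frob n X \<le> frob n (X - mat_diag n u * F X * mat_diag n u)"
proof -
  have Dc: "D \<in> carrier_mat n n" by (simp add: D)
  have dpos: "0 < d i" if "i < n" for i using d[OF that] m by linarith
  have Dp: "psd n D" unfolding D by (intro psd_diag) (use dpos less_imp_le in auto)
  have Dh: "herm_mat n D" using Dp by (simp add: psd_iff)
  have Dq: "m * (vnorm v)\<^sup>2 \<le> quad_form D v" "quad_form D v \<le> (vnorm v)\<^sup>2" if v: "v \<in> carrier_vec n" for v
  proof -
    have "quad_form D v = (\<Sum>i<n. d i * (cmod (v $ i))\<^sup>2)" unfolding D quad_form_diag[OF v] by simp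
    moreover have "(\<Sum>i<n. m * (cmod (v $ i))\<^sup>2) \<le> (\<Sum>i<n. d i * (cmod (v $ i))\<^sup>2)"
      using d by (intro sum_mono mult_right_mono) auto
    moreover have "(\<Sum>i<n. d i * (cmod (v $ i))\<^sup>2) \<le> (\<Sum>i<n. 1 * (cmod (v $ i))\<^sup>2)"
      using d by (intro sum_mono mult_right_mono) auto
    ultimately show "m * (vnorm v)\<^sup>2 \<le> quad_form D v" "quad_form D v \<le> (vnorm v)\<^sup>2"
      using v by (simp_all add: vnorm_sq sum_distrib_left)
  qed
  have m1: "m \<le> 1" using d[of 0] n by simp
  have trD: "Re (hs_ip D Z) \<le> Re (mat_trace Z)" if Z: "psd n Z" for Z
  proof -
    have "psd n (1\<^sub>m n - D)" using psd_minus_iff[OF Dh herm_mat_one] Dh Dq(2) by (simp add: loewner_le_def)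
    then have "0 \<le> Re (hs_ip (1\<^sub>m n - D) Z)" using hs_ip_psd_nonneg(1) Z by blast
    also have "hs_ip (1\<^sub>m n - D) Z = mat_trace Z - hs_ip D Z"
      using hs_ip_minus_left[OF one_carrier_mat Dc psd_carrier[OF Z]] psd_carrier[OF Z] by (simp add: hs_ip_def)
    finally show ?thesis by simp
  qed
  \<comment> \<open>By \<open>D \<le> 1\<close> the subtracted term \<open>g \<langle>D, Z\<rangle> D\<close> is at most \<open>g (Tr Z)\<close>, hence at most \<open>F Z\<close>.\<close>
  define F2 where "F2 = rank_one_update F (- g) D"
  have F2l: "linear_op n F2" and F2s: "hs_symmetric n F2"
    unfolding F2_def using rank_one_update_linear rank_one_update_symmetric F Dc by auto
  have F2p: "positivity_preserving n F2"
  proof (rule positivity_preservingI)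
    fix Z :: "complex mat" assume Z: "psd n Z"
    have "herm_mat n (F2 Z)" unfolding F2_def
      using positivity_preservingD[OF F(3) Z] Dp Z by (intro rank_one_update_herm) (auto simp: psd_iff)
    moreover have "0 \<le> quad_form (F2 Z) v" if v: "v \<in> carrier_vec n" for v
    proof -
      have "g * Re (hs_ip D Z) * quad_form D v \<le> g * Re (mat_trace Z) * (vnorm v)\<^sup>2"
        using g trD[OF Z] Dq[OF v] hs_ip_psd_nonneg(1)[OF Dp Z] Dp v psd_trace_nonneg[OF Z]
        by (intro mult_mono) (auto simp: psd_iff)
      also have "\<dots> \<le> quad_form (F Z) v" by (rule low[OF Z v])
      finally show ?thesis unfolding F2_def using rank_one_update_quad_form[OF F(1) Dp Z v, of "- g"] by simp
    qed
    ultimately show "psd n (F2 Z)" by (simp add: psd_iff)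
  qed
  define e where "e = g * (frob n D)\<^sup>2"
  have e0: "0 \<le> e" using g by (simp add: e_def)
  have F2D: "F2 D = complex_of_real (1 - e) \<cdot>\<^sub>m D"
    unfolding F2_def rank_one_update_def FD hs_ip_self[OF Dc] e_def using Dc
    by (intro eq_matI) (auto simp: algebra_simps)
  have frD: "n * m\<^sup>2 \<le> (frob n D)\<^sup>2"
  proof -
    have "(\<Sum>i<n. m\<^sup>2) \<le> (\<Sum>i<n. \<Sum>j<n. (cmod (D $$ (i,j)))\<^sup>2)"
    proof (rule sum_mono)
      fix i assume "i \<in> {..<n}"
      then have i: "i < n" by simp
      have "m\<^sup>2 \<le> (cmod (D $$ (i,i)))\<^sup>2" using d[OF i] m i by (intro power_mono) (auto simp: D mat_diag_def)
      also have "\<dots> \<le> (\<Sum>j<n. (cmod (D $$ (i,j)))\<^sup>2)" using i by (intro member_le_sum) auto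
      finally show "m\<^sup>2 \<le> (\<Sum>j<n. (cmod (D $$ (i,j)))\<^sup>2)" .
    qed
    then show ?thesis by (simp add: frob_sq)
  qed
  have frD0: "0 < frob n D"
  proof -
    have "0 < (frob n D)\<^sup>2" using frD n m by (smt (verit) mult_pos_pos of_nat_0_less_iff zero_less_power)
    then show ?thesis by (simp add: zero_less_power2 less_le)
  qed
  have e1: "e \<le> 1"
  proof -
    have uv: "unit_vec n 0 \<in> carrier_vec n" "vnorm (unit_vec n 0) = 1" using n by auto
    have "0 \<le> quad_form (F2 D) (unit_vec n 0)" using positivity_preservingD[OF F2p Dp] uv by (simp add: psd_iff)
    also have "\<dots> = (1 - e) * quad_form D (unit_vec n 0)" unfolding F2D by (rule quad_form_smult[OF Dc uv(1)])
    finally have "0 \<le> (1 - e) * quad_form D (unit_vec n 0)" .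
    moreover have "0 < quad_form D (unit_vec n 0)" using Dq(1)[OF uv(1)] m uv(2) by simp
    ultimately show ?thesis by (simp add: zero_le_mult_iff)
  qed
  have z0: "psd n (0\<^sub>m n n)" by (simp add: psd_iff)
  have F2n: "frob n (F2 Z) \<le> (1 - e) * frob n Z" if "Z \<in> carrier_mat n n" for Z
  proof (rule positive_map_norm_le[OF F2l F2s F2p Dh m Dq(1) _ _ that])
    have "complex_of_real (1 - e) \<cdot>\<^sub>m D - F2 D = 0\<^sub>m n n" unfolding F2D using Dc by (intro eq_matI) auto
    then show "psd n (complex_of_real (1 - e) \<cdot>\<^sub>m D - F2 D)" using z0 by simp
  qed (use e1 in auto)
  define al where "al = hs_ip D X / complex_of_real ((frob n D)\<^sup>2)"
  define X' where "X' = X - al \<cdot>\<^sub>m D"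
  have X'c: "X' \<in> carrier_mat n n" using X Dc by (simp add: X'_def minus_carrier_mat)
  have orth: "hs_ip D X' = 0"
    unfolding X'_def using hs_ip_minus_right[OF Dc X smult_carrier_mat[OF Dc]] hs_ip_smult_right[OF Dc Dc] frD0
    by (simp add: hs_ip_self[OF Dc] al_def)
  have Xd: "X = al \<cdot>\<^sub>m D + X'" using X Dc by (intro eq_matI) (auto simp: X'_def)
  note F2c = linear_opD(1)[OF F2l X'c]
  have FX: "F X = al \<cdot>\<^sub>m D + F2 X'"
  proof -
    have "F X' = F2 X'" unfolding F2_def rank_one_update_def orth
      using linear_opD(1)[OF F(1) X'c] Dc by (intro eq_matI) auto
    then show ?thesis by (subst Xd) (use linear_opD[OF F(1)] Dc X'c FD in simp)
  qed
  have orth2: "hs_ip D (F2 X') = 0"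
  proof -
    have "hs_ip D (F2 X') = hs_ip (F2 D) X'" using F2s Dc X'c by (simp add: hs_symmetric_def hs_ip_def)
    then show ?thesis unfolding F2D hs_ip_smult_left[OF Dc X'c] orth by simp
  qed
  define V where "V Z = mat_diag n u * Z * mat_diag n u" for Z
  have Vc: "V Z \<in> carrier_mat n n" if "Z \<in> carrier_mat n n" for Z using that by (simp add: V_def)
  have Vi: "V Z $$ (i,j) = u i * Z $$ (i,j) * u j" if "Z \<in> carrier_mat n n" "i < n" "j < n" for Z i j
    unfolding V_def by (rule diag_sandwich_index[OF that])
  have Vf: "frob n (V Z) = frob n Z" if "Z \<in> carrier_mat n n" for Z
    unfolding V_def using that u by (intro frob_unitary_sandwich) auto
  define Y where "Y = X - V (F X)"
  have FXc: "F X \<in> carrier_mat n n" using linear_opD(1)[OF F(1) X] .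
  have Yc: "Y \<in> carrier_mat n n" using X Vc[OF FXc] by (simp add: Y_def minus_carrier_mat)
  have u1: "cmod (u i) = 1" if "i < n" for i using u[OF that] by simp
  have "e * m\<^sup>2 / 8 * frob n X \<le> frob n Y"
  proof (rule gap_arithmetic[where a = "cmod al * frob n D" and x = "frob n X'" and W = "frob n (F X)"])
    show "(frob n X)\<^sup>2 = (cmod al * frob n D)\<^sup>2 + (frob n X')\<^sup>2"
      by (subst Xd, rule frob_orthogonal[OF Dc X'c orth])
    have "frob n X \<le> frob n (V (F X)) + frob n Y" 
      using frob_triangle_diff[OF X Vc[OF FXc]] by (simp add: Y_def)
    then show "frob n X \<le> frob n Y + frob n (F X)" by (simp add: Vf[OF FXc])
    have "(frob n (F X))\<^sup>2 = (cmod al * frob n D)\<^sup>2 + (frob n (F2 X'))\<^sup>2"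
      unfolding FX by (rule frob_orthogonal[OF Dc F2c orth2])
    also have "(frob n (F2 X'))\<^sup>2 \<le> ((1 - e) * frob n X')\<^sup>2" using F2n[OF X'c] by (intro power_mono) auto
    also have "((1 - e) * frob n X')\<^sup>2 \<le> (1 - e) * (frob n X')\<^sup>2"
      unfolding power_mult_distrib using e0 e1 by (intro mult_right_mono) (auto simp: power2_eq_square mult_left_le_one_le)
    finally show "(frob n (F X))\<^sup>2 \<le> (frob n X)\<^sup>2 - e * (frob n X')\<^sup>2"
      using frob_orthogonal[OF Dc X'c orth, of al] Xd by (simp add: algebra_simps)
    define E where "E = D - V D"
    have UD: "V D \<in> carrier_mat n n" using Vc[OF Dc] .
    have Ec: "E \<in> carrier_mat n n" using Dc UD by (simp add: E_def minus_carrier_mat)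
    \<comment> \<open>The diagonal entries of \<open>D - U D U\<close> are \<open>d u (cnj u - u) = - 2 \<i> d\<^sup>2 u\<close>.\<close>
    have "2 * m * frob n D \<le> frob n E"
    proof -
      have "2 * m * frob n D = L2_set (\<lambda>p. 2 * m * (case p of (i,j) \<Rightarrow> cmod (D $$ (i,j)))) ({..<n}\<times>{..<n})"
        unfolding frob_def using m by (simp add: L2_set_right_distrib)
      also have "\<dots> \<le> frob n E" unfolding frob_def
      proof (intro L2_set_mono, goal_cases)
        case (1 p)
        then obtain i j where p: "p = (i,j)" "i < n" "j < n" by auto
        have Eij: "E $$ (i,j) = D $$ (i,j) - u i * D $$ (i,j) * u j"
          unfolding E_def using mat_minus_index[OF Dc UD p(2,3)] Vi[OF Dc p(2,3)] by simp
        show ?case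
        proof (cases "i = j")
          case False
          then show ?thesis using p by (simp add: D mat_diag_def)
        next
          case True
          have "u i * cnj (u i) = 1" using u1[OF p(2)] by (metis complex_norm_square of_real_1 one_power2)
          then have "E $$ (i,i) = d i * u i * (cnj (u i) - u i)"
            using Eij True p by (simp add: D mat_diag_def algebra_simps)
          also have "cnj (u i) - u i = - 2 * \<i> * d i" using u[OF p(2)] by (simp add: complex_eq_iff)
          finally have "cmod (E $$ (i,i)) = d i * (2 * d i)" using u1[OF p(2)] dpos[OF p(2)] by (simp add: norm_mult)
          moreover have "2 * m * d i \<le> d i * (2 * d i)" using d[OF p(2)] dpos[OF p(2)] by (simp add: mult.commute)
          ultimately show ?thesis using True p dpos[OF p(2)] by (simp add: D mat_diag_def)
        qed
      qed (use m in auto)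
      finally show ?thesis .
    qed
    then have "2 * m * (cmod al * frob n D) \<le> cmod al * frob n E"
      using mult_left_mono[of "2 * m * frob n D" "frob n E" "cmod al"] by (simp add: mult_ac)
    also have "\<dots> = frob n (al \<cdot>\<^sub>m E)" by (simp add: frob_smult[OF Ec])
    also have "al \<cdot>\<^sub>m E = Y - (X' - V (F2 X'))"
    proof (rule eq_matI)
      note US = Vc[OF F2c] Vc[OF FXc]
      have R: "X' - V (F2 X') \<in> carrier_mat n n" "Y - (X' - V (F2 X')) \<in> carrier_mat n n"
        using X'c US Yc by (auto simp: minus_carrier_mat)
      fix i j assume "i < dim_row (Y - (X' - V (F2 X')))" "j < dim_col (Y - (X' - V (F2 X')))"
      then have ij: "i < n" "j < n" using R by auto
      have "X $$ (i,j) = (al \<cdot>\<^sub>m D + X') $$ (i,j)" using Xd by simp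
      also have "\<dots> = al * D $$ (i,j) + X' $$ (i,j)" using Dc X'c ij by simp
      finally have 1: "X $$ (i,j) = al * D $$ (i,j) + X' $$ (i,j)" .
      have 2: "F X $$ (i,j) = al * D $$ (i,j) + F2 X' $$ (i,j)" using FX Dc F2c ij by simp
      have "(Y - (X' - V (F2 X'))) $$ (i,j) = X $$ (i,j) - V (F X) $$ (i,j) - (X' $$ (i,j) - V (F2 X') $$ (i,j))"
        unfolding mat_minus_index[OF Yc R(1) ij] mat_minus_index[OF X'c US(1) ij]
        unfolding Y_def mat_minus_index[OF X US(2) ij] by (rule refl)
      also have "\<dots> = al * (D $$ (i,j) - V D $$ (i,j))"
        unfolding Vi[OF FXc ij] Vi[OF F2c ij] Vi[OF Dc ij] 1 2 by (simp add: algebra_simps)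
      also have "D $$ (i,j) - V D $$ (i,j) = E $$ (i,j)"
        unfolding E_def using mat_minus_index[OF Dc UD ij] by simp
      also have "al * E $$ (i,j) = (al \<cdot>\<^sub>m E) $$ (i,j)" using Ec ij by simp
      finally show "(al \<cdot>\<^sub>m E) $$ (i,j) = (Y - (X' - V (F2 X'))) $$ (i,j)" by simp
    qed (use Ec carrier_matD[OF Vc[OF F2c]] in auto)
    also have "frob n (Y - (X' - V (F2 X'))) \<le> frob n Y + frob n (X' - V (F2 X'))"
      using Yc X'c Vc[OF F2c] by (intro frob_triangle_minus) (auto simp: minus_carrier_mat)
    also have "frob n (X' - V (F2 X')) \<le> frob n X' + frob n (F2 X')"
      using frob_triangle_minus[OF X'c Vc[OF F2c]] Vf[OF F2c] by simp
    also have "frob n (F2 X') \<le> frob n X'" using F2n[OF X'c] e0 mult_right_mono[of "1 - e" 1 "frob n X'"] by simp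
    finally show "2 * m * (cmod al * frob n D) \<le> frob n Y + 2 * frob n X'" by simp
  qed (use m m1 e0 e1 in auto)
  moreover have "g * n * m ^ 4 / 8 * frob n X \<le> e * m\<^sup>2 / 8 * frob n X"
  proof -
    have "g * (n * m\<^sup>2) * m\<^sup>2 \<le> e * m\<^sup>2" unfolding e_def using frD g by (intro mult_right_mono mult_left_mono) auto
    then have "g * n * m ^ 4 \<le> e * m\<^sup>2" by (simp add: power4_eq_xxxx power2_eq_square mult.assoc)
    then show ?thesis by (intro mult_right_mono divide_right_mono) auto
  qed
  ultimately show ?thesis unfolding Y_def V_def by linarith
qed

text \<open>If \<open>D\<close> is only a subsolution, \<open>F D = D - E\<close> with \<open>E \<ge> 0\<close>, then the positive rank-one map
  \<open>X \<mapsto> E \<langle>E, X\<rangle> / \<langle>E, D\<rangle>\<close> turns \<open>D\<close> into an exact eigenvector without destroying symmetry; its norm \<open>\<parallel>E\<parallel>\<^sup>2 / \<langle>E, D\<rangle> \<le> p\<close> is what it costs.\<close>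
lemma rotated_subsolution_gap:
  assumes n: "0 < n" and F: "linear_op n F" "hs_symmetric n F" "positivity_preserving n F"
    and d: "\<And>i. i < n \<Longrightarrow> m \<le> d i \<and> d i \<le> 1" and m: "0 < m"
    and D: "D = mat_diag n (\<lambda>i. complex_of_real (d i))" and FD: "F D = D - E" and E: "psd n E"
    and w: "0 < Re (hs_ip E D)" and p: "(frob n E)\<^sup>2 \<le> p * Re (hs_ip E D)"
    and g: "0 \<le> g" and low: "\<And>X v. psd n X \<Longrightarrow> v \<in> carrier_vec n \<Longrightarrow> g * Re (mat_trace X) * (vnorm v)\<^sup>2 \<le> quad_form (F X) v"
    and u: "\<And>i. i < n \<Longrightarrow> cmod (u i) = 1 \<and> Im (u i) = d i"
    and X: "X \<in> carrier_mat n n"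
  shows "(g * n * m ^ 4 / 8 - p) * frob n X \<le> frob n (X - mat_diag n u * F X * mat_diag n u)"
proof -
  have Dc: "D \<in> carrier_mat n n" by (simp add: D)
  have Ec: "E \<in> carrier_mat n n" using E psd_carrier by auto
  have dpos: "0 \<le> d i" if "i < n" for i using d[OF that] m by linarith
  have Dp: "psd n D" unfolding D by (intro psd_diag) (use dpos in auto)
  define w where "w = Re (hs_ip E D)"
  have w0: "0 < w" and wE: "hs_ip E D = complex_of_real w"
    using assms(10) complex_of_real_Re[OF hs_ip_psd_nonneg(2)[OF E Dp]] by (auto simp: w_def)
  define G where "G = rank_one_update F (1 / w) E"
  have Gl: "linear_op n G" and Gs: "hs_symmetric n G"
    unfolding G_def using rank_one_update_linear rank_one_update_symmetric F Ec by auto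
  have Gq: "quad_form (F Z) v \<le> quad_form (G Z) v" if "psd n Z" "v \<in> carrier_vec n" for Z v
    unfolding G_def rank_one_update_quad_form[OF F(1) E that]
    using hs_ip_psd_nonneg(1)[OF E that(1)] w0 E that(2) by (simp add: psd_iff)
  have Gp: "positivity_preserving n G"
  proof (rule positivity_preservingI)
    fix Z :: "complex mat" assume Z: "psd n Z"
    have FZ: "psd n (F Z)" using positivity_preservingD[OF F(3) Z] .
    then have "herm_mat n (G Z)" unfolding G_def by (intro rank_one_update_herm E Z) (simp add: psd_iff)
    moreover have "0 \<le> quad_form (G Z) v" if "v \<in> carrier_vec n" for v using Gq[OF Z that] FZ that by (force simp: psd_iff)
    ultimately show "psd n (G Z)" by (simp add: psd_iff)
  qed
  have GD: "G D = D" unfolding G_def rank_one_update_def FD wE using w0 Dc Ec by (intro eq_matI) auto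
  have Glow: "g * Re (mat_trace Z) * (vnorm v)\<^sup>2 \<le> quad_form (G Z) v" if "psd n Z" "v \<in> carrier_vec n" for Z v
    using low[OF that] Gq[OF that] by linarith
  define V where "V Z = mat_diag n u * Z * mat_diag n u" for Z
  have Vc: "V Z \<in> carrier_mat n n" if "Z \<in> carrier_mat n n" for Z using that by (simp add: V_def)
  have Vi: "V Z $$ (i,j) = u i * Z $$ (i,j) * u j" if "Z \<in> carrier_mat n n" "i < n" "j < n" for Z i j
    unfolding V_def by (rule diag_sandwich_index[OF that])
  have Vf: "frob n (V Z) = frob n Z" if "Z \<in> carrier_mat n n" for Z
    unfolding V_def using that u by (intro frob_unitary_sandwich) auto
  note FXc = linear_opD(1)[OF F(1) X] and GXc = linear_opD(1)[OF Gl X]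
  have "g * n * m ^ 4 / 8 * frob n X \<le> frob n (X - V (G X))"
    unfolding V_def by (rule rotated_eigenvector_gap[OF n Gl Gs Gp d m D GD g Glow u X])
  also have "\<dots> \<le> frob n (X - V (F X)) + frob n (V (G X - F X))"
  proof -
    have c: "G X - F X \<in> carrier_mat n n" "X - V (F X) \<in> carrier_mat n n" using FXc GXc X Vc[OF FXc] by (auto simp: minus_carrier_mat)
    have "X - V (G X) = (X - V (F X)) - V (G X - F X)"
    proof (rule eq_matI)
      fix i j assume "i < dim_row ((X - V (F X)) - V (G X - F X))" "j < dim_col ((X - V (F X)) - V (G X - F X))"
      then have ij: "i < n" "j < n" using Vc[OF c(1)] by auto
      show "(X - V (G X)) $$ (i,j) = ((X - V (F X)) - V (G X - F X)) $$ (i,j)"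
        unfolding mat_minus_index[OF c(2) Vc[OF c(1)] ij] mat_minus_index[OF X Vc[OF GXc] ij] mat_minus_index[OF X Vc[OF FXc] ij]
          Vi[OF c(1) ij] Vi[OF GXc ij] Vi[OF FXc ij] mat_minus_index[OF GXc FXc ij] by (simp add: algebra_simps)
    qed (use carrier_matD[OF Vc[OF c(1)]] carrier_matD[OF Vc[OF GXc]] in auto)
    then show ?thesis using frob_triangle_minus[of "X - V (F X)" n "V (G X - F X)"] c Vc[OF c(1)] by simp
  qed
  also have "frob n (V (G X - F X)) \<le> p * frob n X"
  proof -
    have "frob n (V (G X - F X)) = frob n (G X - F X)"
      using FXc GXc by (intro Vf) (simp add: minus_carrier_mat)
    also have "frob n (G X - F X) = frob n ((complex_of_real (1 / w) * hs_ip E X) \<cdot>\<^sub>m E)"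
    proof -
      have "G X - F X = (complex_of_real (1 / w) * hs_ip E X) \<cdot>\<^sub>m E"
        unfolding G_def rank_one_update_def using FXc Ec by (intro eq_matI) auto
      then show ?thesis by simp
    qed
    also have "\<dots> = 1 / w * cmod (hs_ip E X) * frob n E" using w0 by (simp add: frob_smult[OF Ec] norm_mult norm_divide)
    also have "\<dots> \<le> 1 / w * (frob n E * frob n X) * frob n E"
      using w0 hs_ip_le[OF Ec X] by (intro mult_right_mono mult_left_mono) auto
    also have "\<dots> = (frob n E)\<^sup>2 / w * frob n X" by (simp add: power2_eq_square)
    also have "\<dots> \<le> p * frob n X" using p w0 unfolding w_def[symmetric] by (intro mult_right_mono) (auto simp: field_simps)
    finally show ?thesis .
  qed
  finally show ?thesis unfolding V_def by (simp add: algebra_simps)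
qed

section \<open>The Dyson equation at one spectral parameter\<close>

lemma vnorm_zero [simp]: "vnorm (0\<^sub>v n) = 0"
  by (simp add: vnorm_def L2_set_def)

lemma polarization:
  assumes A: "herm_mat n A" and v: "v \<in> carrier_vec n" and w: "w \<in> carrier_vec n"
  shows "4 * Re ((A *\<^sub>v v) \<bullet>c w) = quad_form A (v + w) - quad_form A (v - w)"
proof -
  have Ac: "A \<in> carrier_mat n n" "mat_adjoint A = A" using A by (auto simp: herm_mat_def)
  have Av: "A *\<^sub>v v \<in> carrier_vec n" "A *\<^sub>v w \<in> carrier_vec n" using Ac v w by auto
  have "Re ((A *\<^sub>v w) \<bullet>c v) = Re ((A *\<^sub>v v) \<bullet>c w)"
    using cinner_adjoint[OF Ac(1) v w] cinner_commute[OF v Av(2)] Ac(2) by simp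
  moreover have "quad_form A (v + w) = quad_form A v + quad_form A w + Re ((A *\<^sub>v v) \<bullet>c w) + Re ((A *\<^sub>v w) \<bullet>c v)"
    unfolding quad_form_def using Ac(1) v w Av
    by (simp add: mult_add_distrib_mat_vec[of _ n n] cinner_sum[of _ n] sum.distrib algebra_simps)
  moreover have "quad_form A (v - w) = quad_form A v + quad_form A w - Re ((A *\<^sub>v v) \<bullet>c w) - Re ((A *\<^sub>v w) \<bullet>c v)"
    unfolding quad_form_def using Ac(1) v w Av
    by (simp add: mult_minus_distrib_mat_vec[of _ n n] cinner_sum[of _ n] sum.distrib sum_subtractf algebra_simps)
  ultimately show ?thesis by simp
qed

lemma parallelogram:
  assumes v: "v \<in> carrier_vec n" and w: "w \<in> carrier_vec n"
  shows "(vnorm (v + w))\<^sup>2 + (vnorm (v - w))\<^sup>2 = 2 * (vnorm v)\<^sup>2 + 2 * (vnorm w)\<^sup>2"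
proof -
  have "(cmod (a + b))\<^sup>2 + (cmod (a - b))\<^sup>2 = 2 * (cmod a)\<^sup>2 + 2 * (cmod b)\<^sup>2" for a b
    by (simp add: cmod_power2) (simp add: power2_eq_square algebra_simps)
  note id = this
  have "(vnorm (v + w))\<^sup>2 + (vnorm (v - w))\<^sup>2 = (\<Sum>i<n. (cmod (v $ i + w $ i))\<^sup>2 + (cmod (v $ i - w $ i))\<^sup>2)"
    unfolding vnorm_sq using v w by (simp add: sum.distrib)
  also have "\<dots> = 2 * (vnorm v)\<^sup>2 + 2 * (vnorm w)\<^sup>2"
    unfolding id vnorm_sq using v w by (simp add: sum.distrib sum_distrib_left)
  finally show ?thesis .
qed

text \<open>Polarisation and the parallelogram identity bound \<open>Re \<langle>A v, w\<rangle>\<close> by \<open>a (\<parallel>v\<parallel>\<^sup>2 + \<parallel>w\<parallel>\<^sup>2) / 2\<close>; the multiple \<open>w\<close> of \<open>A v\<close>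
  with the norm of \<open>v\<close> gives the claim.\<close>
lemma herm_numerical_bound:
  assumes A: "herm_mat n A" and b: "\<And>v. v \<in> carrier_vec n \<Longrightarrow> \<bar>quad_form A v\<bar> \<le> a * (vnorm v)\<^sup>2"
    and v: "v \<in> carrier_vec n"
  shows "vnorm (A *\<^sub>v v) \<le> a * vnorm v"
proof (cases "A *\<^sub>v v = 0\<^sub>v n \<or> v = 0\<^sub>v n")
  case True
  have Ac: "A \<in> carrier_mat n n" using A by (auto simp: herm_mat_def)
  from True have z: "vnorm (A *\<^sub>v v) = 0" using Ac by auto
  show ?thesis
  proof (cases "v = 0\<^sub>v n")
    case False
    then have "0 < vnorm v" using v vnorm_pos by blast
    moreover have "0 \<le> a * (vnorm v)\<^sup>2" using b[OF v] by (meson abs_ge_zero order_trans)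
    ultimately show ?thesis unfolding z by (metis power2_eq_square mult.assoc zero_le_mult_iff less_le_not_le)
  qed (use z in simp)
next
  case False
  have Ac: "A \<in> carrier_mat n n" using A by (auto simp: herm_mat_def)
  have Av: "A *\<^sub>v v \<in> carrier_vec n" using Ac v by simp
  have p: "0 < vnorm v" "0 < vnorm (A *\<^sub>v v)" using False vnorm_pos[OF v] vnorm_pos[OF Av] by simp_all
  define r where "r = vnorm v / vnorm (A *\<^sub>v v)"
  have r: "0 < r" using p by (simp add: r_def)
  define w where "w = complex_of_real r \<cdot>\<^sub>v (A *\<^sub>v v)"
  have w: "w \<in> carrier_vec n" using Av by (simp add: w_def)
  have "vnorm w = r * vnorm (A *\<^sub>v v)" using r by (simp add: w_def)
  then have wn: "vnorm w = vnorm v" using p by (simp add: r_def)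
  have "(A *\<^sub>v v) \<bullet>c w = complex_of_real r * ((A *\<^sub>v v) \<bullet>c (A *\<^sub>v v))"
    unfolding w_def using Av Ac by (auto simp: cinner_sum[of _ n] sum_distrib_left intro!: sum.cong)
  then have "Re ((A *\<^sub>v v) \<bullet>c w) = vnorm v * vnorm (A *\<^sub>v v)"
    using p by (simp add: cinner_self r_def power2_eq_square)
  then have "4 * (vnorm v * vnorm (A *\<^sub>v v)) = quad_form A (v + w) - quad_form A (v - w)"
    using polarization[OF A v w] by simp
  also have "\<dots> \<le> a * (vnorm (v + w))\<^sup>2 + a * (vnorm (v - w))\<^sup>2"
    using b[of "v + w"] b[of "v - w"] v w by (simp add: abs_le_iff)
  also have "\<dots> = 4 * (vnorm v * (a * vnorm v))"
    unfolding distrib_left[symmetric] parallelogram[OF v w] wn by (simp add: power2_eq_square)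
  finally have "vnorm v * vnorm (A *\<^sub>v v) \<le> vnorm v * (a * vnorm v)" by simp
  then show ?thesis using p(1) by simp
qed

lemma quad_form_im_mat:
  assumes "M \<in> carrier_mat n n" "v \<in> carrier_vec n"
  shows "quad_form (im_mat M) v = Im ((M *\<^sub>v v) \<bullet>c v)" "quad_form (re_mat M) v = Re ((M *\<^sub>v v) \<bullet>c v)"
proof -
  note d = re_im_mat[OF assms(1)]
  have c: "re_mat M \<in> carrier_mat n n" "im_mat M \<in> carrier_mat n n" using d(1,2) by (auto simp: herm_mat_def)
  have "M *\<^sub>v v = re_mat M *\<^sub>v v + \<i> \<cdot>\<^sub>v (im_mat M *\<^sub>v v)"
  proof -
    have "M *\<^sub>v v = (re_mat M + \<i> \<cdot>\<^sub>m im_mat M) *\<^sub>v v" using d(3) by simp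
    also have "\<dots> = re_mat M *\<^sub>v v + (\<i> \<cdot>\<^sub>m im_mat M) *\<^sub>v v" using c assms by (intro add_mult_distrib_mat_vec) auto
    also have "(\<i> \<cdot>\<^sub>m im_mat M) *\<^sub>v v = \<i> \<cdot>\<^sub>v (im_mat M *\<^sub>v v)" using c assms by (intro eq_vecI) auto
    finally show ?thesis .
  qed
  then have e: "(M *\<^sub>v v) \<bullet>c v = (re_mat M *\<^sub>v v) \<bullet>c v + \<i> * ((im_mat M *\<^sub>v v) \<bullet>c v)"
    using c assms by (simp add: add_scalar_prod_distrib[of _ n] cinner_smult_left[of _ n])
  have "Im ((re_mat M *\<^sub>v v) \<bullet>c v) = 0" "Im ((im_mat M *\<^sub>v v) \<bullet>c v) = 0"
    using quad_form_im d(1,2) assms(2) by auto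
  then show "quad_form (im_mat M) v = Im ((M *\<^sub>v v) \<bullet>c v)" "quad_form (re_mat M) v = Re ((M *\<^sub>v v) \<bullet>c v)"
    unfolding e quad_form_def by simp_all
qed

lemma re_im_mult_vec_bound:
  assumes M: "M \<in> carrier_mat n n" and v: "v \<in> carrier_vec n"
    and "vnorm (re_mat M *\<^sub>v v) \<le> a" "vnorm (im_mat M *\<^sub>v v) \<le> a"
  shows "vnorm (M *\<^sub>v v) \<le> 2 * a"
proof -
  note d = re_im_mat[OF M]
  have c: "re_mat M \<in> carrier_mat n n" "im_mat M \<in> carrier_mat n n" using d(1,2) by (auto simp: herm_mat_def)
  have "M *\<^sub>v v = (re_mat M + \<i> \<cdot>\<^sub>m im_mat M) *\<^sub>v v" using d(3) by simp
  also have "\<dots> = re_mat M *\<^sub>v v + (\<i> \<cdot>\<^sub>m im_mat M) *\<^sub>v v" using c v by (intro add_mult_distrib_mat_vec) auto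
  also have "(\<i> \<cdot>\<^sub>m im_mat M) *\<^sub>v v = \<i> \<cdot>\<^sub>v (im_mat M *\<^sub>v v)" using c v by (intro eq_vecI) auto
  finally have "vnorm (M *\<^sub>v v) \<le> vnorm (re_mat M *\<^sub>v v) + vnorm (\<i> \<cdot>\<^sub>v (im_mat M *\<^sub>v v))"
    using vnorm_triangle[of "re_mat M *\<^sub>v v" n "\<i> \<cdot>\<^sub>v (im_mat M *\<^sub>v v)"] c v by simp
  then show ?thesis using assms(3,4) by simp
qed

lemma numerical_radius_bound:
  assumes M: "M \<in> carrier_mat n n" and b: "\<And>v. v \<in> carrier_vec n \<Longrightarrow> cmod ((M *\<^sub>v v) \<bullet>c v) \<le> a * (vnorm v)\<^sup>2"
    and v: "v \<in> carrier_vec n"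
  shows "vnorm (M *\<^sub>v v) \<le> 2 * (a * vnorm v)"
proof (rule re_im_mult_vec_bound[OF M v])
  have "\<bar>quad_form (re_mat M) w\<bar> \<le> a * (vnorm w)\<^sup>2" if w: "w \<in> carrier_vec n" for w
    unfolding quad_form_im_mat(2)[OF M w] by (rule order_trans[OF abs_Re_le_cmod b[OF w]])
  from herm_numerical_bound[OF re_im_mat(1)[OF M] this v]
  show "vnorm (re_mat M *\<^sub>v v) \<le> a * vnorm v" .
  have "\<bar>quad_form (im_mat M) w\<bar> \<le> a * (vnorm w)\<^sup>2" if w: "w \<in> carrier_vec n" for w
    unfolding quad_form_im_mat(1)[OF M w] by (rule order_trans[OF abs_Im_le_cmod b[OF w]])
  from herm_numerical_bound[OF re_im_mat(2)[OF M] this v]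
  show "vnorm (im_mat M *\<^sub>v v) \<le> a * vnorm v" .
qed

locale flat_self_energy =
  fixes N :: nat and S :: "complex mat \<Rightarrow> complex mat" and c C :: real
  assumes N: "1 \<le> N" and lin: "linear_op N S" and sym: "hs_symmetric N S" and pos: "positivity_preserving N S"
    and flat: "flat_op N c C S" and c: "0 < c" "c \<le> C"
begin

lemma N_pos: "0 < N" "0 < real N" using N by auto

lemma C_pos: "0 < C" using c by simp

lemmas S_carrier = linear_opD(1)[OF lin]

lemma flat_quad_form:
  assumes R: "psd N R" and v: "v \<in> carrier_vec N"
  shows "c * (Re (mat_trace R) / N) * (vnorm v)\<^sup>2 \<le> quad_form (S R) v"
    "quad_form (S R) v \<le> C * (Re (mat_trace R) / N) * (vnorm v)\<^sup>2"
proof -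
  have "mat_trace R = complex_of_real (Re (mat_trace R))"
    using complex_of_real_Re[OF herm_trace_real] R by (auto simp: psd_iff)
  then have e: "complex_of_real a * norm_trace N R = complex_of_real (a * (Re (mat_trace R) / N))" for a
    unfolding norm_trace_def by (metis of_real_divide of_real_mult of_real_of_nat_eq)
  have f: "loewner_le N ((complex_of_real c * norm_trace N R) \<cdot>\<^sub>m 1\<^sub>m N) (S R)" 
    "loewner_le N (S R) ((complex_of_real C * norm_trace N R) \<cdot>\<^sub>m 1\<^sub>m N)"
    using flat R psd_carrier[OF R] by (auto simp: flat_op_def)
  show "c * (Re (mat_trace R) / N) * (vnorm v)\<^sup>2 \<le> quad_form (S R) v"
    using f(1) v unfolding e loewner_le_def by (metis quad_form_scalar)
  show "quad_form (S R) v \<le> C * (Re (mat_trace R) / N) * (vnorm v)\<^sup>2"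
    using f(2) v unfolding e loewner_le_def by (metis quad_form_scalar)
qed

text \<open>Flatness turns the normalised Hilbert--Schmidt norm into an operator norm bound: \<open>\<plusminus>H\<close> lies below
  \<open>(t + H\<^sup>2 / t) / 2\<close>, whose normalised trace equals \<open>t\<close> for \<open>t = \<parallel>H\<parallel>\<^sub>h\<^sub>s\<close>.\<close>
lemma S_herm_bound:
  assumes H: "herm_mat N H" and v: "v \<in> carrier_vec N"
  shows "vnorm (S H *\<^sub>v v) \<le> C * (frob N H / sqrt N) * vnorm v"
proof (cases "frob N H = 0")
  case True
  then have "S H = 0\<^sub>m N N" using H linear_op_zero[OF lin] frob_eq_0 by (auto simp: herm_mat_def)
  moreover have "0\<^sub>m N N *\<^sub>v v = (0\<^sub>v N :: complex vec)" using v by (intro eq_vecI) auto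
  ultimately show ?thesis using True by simp
next
  case False
  have Hc: "H \<in> carrier_mat N N" "mat_adjoint H = H" using H by (auto simp: herm_mat_def)
  define t where "t = frob N H / sqrt N"
  have "0 < frob N H" using False frob_nonneg[of N H] by linarith
  then have t: "0 < t" using N_pos by (simp add: t_def)
  have t2: "(frob N H)\<^sup>2 = N * t\<^sup>2" using N_pos by (simp add: t_def power_divide)
  define P where "P = complex_of_real (1/2 * t) \<cdot>\<^sub>m 1\<^sub>m N + complex_of_real (1 / (2 * t)) \<cdot>\<^sub>m (H * H)"
  have HH: "H * H \<in> carrier_mat N N" using Hc by simp
  have Pc: "P \<in> carrier_mat N N" using HH by (simp add: P_def)
  have sq: "psd N (P + complex_of_real s \<cdot>\<^sub>m H)" if s: "s = 1 \<or> s = -1" for s :: real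
  proof -
    define K where "K = complex_of_real t \<cdot>\<^sub>m 1\<^sub>m N + complex_of_real s \<cdot>\<^sub>m H"
    have Kc: "K \<in> carrier_mat N N" "mat_adjoint K = K" using Hc by (auto simp: K_def mat_adjoint_add[of _ N N])
    have "K * K = complex_of_real (t\<^sup>2) \<cdot>\<^sub>m 1\<^sub>m N + complex_of_real (2 * t * s) \<cdot>\<^sub>m H + H * H"
    proof -
      have "K * K = complex_of_real t \<cdot>\<^sub>m (complex_of_real t \<cdot>\<^sub>m 1\<^sub>m N + complex_of_real s \<cdot>\<^sub>m H) 
          + complex_of_real s \<cdot>\<^sub>m (complex_of_real t \<cdot>\<^sub>m H + complex_of_real s \<cdot>\<^sub>m (H * H))"
        unfolding K_def using Hc
        by (simp add: add_mult_distrib_mat[of _ N N _ _ N] mult_add_distrib_mat[of _ N N _ N] mult_smult_assoc_mat[of _ N N _ N] mult_smult_distrib[of _ N N _ N])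
      also have "\<dots> = complex_of_real (t\<^sup>2) \<cdot>\<^sub>m 1\<^sub>m N + complex_of_real (2 * t * s) \<cdot>\<^sub>m H + H * H"
        using Hc HH s by (intro eq_matI) (auto simp: algebra_simps power2_eq_square simp del: index_mult_mat(1))
      finally show ?thesis .
    qed
    then have "P + complex_of_real s \<cdot>\<^sub>m H = complex_of_real (1 / (2 * t)) \<cdot>\<^sub>m (K * K)"
      unfolding P_def using Hc HH t by (intro eq_matI) (auto simp: field_simps power2_eq_square simp del: index_mult_mat(1))
    moreover have "psd N (K * K)" using psd_gram[OF Kc(1)] Kc(2) by simp
    ultimately show ?thesis using psd_smult[of N "K * K" "1 / (2 * t)"] t by simp
  qed
  have Pp: "psd N P"
  proof -
    have "psd N (H * H)" using psd_gram[OF Hc(1)] Hc(2) by simp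
    then show ?thesis unfolding P_def using t by (intro psd_add psd_smult) auto
  qed
  have trP: "Re (mat_trace P) = N * t"
  proof -
    have "mat_trace (H * H) = hs_ip H H" using Hc by (simp add: hs_ip_def)
    also have "\<dots> = complex_of_real (N * t\<^sup>2)" unfolding hs_ip_self[OF Hc(1)] t2 by simp
    finally have "mat_trace P = complex_of_real (1/2 * t) * N + complex_of_real (1 / (2 * t)) * complex_of_real (N * t\<^sup>2)"
      unfolding P_def using HH by (simp add: mat_trace_add[of _ N] mat_trace_smult[of _ N] del: of_real_mult of_real_divide)
    then have "Re (mat_trace P) = 1/2 * t * N + 1 / (2 * t) * (N * t\<^sup>2)" by simp
    also have "\<dots> = N * t" using t by (simp add: field_simps power2_eq_square)
    finally show ?thesis .
  qed
  have q: "- (s * quad_form (S H) w) \<le> C * t * (vnorm w)\<^sup>2" if s: "s = 1 \<or> s = -1" and w: "w \<in> carrier_vec N" for s :: real and w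
  proof -
    have "psd N (S (P + complex_of_real s \<cdot>\<^sub>m H))" using positivity_preservingD[OF pos sq[OF s]] .
    then have "0 \<le> quad_form (S (P + complex_of_real s \<cdot>\<^sub>m H)) w" using w by (simp add: psd_iff)
    also have "S (P + complex_of_real s \<cdot>\<^sub>m H) = S P + complex_of_real s \<cdot>\<^sub>m S H"
      using linear_opD[OF lin] Pc Hc by simp
    also have "quad_form \<dots> w = quad_form (S P) w + s * quad_form (S H) w"
      using S_carrier Pc Hc w by (simp add: quad_form_add[of _ N] quad_form_smult[of _ N])
    also have "quad_form (S P) w \<le> C * t * (vnorm w)\<^sup>2" using flat_quad_form(2)[OF Pp w] trP N_pos by simp
    finally show ?thesis by simp
  qed
  have b: "\<bar>quad_form (S H) w\<bar> \<le> C * t * (vnorm w)\<^sup>2" if "w \<in> carrier_vec N" for w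
    using q[of 1, OF _ that] q[of "-1", OF _ that] by (simp add: abs_le_iff)
  show ?thesis unfolding t_def[symmetric]
    by (rule herm_numerical_bound[OF positive_linear_herm[OF lin pos H] b v])
qed

lemma S_bound:
  assumes X: "X \<in> carrier_mat N N" and v: "v \<in> carrier_vec N"
  shows "vnorm (S X *\<^sub>v v) \<le> 2 * (C * (frob N X / sqrt N) * vnorm v)"
proof (rule re_im_mult_vec_bound[OF S_carrier[OF X] v])
  note d = re_im_mat[OF X]
  have cc: "re_mat X \<in> carrier_mat N N" "im_mat X \<in> carrier_mat N N" using d(1,2) by (auto simp: herm_mat_def)
  have "(frob N (re_mat X))\<^sup>2 \<le> (frob N X)\<^sup>2" "(frob N (im_mat X))\<^sup>2 \<le> (frob N X)\<^sup>2" using d(4) by simp_all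
  then have fr: "frob N (re_mat X) \<le> frob N X" "frob N (im_mat X) \<le> frob N X" by (auto intro: power2_le_imp_le)
  have mono: "C * (f / sqrt N) * vnorm v \<le> C * (frob N X / sqrt N) * vnorm v" if "f \<le> frob N X" for f
    using that C_pos by (intro mult_right_mono mult_left_mono divide_right_mono) auto
  have SX: "S (mat_adjoint X) = mat_adjoint (S X)" by (rule positive_linear_adjoint[OF lin pos X])
  have "S (re_mat X) = re_mat (S X)" unfolding re_mat_def
    using X linear_opD[OF lin] by (simp add: SX)
  then show "vnorm (re_mat (S X) *\<^sub>v v) \<le> C * (frob N X / sqrt N) * vnorm v"
    using S_herm_bound[OF d(1) v] mono[OF fr(1)] by simp
  have "S (im_mat X) = im_mat (S X)" unfolding im_mat_def
    using X linear_opD(3)[OF lin] linear_op_minus[OF lin] by (simp add: SX minus_carrier_mat)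
  then show "vnorm (im_mat (S X) *\<^sub>v v) \<le> C * (frob N X / sqrt N) * vnorm v"
    using S_herm_bound[OF d(2) v] mono[OF fr(2)] by simp
qed

end

locale dyson_solution = flat_self_energy +
  fixes z :: complex and M :: "complex mat"
  assumes z: "0 < Im z" and mde: "mde_solution N S z M"

lemma (in dyson_solution) M_carrier: "M \<in> carrier_mat N N" using mde by (simp add: mde_solution_def)

lemma (in dyson_solution) im_M_herm: "herm_mat N (im_mat M)" by (rule re_im_mat(2)[OF M_carrier])
lemma (in dyson_solution) im_M_carrier: "im_mat M \<in> carrier_mat N N" using im_M_herm by (auto simp: herm_mat_def)

lemma (in dyson_solution) im_M_pos: "v \<in> carrier_vec N \<Longrightarrow> v \<noteq> 0\<^sub>v N \<Longrightarrow> 0 < quad_form (im_mat M) v"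
  using mde by (auto simp: mde_solution_def loewner_less_def)

lemma (in dyson_solution) im_M_psd: "psd N (im_mat M)"
proof -
  have "0 \<le> quad_form (im_mat M) v" if v: "v \<in> carrier_vec N" for v
  proof (cases "v = 0\<^sub>v N")
    case True
    then show ?thesis using im_M_carrier by (simp add: quad_form_def cinner_sum[of _ N])
  qed (use im_M_pos[OF v] in simp)
  then show ?thesis by (simp add: psd_iff im_M_herm)
qed

text \<open>Flatness places \<open>A = Im z + S[Im M]\<close> between \<open>a_low\<close> and \<open>a_up\<close>, while \<open>inv_bound\<close> is the bound for the
  inverse of \<open>M\<close>; the former degenerate at the real axis outside of the spectrum, the latter does not.\<close>
definition (in dyson_solution) "avg_im = Re (mat_trace (im_mat M)) / N"
definition (in dyson_solution) "a_low = Im z + c * avg_im"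
definition (in dyson_solution) "a_up = Im z + C * avg_im"
definition (in dyson_solution) "Amat = complex_of_real (Im z) \<cdot>\<^sub>m 1\<^sub>m N + S (im_mat M)"
definition (in dyson_solution) "inv_bound = cmod z + 2 * C / sqrt c"

lemma (in dyson_solution) avg_im_pos: "0 < avg_im"
proof -
  have "0 < (\<Sum>i<N. quad_form (im_mat M) (unit_vec N i))"
    using N_pos by (intro sum_pos im_M_pos) (auto simp: lessThan_empty_iff)
  then show ?thesis unfolding avg_im_def mat_trace_quad_form[OF im_M_carrier] using N_pos by simp
qed

lemma (in dyson_solution) a_pos: "0 < a_low" "a_low \<le> a_up" "0 < a_up"
proof -
  show 1: "0 < a_low" unfolding a_low_def using z c avg_im_pos by (simp add: add_pos_pos)
  show 2: "a_low \<le> a_up" unfolding a_low_def a_up_def using c avg_im_pos by simp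
  show "0 < a_up" using 1 2 by simp
qed

lemma (in dyson_solution) a_ratio: "a_up \<le> C / c * a_low"
proof -
  have "Im z * 1 \<le> Im z * (C / c)" using z c by (intro mult_left_mono) auto
  then show ?thesis unfolding a_low_def a_up_def using c by (simp add: field_simps)
qed

lemma (in dyson_solution) A_herm: "herm_mat N Amat"
  unfolding Amat_def by (intro herm_mat_add herm_mat_smult herm_mat_one positive_linear_herm[OF lin pos im_M_herm])

lemma (in dyson_solution) A_carrier: "Amat \<in> carrier_mat N N" using A_herm by (auto simp: herm_mat_def)

lemma (in dyson_solution) A_bounds:
  assumes v: "v \<in> carrier_vec N"
  shows "a_low * (vnorm v)\<^sup>2 \<le> quad_form Amat v" "quad_form Amat v \<le> a_up * (vnorm v)\<^sup>2"
proof -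
  have "quad_form Amat v = Im z * (vnorm v)\<^sup>2 + quad_form (S (im_mat M)) v"
    unfolding Amat_def using S_carrier[OF im_M_carrier] v by (simp add: quad_form_add[of _ N] quad_form_scalar)
  then show "a_low * (vnorm v)\<^sup>2 \<le> quad_form Amat v" "quad_form Amat v \<le> a_up * (vnorm v)\<^sup>2"
    using flat_quad_form[OF im_M_psd v] by (simp_all add: a_low_def a_up_def avg_im_def distrib_right)
qed

definition (in dyson_solution) "Zmat = z \<cdot>\<^sub>m 1\<^sub>m N + S M"

lemma (in dyson_solution) Z_carrier: "Zmat \<in> carrier_mat N N" using S_carrier[OF M_carrier] by (simp add: Zmat_def)

lemma (in dyson_solution) Z_M: "Zmat * M = (-1) \<cdot>\<^sub>m 1\<^sub>m N"
proof -
  have zm: "Zmat * M \<in> carrier_mat N N" using Z_carrier M_carrier by simp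
  have "1\<^sub>m N + Zmat * M = 0\<^sub>m N N" using mde by (simp add: mde_solution_def Zmat_def)
  then have "(1\<^sub>m N + Zmat * M) $$ (i,j) = 0" if "i < N" "j < N" for i j using that by simp
  then have "1\<^sub>m N $$ (i,j) + (Zmat * M) $$ (i,j) = 0" if "i < N" "j < N" for i j
    using that zm by (metis index_add_mat(1) carrier_matD)
  then show ?thesis using zm by (intro eq_matI) (auto simp: add_eq_0_iff2 simp del: index_mult_mat(1))
qed

text \<open>This is the imaginary part of \<open>- M\<^sup>-\<^sup>1 = z + S[M]\<close>, multiplied by \<open>M\<^sup>*\<close> and \<open>M\<close>.\<close>
lemma (in dyson_solution) im_M_eq: "im_mat M = mat_adjoint M * Amat * M"
proof -
  have aM: "mat_adjoint M \<in> carrier_mat N N" using M_carrier by simp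
  note asc = assoc_mult_mat[of _ N N _ N _ N]
  have Za: "mat_adjoint Zmat = cnj z \<cdot>\<^sub>m 1\<^sub>m N + S (mat_adjoint M)"
    unfolding Zmat_def using S_carrier[OF M_carrier] positive_linear_adjoint[OF lin pos M_carrier]
    by (simp add: mat_adjoint_add[of _ N N])
  have "mat_adjoint (Zmat * M) = (-1) \<cdot>\<^sub>m 1\<^sub>m N" unfolding Z_M by simp
  then have ZMa: "mat_adjoint M * mat_adjoint Zmat = (-1) \<cdot>\<^sub>m 1\<^sub>m N" by (simp add: mat_adjoint_mult[OF Z_carrier M_carrier])
  have im2: "M - mat_adjoint M = (2 * \<i>) \<cdot>\<^sub>m im_mat M"
    unfolding im_mat_def using M_carrier by (intro eq_matI) auto
  have dZ: "Zmat - mat_adjoint Zmat = (2 * \<i>) \<cdot>\<^sub>m Amat"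
  proof -
    have "S M - S (mat_adjoint M) = (2 * \<i>) \<cdot>\<^sub>m S (im_mat M)"
      using linear_op_minus[OF lin M_carrier aM] linear_opD(3)[OF lin im_M_carrier] im2 by simp
    then have e: "S M $$ (i,j) - S (mat_adjoint M) $$ (i,j) = 2 * \<i> * S (im_mat M) $$ (i,j)" if "i < N" "j < N" for i j
      using that S_carrier[OF M_carrier] S_carrier[OF aM] S_carrier[OF im_M_carrier]
      by (metis mat_minus_index index_smult_mat(1) carrier_matD)
    show ?thesis unfolding Za unfolding Amat_def Zmat_def
    proof (rule eq_matI)
      have k: "z - cnj z = 2 * \<i> * complex_of_real (Im z)" by (simp add: complex_eq_iff)
      fix i j assume "i < dim_row ((2 * \<i>) \<cdot>\<^sub>m (complex_of_real (Im z) \<cdot>\<^sub>m 1\<^sub>m N + S (im_mat M)))"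
        "j < dim_col ((2 * \<i>) \<cdot>\<^sub>m (complex_of_real (Im z) \<cdot>\<^sub>m 1\<^sub>m N + S (im_mat M)))"
      then have ij: "i < N" "j < N" using S_carrier[OF im_M_carrier] by auto
      then show "(z \<cdot>\<^sub>m 1\<^sub>m N + S M - (cnj z \<cdot>\<^sub>m 1\<^sub>m N + S (mat_adjoint M))) $$ (i, j) =
        ((2 * \<i>) \<cdot>\<^sub>m (complex_of_real (Im z) \<cdot>\<^sub>m 1\<^sub>m N + S (im_mat M))) $$ (i, j)"
        using S_carrier[OF M_carrier] S_carrier[OF aM] S_carrier[OF im_M_carrier] e[OF ij] k
        by (cases "i = j") (auto simp: algebra_simps)
    qed (use S_carrier[OF aM] S_carrier[OF im_M_carrier] in auto)
  qed
  have AM: "Amat * M \<in> carrier_mat N N" "mat_adjoint M * Amat * M \<in> carrier_mat N N" using A_carrier M_carrier aM by auto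
  have aZ: "mat_adjoint Zmat \<in> carrier_mat N N" using Z_carrier by simp
  have "(2 * \<i>) \<cdot>\<^sub>m (mat_adjoint M * Amat * M) = mat_adjoint M * ((2 * \<i>) \<cdot>\<^sub>m Amat) * M"
    using A_carrier M_carrier aM by (simp add: mult_smult_distrib[of _ N N _ N] mult_smult_assoc_mat[of _ N N _ N])
  also have "\<dots> = mat_adjoint M * (Zmat * M) - (mat_adjoint M * mat_adjoint Zmat) * M"
    unfolding dZ[symmetric] using Z_carrier aZ M_carrier aM
    by (simp add: mult_minus_distrib_mat[of _ N N _ N] minus_mult_distrib_mat[of _ N N _ _ N] asc)
  also have "\<dots> = M - mat_adjoint M"
    unfolding Z_M ZMa using M_carrier aM by (simp add: mult_smult_distrib[of _ N N _ N] mult_smult_assoc_mat[of _ N N _ N]) (intro eq_matI, auto)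
  finally have "(2 * \<i>) \<cdot>\<^sub>m (mat_adjoint M * Amat * M) = (2 * \<i>) \<cdot>\<^sub>m im_mat M" unfolding im2 .
  then have "2 * \<i> * (mat_adjoint M * Amat * M) $$ (i,j) = 2 * \<i> * im_mat M $$ (i,j)" if "i < N" "j < N" for i j
    using that AM im_M_carrier by (metis index_smult_mat(1) carrier_matD)
  then show ?thesis using AM im_M_carrier by (intro eq_matI) (auto simp del: index_mult_mat(1))
qed

lemma (in dyson_solution) quad_im_M:
  assumes v: "v \<in> carrier_vec N"
  shows "quad_form (im_mat M) v = quad_form Amat (M *\<^sub>v v)"
  by (subst im_M_eq) (rule quad_form_congruence[OF A_carrier M_carrier v])

text \<open>The identity \<open>Im M = M\<^sup>* A M\<close> makes \<open>Im M\<close> quadratic in \<open>M\<close> from below, and it is at most linear in \<open>M\<close>.\<close>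
lemma (in dyson_solution) M_bound:
  assumes v: "v \<in> carrier_vec N"
  shows "vnorm (M *\<^sub>v v) \<le> 1 / a_low * vnorm v"
proof -
  have Mv: "M *\<^sub>v v \<in> carrier_vec N" using M_carrier v by simp
  have "a_low * (vnorm (M *\<^sub>v v))\<^sup>2 \<le> quad_form (im_mat M) v" unfolding quad_im_M[OF v] by (rule A_bounds(1)[OF Mv])
  also have "\<dots> = Im ((M *\<^sub>v v) \<bullet>c v)" by (rule quad_form_im_mat(1)[OF M_carrier v])
  also have "\<dots> \<le> cmod ((M *\<^sub>v v) \<bullet>c v)" using abs_Im_le_cmod[of "(M *\<^sub>v v) \<bullet>c v"] by linarith
  also have "\<dots> \<le> vnorm (M *\<^sub>v v) * vnorm v" by (rule cinner_le[OF Mv v])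
  finally have "vnorm (M *\<^sub>v v) * (a_low * vnorm (M *\<^sub>v v)) \<le> vnorm (M *\<^sub>v v) * vnorm v" by (simp add: power2_eq_square algebra_simps)
  then have "a_low * vnorm (M *\<^sub>v v) \<le> vnorm v \<or> vnorm (M *\<^sub>v v) = 0"
    by (smt (verit) mult_le_cancel_left_pos vnorm_nonneg)
  then show ?thesis using a_pos by (auto simp: field_simps)
qed

text \<open>In the trace of \<open>Im M = M\<^sup>* A M \<ge> c \<langle>Im M\<rangle> M\<^sup>* M\<close> the factor \<open>\<langle>Im M\<rangle>\<close> cancels.\<close>
lemma (in dyson_solution) M_frob: "(frob N M)\<^sup>2 \<le> N / c"
proof -
  have tr: "N * avg_im = (\<Sum>i<N. quad_form Amat (M *\<^sub>v unit_vec N i))"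
  proof -
    have "N * avg_im = Re (mat_trace (im_mat M))" using N_pos by (simp add: avg_im_def)
    then show ?thesis unfolding mat_trace_quad_form[OF im_M_carrier] by (simp add: quad_im_M)
  qed
  have fr: "(frob N M)\<^sup>2 = (\<Sum>i<N. (vnorm (M *\<^sub>v unit_vec N i))\<^sup>2)"
  proof -
    have "M *\<^sub>v unit_vec N i = col M i" if "i < N" for i using M_carrier that by (intro eq_vecI) auto
    then show ?thesis unfolding frob_cols[OF M_carrier] by simp
  qed
  have "a_low * (frob N M)\<^sup>2 \<le> N * avg_im"
    unfolding tr fr sum_distrib_left using M_carrier by (intro sum_mono A_bounds) auto
  moreover have "c * avg_im * (frob N M)\<^sup>2 \<le> a_low * (frob N M)\<^sup>2"
    unfolding a_low_def using z by (intro mult_right_mono) auto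
  ultimately have "avg_im * (c * (frob N M)\<^sup>2) \<le> avg_im * N" by (simp add: mult_ac)
  then have "c * (frob N M)\<^sup>2 \<le> N" using avg_im_pos by simp
  then show ?thesis using c by (simp add: field_simps)
qed

lemma (in dyson_solution) M_frob_sqrt: "frob N M / sqrt N \<le> 1 / sqrt c"
proof -
  have "(frob N M / sqrt N)\<^sup>2 \<le> (1 / sqrt c)\<^sup>2"
    using M_frob N_pos c by (simp add: power_divide field_simps)
  then show ?thesis by (rule power2_le_imp_le) (use c in simp)
qed

lemma (in dyson_solution) avg_im_le: "avg_im \<le> 1 / sqrt c"
proof -
  have "complex_of_real ((frob N (1\<^sub>m N))\<^sup>2) = complex_of_real N"
    unfolding hs_ip_self[OF one_carrier_mat, symmetric] by (simp add: hs_ip_def)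
  then have "(frob N (1\<^sub>m N))\<^sup>2 = real N" by (simp only: of_real_eq_iff)
  then have f1: "frob N (1\<^sub>m N) = sqrt N" by (metis frob_nonneg real_sqrt_unique)
  have "(frob N (im_mat M))\<^sup>2 \<le> (frob N M)\<^sup>2" using re_im_mat(4)[OF M_carrier] by simp
  then have f2: "frob N (im_mat M) \<le> frob N M" by (rule power2_le_imp_le) simp
  have "N * avg_im = Re (hs_ip (1\<^sub>m N) (im_mat M))" using N_pos im_M_carrier by (simp add: avg_im_def hs_ip_def)
  also have "\<dots> \<le> cmod (hs_ip (1\<^sub>m N) (im_mat M))" by (rule complex_Re_le_cmod)
  also have "\<dots> \<le> frob N (1\<^sub>m N) * frob N (im_mat M)" by (rule hs_ip_le[OF one_carrier_mat im_M_carrier])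
  also have "\<dots> \<le> sqrt N * frob N M" unfolding f1 using f2 by (intro mult_left_mono) auto
  finally have "sqrt N * (sqrt N * avg_im) \<le> sqrt N * frob N M" by (simp add: mult.assoc[symmetric])
  then have "sqrt N * avg_im \<le> frob N M" using N_pos by simp
  then have "avg_im \<le> frob N M / sqrt N" using N_pos by (simp add: field_simps)
  then show ?thesis using M_frob_sqrt by simp
qed

lemma (in dyson_solution) inv_bound_pos: "0 < inv_bound"
  unfolding inv_bound_def using C_pos c by (simp add: add_nonneg_pos)

text \<open>The inverse of \<open>M\<close> is \<open>- (z + S[M])\<close>, and flatness bounds \<open>S[M]\<close> by the Hilbert--Schmidt norm of \<open>M\<close>.\<close>
lemma (in dyson_solution) M_lower_bound:
  assumes v: "v \<in> carrier_vec N"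
  shows "vnorm v \<le> inv_bound * vnorm (M *\<^sub>v v)"
proof -
  define w where "w = M *\<^sub>v v"
  have w: "w \<in> carrier_vec N" using M_carrier v by (simp add: w_def)
  have "Zmat *\<^sub>v w = (Zmat * M) *\<^sub>v v" unfolding w_def using assoc_mult_mat_vec[OF Z_carrier M_carrier v] by simp
  also have "\<dots> = (-1) \<cdot>\<^sub>v v" unfolding Z_M using v by (intro eq_vecI) auto
  finally have "vnorm v = vnorm (Zmat *\<^sub>v w)" by simp
  also have "Zmat *\<^sub>v w = z \<cdot>\<^sub>v w + S M *\<^sub>v w"
  proof -
    have "Zmat *\<^sub>v w = (z \<cdot>\<^sub>m 1\<^sub>m N) *\<^sub>v w + S M *\<^sub>v w" unfolding Zmat_def
      using S_carrier[OF M_carrier] w by (intro add_mult_distrib_mat_vec) auto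
    also have "(z \<cdot>\<^sub>m 1\<^sub>m N) *\<^sub>v w = z \<cdot>\<^sub>v w" using w by (intro eq_vecI) auto
    finally show ?thesis .
  qed
  also have "vnorm \<dots> \<le> cmod z * vnorm w + vnorm (S M *\<^sub>v w)"
    using vnorm_triangle[of "z \<cdot>\<^sub>v w" N "S M *\<^sub>v w"] S_carrier[OF M_carrier] w by simp
  also have "vnorm (S M *\<^sub>v w) \<le> 2 * (C * (frob N M / sqrt N) * vnorm w)" by (rule S_bound[OF M_carrier w])
  also have "\<dots> \<le> 2 * (C * (1 / sqrt c) * vnorm w)"
    using M_frob_sqrt C_pos by (intro mult_left_mono mult_right_mono) auto
  finally show ?thesis unfolding w_def[symmetric] inv_bound_def by (simp add: algebra_simps)
qed

section \<open>Balanced polar decomposition and the stability operator\<close>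

text \<open>Moving the square roots of the moduli of the diagonal entries into the congruence leaves a unitary diagonal.\<close>
lemma balanced_decomposition:
  assumes M: "M \<in> carrier_mat n n" and pos: "\<And>v. v \<in> carrier_vec n \<Longrightarrow> v \<noteq> 0\<^sub>v n \<Longrightarrow> 0 < Im ((M *\<^sub>v v) \<bullet>c v)"
  obtains B Bi u where "B \<in> carrier_mat n n" "Bi \<in> carrier_mat n n" "B * Bi = 1\<^sub>m n" "Bi * B = 1\<^sub>m n"
    "\<And>i. i < n \<Longrightarrow> cmod (u i) = 1 \<and> 0 < Im (u i)" "M = mat_adjoint B * mat_diag n u * B"
proof -
  note asc = assoc_mult_mat[of _ n n _ n _ n]
  obtain T l where T: "T \<in> carrier_mat n n" and inj: "\<forall>x\<in>carrier_vec n. T *\<^sub>v x = 0\<^sub>v n \<longrightarrow> x = 0\<^sub>v n"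
    and Tl: "mat_adjoint T * M * T = mat_diag n l"
    using positive_im_congruence_diagonal[OF M pos] by blast
  obtain R where R: "R \<in> carrier_mat n n" "T * R = 1\<^sub>m n" "R * T = 1\<^sub>m n"
    using invertible_of_injective[OF T] inj by blast
  have lpos: "0 < Im (l i)" if i: "i < n" for i
  proof -
    have c: "col T i \<in> carrier_vec n" using T i by auto
    have "T *\<^sub>v unit_vec n i \<noteq> 0\<^sub>v n" using inj i by (metis unit_vec_carrier unit_vec_nonzero)
    moreover have "T *\<^sub>v unit_vec n i = col T i" using T i by (intro eq_vecI) auto
    ultimately have "0 < Im ((M *\<^sub>v col T i) \<bullet>c col T i)" using pos c by simp
    also have "(M *\<^sub>v col T i) \<bullet>c col T i = l i" unfolding congruence_index[OF M T i i, symmetric] Tl using i by (simp add: mat_diag_def)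
    finally show ?thesis .
  qed
  have lnz: "cmod (l i) > 0" if "i < n" for i using lpos[OF that] by auto
  define s where "s i = complex_of_real (sqrt (cmod (l i)))" for i
  define u where "u i = l i / complex_of_real (cmod (l i))" for i
  have sus: "s i * u i * s i = l i" if "i < n" for i
  proof -
    have "s i * s i = complex_of_real (cmod (l i))" unfolding s_def of_real_mult[symmetric] by simp
    then have "s i * u i * s i = complex_of_real (cmod (l i)) * u i" by (simp add: mult_ac)
    then show ?thesis using lnz[OF that] by (simp add: u_def)
  qed
  have snz: "s i \<noteq> 0" if "i < n" for i using lnz[OF that] by (simp add: s_def)
  define E where "E = mat_diag n s"
  define E' where "E' = mat_diag n (\<lambda>i. 1 / s i)"
  have "(\<lambda>i. cnj (s i)) = s" by (simp add: s_def fun_eq_iff)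
  then have E: "E \<in> carrier_mat n n" "E' \<in> carrier_mat n n" "mat_adjoint E = E" by (auto simp: E_def E'_def)
  have EE: "E * E' = 1\<^sub>m n" "E' * E = 1\<^sub>m n"
    unfolding E_def E'_def mat_diag_diag using snz by (auto intro!: eq_matI simp: mat_diag_def)
  have aR: "mat_adjoint R * mat_adjoint T = 1\<^sub>m n" using R T by (simp add: mat_adjoint_mult[OF T R(1), symmetric])
  have Md: "M = mat_adjoint R * mat_diag n l * R"
  proof -
    have "mat_adjoint R * (mat_adjoint T * M * T) * R = (mat_adjoint R * mat_adjoint T) * M * (T * R)"
      using T R(1) M by (simp add: asc)
    then show ?thesis unfolding Tl aR R(2) using M by simp
  qed
  have d: "mat_diag n l = E * mat_diag n u * E"
    unfolding E_def mat_diag_diag using sus by (intro eq_matI) (auto simp: mat_diag_def)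
  define U where "U = mat_diag n u"
  have U: "U \<in> carrier_mat n n" by (simp add: U_def)
  have ER: "E * R \<in> carrier_mat n n" "T * E' \<in> carrier_mat n n" using E R T by auto
  show ?thesis
  proof (rule that[of "E * R" "T * E'" u])
    have "E * R * (T * E') = E * (R * T) * E'" using E R(1) T by (simp add: asc)
    then show "E * R * (T * E') = 1\<^sub>m n" unfolding R(3) using E EE by simp
    have "T * E' * (E * R) = T * (E' * E) * R" using E R(1) T by (simp add: asc)
    then show "T * E' * (E * R) = 1\<^sub>m n" unfolding EE using R T by simp
    show "cmod (u i) = 1 \<and> 0 < Im (u i)" if "i < n" for i
      using lnz[OF that] lpos[OF that] by (simp add: u_def norm_divide)
    show "M = mat_adjoint (E * R) * mat_diag n u * (E * R)"
      unfolding Md d mat_adjoint_mult[OF E(1) R(1)] E(3) U_def[symmetric] using E R(1) U by (simp add: asc)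
  qed (use ER in auto)
qed

text \<open>The bound \<open>\<mu>\<close> for \<open>M\<close> is a parameter because the two regimes have different ones: \<open>1 / a_low\<close> inside the
  spectrum, and a multiple of the inverse distance to the support outside.\<close>
locale balanced_solution = dyson_solution +
  fixes B Bi :: "complex mat" and u :: "nat \<Rightarrow> complex" and \<mu> :: real
  assumes B: "B \<in> carrier_mat N N" and Bi: "Bi \<in> carrier_mat N N" and BBi: "B * Bi = 1\<^sub>m N" and BiB: "Bi * B = 1\<^sub>m N"
    and u: "\<And>i. i < N \<Longrightarrow> cmod (u i) = 1 \<and> 0 < Im (u i)" and M_decomp: "M = mat_adjoint B * mat_diag N u * B"
    and mu: "\<And>v. v \<in> carrier_vec N \<Longrightarrow> vnorm (M *\<^sub>v v) \<le> \<mu> * vnorm v"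

definition (in balanced_solution) "Dmat = mat_diag N (\<lambda>i. complex_of_real (Im (u i)))"
definition (in balanced_solution) "Umat = mat_diag N u"

lemma (in balanced_solution) carriers: "Dmat \<in> carrier_mat N N" "Umat \<in> carrier_mat N N" "mat_adjoint B \<in> carrier_mat N N"
  "mat_adjoint Bi \<in> carrier_mat N N" "mat_adjoint Umat \<in> carrier_mat N N"
  using B Bi by (auto simp: Dmat_def Umat_def)

lemma (in balanced_solution) D_herm: "herm_mat N Dmat" by (auto simp: herm_mat_def Dmat_def)

lemma (in balanced_solution) adj_Bi_adj_B: "mat_adjoint Bi * mat_adjoint B = 1\<^sub>m N" "mat_adjoint B * mat_adjoint Bi = 1\<^sub>m N"
  by (metis mat_adjoint_mult[OF B Bi] BBi mat_adjoint_one) (metis mat_adjoint_mult[OF Bi B] BiB mat_adjoint_one)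

lemma (in balanced_solution) im_M_decomp: "im_mat M = mat_adjoint B * Dmat * B"
proof -
  note asc = assoc_mult_mat[of _ N N _ N _ N]
  have aM: "mat_adjoint M = mat_adjoint B * mat_adjoint Umat * B"
    unfolding M_decomp Umat_def[symmetric] using B carriers
    by (simp add: mat_adjoint_mult[of _ N N _ N] mat_adjoint_mult[of Umat N N B N] asc)
  have "M - mat_adjoint M = mat_adjoint B * (Umat - mat_adjoint Umat) * B"
    unfolding aM unfolding M_decomp Umat_def[symmetric] using B carriers
    by (simp add: mult_minus_distrib_mat[of _ N N _ N] minus_mult_distrib_mat[of _ N N _ _ N] asc)
  also have "Umat - mat_adjoint Umat = (2 * \<i>) \<cdot>\<^sub>m Dmat"
    unfolding Umat_def Dmat_def by (intro eq_matI) (auto simp: mat_diag_def complex_eq_iff)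
  also have "mat_adjoint B * ((2 * \<i>) \<cdot>\<^sub>m Dmat) * B = (2 * \<i>) \<cdot>\<^sub>m (mat_adjoint B * Dmat * B)"
    using B carriers by (simp add: mult_smult_distrib[of _ N N _ N] mult_smult_assoc_mat[of _ N N _ N])
  finally have "M - mat_adjoint M = (2 * \<i>) \<cdot>\<^sub>m (mat_adjoint B * Dmat * B)" .
  then have "im_mat M = (1 / (2 * \<i>)) \<cdot>\<^sub>m ((2 * \<i>) \<cdot>\<^sub>m (mat_adjoint B * Dmat * B))" by (simp add: im_mat_def)
  also have "\<dots> = mat_adjoint B * Dmat * B" using B carriers by (intro eq_matI) (auto simp del: index_mult_mat(1))
  finally show ?thesis .
qed

text \<open>In the balanced frame the imaginary part of the Dyson equation says that \<open>A\<close> becomes \<open>D = Im U\<close>.\<close>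
lemma (in balanced_solution) B_A_B: "B * Amat * mat_adjoint B = Dmat"
proof -
  note asc = assoc_mult_mat[of _ N N _ N _ N]
  define A where "A = Amat"
  have A: "A \<in> carrier_mat N N" using A_carrier by (simp add: A_def)
  define G where "G = B * A * mat_adjoint B"
  have G: "G \<in> carrier_mat N N" using B A by (simp add: G_def)
  have Mu: "M = mat_adjoint B * Umat * B" using M_decomp by (simp add: Umat_def)
  have aM: "mat_adjoint M = mat_adjoint B * mat_adjoint Umat * B"
    by (subst Mu) (use B carriers in \<open>simp add: mat_adjoint_mult[of _ N N _ N] mat_adjoint_mult[of Umat N N B N] asc\<close>)
  have "mat_adjoint B * Dmat * B = mat_adjoint M * A * M" using im_M_eq im_M_decomp by (simp add: A_def)
  also have "\<dots> = (mat_adjoint B * mat_adjoint Umat * B) * A * M" by (simp only: aM)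
  also have "\<dots> = (mat_adjoint B * mat_adjoint Umat * B) * A * (mat_adjoint B * Umat * B)"
    by (rule arg_cong[OF Mu])
  also have "\<dots> = mat_adjoint B * (mat_adjoint Umat * G * Umat) * B"
    unfolding G_def using B A carriers by (simp add: asc)
  finally have e: "mat_adjoint B * Dmat * B = mat_adjoint B * (mat_adjoint Umat * G * Umat) * B" .
  have cancel: "mat_adjoint Bi * (mat_adjoint B * X * B) * Bi = X" if X: "X \<in> carrier_mat N N" for X
  proof -
    have "mat_adjoint Bi * (mat_adjoint B * X * B) * Bi = (mat_adjoint Bi * mat_adjoint B) * X * (B * Bi)"
      using B Bi X by (simp add: asc)
    then show ?thesis unfolding adj_Bi_adj_B BBi using X by simp
  qed
  have UGU: "mat_adjoint Umat * G * Umat \<in> carrier_mat N N" using G carriers by simp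
  have DU: "Dmat = mat_adjoint Umat * G * Umat"
    by (rule trans[OF cancel[OF carriers(1), symmetric] trans[OF _ cancel[OF UGU]]]) (simp only: e)
  have De: "Dmat $$ (i,j) = cnj (u i) * G $$ (i,j) * u j" if "i < N" "j < N" for i j
  proof -
    have "(mat_adjoint Umat * G * Umat) $$ (i,j) = cnj (u i) * G $$ (i,j) * u j"
      unfolding Umat_def mat_adjoint_diag using that G by (simp add: mat_diag_mult_left[OF G] mat_diag_mult_right[of _ N N])
    then show ?thesis using DU by simp
  qed
  have uu: "u i * cnj (u i) = 1" if "i < N" for i using u[OF that] by (metis complex_norm_square of_real_1 one_power2)
  have "G $$ (i,j) = Dmat $$ (i,j)" if ij: "i < N" "j < N" for i j
  proof -
    have "u i * Dmat $$ (i,j) * cnj (u j) = (u i * cnj (u i)) * G $$ (i,j) * (u j * cnj (u j))"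
      unfolding De[OF ij] by (simp add: mult_ac)
    then have "G $$ (i,j) = u i * Dmat $$ (i,j) * cnj (u j)" using uu ij by simp
    also have "\<dots> = Dmat $$ (i,j)" using uu[OF ij(1)] ij by (auto simp: Dmat_def mat_diag_def mult_ac)
    finally show ?thesis .
  qed
  then have "G = Dmat" using G carriers(1) by (intro eq_matI) auto
  then show ?thesis by (simp add: G_def A_def)
qed

lemma (in balanced_solution) quad_D: "v \<in> carrier_vec N \<Longrightarrow> quad_form Dmat v = quad_form Amat (mat_adjoint B *\<^sub>v v)"
  using quad_form_congruence[OF A_carrier carriers(3), of v] by (simp add: B_A_B)

lemma diag_mult_unit_vec: "j < n \<Longrightarrow> mat_diag n f *\<^sub>v unit_vec n j = f j \<cdot>\<^sub>v (unit_vec n j :: complex vec)"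
  by (intro eq_vecI) (auto simp: mat_diag_def)

text \<open>From \<open>B A B\<^sup>* = D\<close> and \<open>M = B\<^sup>* U B\<close> the vector \<open>y = B\<^sup>* e\<^sub>j\<close> satisfies \<open>M A y = u\<^sub>j (Im u\<^sub>j) y\<close>, so that \<open>Im u\<^sub>j\<close>
  is the modulus of an eigenvalue of \<open>M A\<close> and inherits the bounds on both factors.\<close>
lemma (in balanced_solution) d_bounds:
  assumes j: "j < N"
  shows "a_low / inv_bound \<le> Im (u j)" "Im (u j) \<le> a_up * \<mu>" "Im (u j) \<le> 1"
proof -
  note asc = assoc_mult_mat_vec[of _ N N _ N]
  define y where "y = mat_adjoint B *\<^sub>v unit_vec N j"
  define x where "x = Amat *\<^sub>v y"
  have y: "y \<in> carrier_vec N" using carriers by (simp add: y_def)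
  have x: "x \<in> carrier_vec N" using A_carrier y by (simp add: x_def)
  have y0: "0 < vnorm y"
  proof (rule vnorm_pos[OF y], rule notI)
    assume "y = 0\<^sub>v N"
    then have "mat_adjoint Bi *\<^sub>v y = 0\<^sub>v N" using carriers by simp
    moreover have "mat_adjoint Bi *\<^sub>v y = (mat_adjoint Bi * mat_adjoint B) *\<^sub>v unit_vec N j"
      unfolding y_def using carriers by (simp add: asc)
    ultimately show False unfolding adj_Bi_adj_B using j by (simp add: unit_vec_nonzero)
  qed
  have "B *\<^sub>v x = (B * Amat * mat_adjoint B) *\<^sub>v unit_vec N j"
    unfolding x_def y_def using B A_carrier carriers by (simp add: assoc_mult_mat_vec[of _ N N _ N])
  also have "\<dots> = complex_of_real (Im (u j)) \<cdot>\<^sub>v unit_vec N j"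
    unfolding B_A_B Dmat_def by (rule diag_mult_unit_vec[OF j])
  finally have Bx: "B *\<^sub>v x = complex_of_real (Im (u j)) \<cdot>\<^sub>v unit_vec N j" .
  have "M *\<^sub>v x = mat_adjoint B *\<^sub>v (Umat *\<^sub>v (B *\<^sub>v x))"
    unfolding M_decomp Umat_def[symmetric] using B carriers x by (simp add: assoc_mult_mat_vec[of _ N N _ N])
  also have "Umat *\<^sub>v (B *\<^sub>v x) = (u j * complex_of_real (Im (u j))) \<cdot>\<^sub>v unit_vec N j"
    unfolding Bx mult_mat_vec[OF carriers(2) unit_vec_carrier] 
    by (simp add: Umat_def diag_mult_unit_vec[OF j] smult_smult_assoc mult.commute)
  also have "mat_adjoint B *\<^sub>v \<dots> = (u j * complex_of_real (Im (u j))) \<cdot>\<^sub>v y"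
    unfolding y_def using carriers by (simp add: mult_mat_vec[of _ N N])
  finally have "vnorm (M *\<^sub>v x) = cmod (u j) * \<bar>Im (u j)\<bar> * vnorm y" by (simp add: norm_mult)
  then have Mx: "vnorm (M *\<^sub>v x) = Im (u j) * vnorm y" using u[OF j] by simp
  have xu: "vnorm x \<le> a_up * vnorm y" unfolding x_def
  proof (rule herm_numerical_bound[OF A_herm _ y])
    fix v :: "complex vec" assume v: "v \<in> carrier_vec N"
    have "0 \<le> a_low * (vnorm v)\<^sup>2" using a_pos by simp
    then show "\<bar>quad_form Amat v\<bar> \<le> a_up * (vnorm v)\<^sup>2" using A_bounds[OF v] by simp
  qed
  have "a_low * (vnorm y)\<^sup>2 \<le> \<bar>quad_form Amat y\<bar>" using A_bounds(1)[OF y] by simp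
  also have "\<dots> \<le> vnorm x * vnorm y" unfolding x_def by (rule quad_form_le[OF A_carrier y])
  finally have xl: "a_low * vnorm y \<le> vnorm x" using y0 by (simp add: power2_eq_square)
  have "a_low * vnorm y \<le> inv_bound * (Im (u j) * vnorm y)" using xl M_lower_bound[OF x] Mx by simp
  then have "a_low \<le> inv_bound * Im (u j)" using y0 by (simp add: mult.assoc[symmetric])
  then show "a_low / inv_bound \<le> Im (u j)" using inv_bound_pos by (simp add: field_simps)
  have mu0: "0 \<le> \<mu>"
  proof -
    have "0 \<le> \<mu> * vnorm y" using mu[OF y] vnorm_nonneg order_trans by blast
    then show ?thesis using y0 by (simp add: zero_le_mult_iff)
  qed
  have "Im (u j) * vnorm y \<le> \<mu> * vnorm x" using mu[OF x] Mx by simp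
  also have "\<dots> \<le> \<mu> * (a_up * vnorm y)" using xu mu0 by (rule mult_left_mono)
  finally show "Im (u j) \<le> a_up * \<mu>" using y0 by (simp add: mult.assoc[symmetric] mult.commute)
  show "Im (u j) \<le> 1" using u[OF j] abs_Im_le_cmod[of "u j"] by simp
qed

text \<open>These are the spectral bounds for \<open>B B\<^sup>*\<close>. They come from comparing \<open>D = B A B\<^sup>*\<close> with the bounds on \<open>D\<close> and
  on \<open>A\<close>, whose quotient \<open>a_up / a_low\<close> is at most \<open>C / c\<close>.\<close>
definition (in balanced_solution) "b_up = C / c * \<mu>"
definition (in balanced_solution) "b_low = c / (C * inv_bound)"

lemma (in balanced_solution) mu_pos: "0 < \<mu>"
proof -
  have "0 < Im (u 0)" "Im (u 0) \<le> a_up * \<mu>" using u[of 0] d_bounds(2)[of 0] N_pos by auto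
  then have "0 < a_up * \<mu>" by linarith
  then show ?thesis using a_pos by (simp add: zero_less_mult_iff)
qed

lemma (in balanced_solution) b_pos: "0 < b_up" "0 < b_low"
  unfolding b_up_def b_low_def using c C_pos mu_pos inv_bound_pos by simp_all

lemma (in balanced_solution) adjoint_B_bounds:
  assumes v: "v \<in> carrier_vec N"
  shows "(vnorm (mat_adjoint B *\<^sub>v v))\<^sup>2 \<le> b_up * (vnorm v)\<^sup>2" "b_low * (vnorm v)\<^sup>2 \<le> (vnorm (mat_adjoint B *\<^sub>v v))\<^sup>2"
proof -
  define w where "w = mat_adjoint B *\<^sub>v v"
  have w: "w \<in> carrier_vec N" using carriers v by (simp add: w_def)
  have q: "quad_form Dmat v = (\<Sum>i<N. Im (u i) * (cmod (v $ i))\<^sup>2)" unfolding Dmat_def quad_form_diag[OF v] by simp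
  have vs: "(vnorm v)\<^sup>2 = (\<Sum>i<N. (cmod (v $ i))\<^sup>2)" using v by (simp add: vnorm_sq)
  have "a_low * (vnorm w)\<^sup>2 \<le> quad_form Dmat v" unfolding quad_D[OF v] w_def[symmetric] by (rule A_bounds(1)[OF w])
  also have "\<dots> \<le> (a_up * \<mu>) * (vnorm v)\<^sup>2"
    unfolding q vs sum_distrib_left using d_bounds(2) by (intro sum_mono mult_right_mono) auto
  also have "\<dots> \<le> (C / c * a_low * \<mu>) * (vnorm v)\<^sup>2" using a_ratio mu_pos by (intro mult_right_mono) auto
  finally have "a_low * (vnorm w)\<^sup>2 \<le> a_low * (b_up * (vnorm v)\<^sup>2)" by (simp add: b_up_def mult_ac)
  then show "(vnorm (mat_adjoint B *\<^sub>v v))\<^sup>2 \<le> b_up * (vnorm v)\<^sup>2" using a_pos by (simp add: w_def)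
  have "(a_low / inv_bound) * (vnorm v)\<^sup>2 \<le> quad_form Dmat v"
    unfolding q vs sum_distrib_left using d_bounds(1) by (intro sum_mono mult_right_mono) auto
  also have "\<dots> \<le> a_up * (vnorm w)\<^sup>2" unfolding quad_D[OF v] w_def[symmetric] by (rule A_bounds(2)[OF w])
  also have "\<dots> \<le> (C / c * a_low) * (vnorm w)\<^sup>2" using a_ratio by (intro mult_right_mono) auto
  finally have "a_low * ((vnorm v)\<^sup>2 / inv_bound) \<le> a_low * (C / c * (vnorm w)\<^sup>2)" by (simp add: mult_ac)
  then have "(vnorm v)\<^sup>2 / inv_bound \<le> C / c * (vnorm w)\<^sup>2" by (rule mult_left_le_imp_le[OF _ a_pos(1)])
  then show "b_low * (vnorm v)\<^sup>2 \<le> (vnorm (mat_adjoint B *\<^sub>v v))\<^sup>2"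
    unfolding b_low_def w_def using c C_pos inv_bound_pos by (simp add: field_simps)
qed

lemma (in balanced_solution) sandwich_bounds:
  assumes X: "X \<in> carrier_mat N N"
  shows "frob N (mat_adjoint B * X * B) \<le> b_up * frob N X" "b_low * frob N X \<le> frob N (mat_adjoint B * X * B)"
proof -
  have sb: "(sqrt b_up)\<^sup>2 = b_up" "(sqrt b_low)\<^sup>2 = b_low" using b_pos by auto
  have "frob N (mat_adjoint B * X * B) \<le> (sqrt b_up)\<^sup>2 * frob N X"
  proof (rule frob_sandwich_le[OF B X])
    fix v :: "complex vec" assume v: "v \<in> carrier_vec N"
    have "(vnorm (mat_adjoint B *\<^sub>v v))\<^sup>2 \<le> (sqrt b_up * vnorm v)\<^sup>2" using adjoint_B_bounds(1)[OF v] by (simp add: power_mult_distrib sb)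
    then show "vnorm (mat_adjoint B *\<^sub>v v) \<le> sqrt b_up * vnorm v" by (rule power2_le_imp_le) (use b_pos in simp)
  qed (use b_pos in simp)
  then show "frob N (mat_adjoint B * X * B) \<le> b_up * frob N X" by (simp only: sb)
  have "(sqrt b_low)\<^sup>2 * frob N X \<le> frob N (mat_adjoint B * X * B)"
  proof (rule frob_sandwich_ge[OF B X])
    fix v :: "complex vec" assume v: "v \<in> carrier_vec N"
    have "(sqrt b_low * vnorm v)\<^sup>2 \<le> (vnorm (mat_adjoint B *\<^sub>v v))\<^sup>2" using adjoint_B_bounds(2)[OF v] by (simp add: power_mult_distrib sb)
    then show "sqrt b_low * vnorm v \<le> vnorm (mat_adjoint B *\<^sub>v v)" by (rule power2_le_imp_le) simp
  qed (use b_pos in simp)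
  then show "b_low * frob N X \<le> frob N (mat_adjoint B * X * B)" by (simp only: sb)
qed

text \<open>The map \<open>F\<close> is what remains of \<open>R \<mapsto> M S[R] M\<close> in the variable \<open>X\<close> with \<open>R = B\<^sup>* X B\<close> when the unitary \<open>U\<close> is
  stripped off from both sides; unlike the former it is symmetric and positivity preserving.\<close>
definition (in balanced_solution) "F X = B * S (mat_adjoint B * X * B) * mat_adjoint B"

lemma (in balanced_solution) BXB_carrier: "X \<in> carrier_mat N N \<Longrightarrow> mat_adjoint B * X * B \<in> carrier_mat N N"
  using B by simp

lemma (in balanced_solution) BXB'_carrier: "X \<in> carrier_mat N N \<Longrightarrow> B * X * mat_adjoint B \<in> carrier_mat N N"
  using B by simp

lemma (in balanced_solution) F_linear: "linear_op N F"
  unfolding linear_op_def F_def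
proof (intro conjI ballI allI)
  fix R :: "complex mat" assume R: "R \<in> carrier_mat N N"
  note SR = S_carrier[OF BXB_carrier[OF R]]
  show "B * S (mat_adjoint B * R * B) * mat_adjoint B \<in> carrier_mat N N" using BXB'_carrier[OF SR] .
  show "B * S (mat_adjoint B * (a \<cdot>\<^sub>m R) * B) * mat_adjoint B = a \<cdot>\<^sub>m (B * S (mat_adjoint B * R * B) * mat_adjoint B)" for a
  proof -
    have "mat_adjoint B * (a \<cdot>\<^sub>m R) * B = a \<cdot>\<^sub>m (mat_adjoint B * R * B)"
      using B R by (simp add: mult_smult_distrib[of _ N N _ N] mult_smult_assoc_mat[of _ N N _ N])
    then show ?thesis using linear_opD(3)[OF lin BXB_carrier[OF R]] SR B
      by (simp add: mult_smult_distrib[of _ N N _ N] mult_smult_assoc_mat[of _ N N _ N])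
  qed
  fix Q :: "complex mat" assume Q: "Q \<in> carrier_mat N N"
  note SQ = S_carrier[OF BXB_carrier[OF Q]]
  have "mat_adjoint B * (R + Q) * B = mat_adjoint B * R * B + mat_adjoint B * Q * B"
    using B R Q by (simp add: mult_add_distrib_mat[of _ N N _ N] add_mult_distrib_mat[of _ N N _ _ N])
  then show "B * S (mat_adjoint B * (R + Q) * B) * mat_adjoint B =
     B * S (mat_adjoint B * R * B) * mat_adjoint B + B * S (mat_adjoint B * Q * B) * mat_adjoint B"
    using linear_opD(2)[OF lin BXB_carrier[OF R] BXB_carrier[OF Q]] SR SQ B
    by (simp add: mult_add_distrib_mat[of _ N N _ N] add_mult_distrib_mat[of _ N N _ _ N])
qed

lemma (in balanced_solution) hs_ip_B_move:
  assumes R: "R \<in> carrier_mat N N" and Y: "Y \<in> carrier_mat N N"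
  shows "hs_ip R (B * Y * mat_adjoint B) = hs_ip (mat_adjoint B * R * B) Y"
proof -
  have "hs_ip R (B * Y * mat_adjoint B) = hs_ip (R * B) (B * Y)"
    using hs_ip_mult_right[of R N "B * Y" "mat_adjoint B"] B R Y by simp
  also have "\<dots> = hs_ip (mat_adjoint B * (R * B)) Y" using B R Y by (intro hs_ip_mult_left) auto
  finally show ?thesis using B R by (simp add: assoc_mult_mat[of _ N N _ N _ N])
qed

lemma (in balanced_solution) F_symmetric: "hs_symmetric N F"
  unfolding hs_symmetric_def hs_ip_def[symmetric]
proof (intro ballI)
  fix R Q :: "complex mat" assume R: "R \<in> carrier_mat N N" and Q: "Q \<in> carrier_mat N N"
  note SR = S_carrier[OF BXB_carrier[OF R]] and SQ = S_carrier[OF BXB_carrier[OF Q]]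
  have "hs_ip R (F Q) = hs_ip (mat_adjoint B * R * B) (S (mat_adjoint B * Q * B))"
    unfolding F_def by (rule hs_ip_B_move[OF R SQ])
  also have "\<dots> = hs_ip (S (mat_adjoint B * R * B)) (mat_adjoint B * Q * B)"
    using sym BXB_carrier[OF R] BXB_carrier[OF Q] by (simp add: hs_symmetric_def hs_ip_def)
  also have "\<dots> = cnj (hs_ip (mat_adjoint B * Q * B) (S (mat_adjoint B * R * B)))"
    by (rule hs_ip_commute[OF SR BXB_carrier[OF Q]])
  also have "\<dots> = cnj (hs_ip Q (F R))" unfolding F_def using hs_ip_B_move[OF Q SR] by simp
  also have "\<dots> = hs_ip (F R) Q" using hs_ip_commute[OF linear_opD(1)[OF F_linear R] Q] by simp
  finally show "hs_ip R (F Q) = hs_ip (F R) Q" .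
qed

lemma (in balanced_solution) F_positive: "positivity_preserving N F"
proof (rule positivity_preservingI)
  fix X assume "psd N X"
  from psd_congruence[OF positivity_preservingD[OF pos psd_congruence[OF this B]] carriers(3)]
  show "psd N (F X)" by (simp add: F_def)
qed

text \<open>The terms \<open>D = B A B\<^sup>*\<close> and \<open>F[D] = B S[Im M] B\<^sup>*\<close> differ by the part \<open>Im z\<close> of \<open>A\<close>.\<close>
lemma (in balanced_solution) F_D: "F Dmat = Dmat - complex_of_real (Im z) \<cdot>\<^sub>m (B * mat_adjoint B)"
proof -
  have Sm: "S (im_mat M) \<in> carrier_mat N N" by (rule S_carrier[OF im_M_carrier])
  have BB: "B * mat_adjoint B \<in> carrier_mat N N" "F Dmat \<in> carrier_mat N N" using B linear_opD(1)[OF F_linear carriers(1)] by auto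
  have "Dmat = B * (complex_of_real (Im z) \<cdot>\<^sub>m 1\<^sub>m N + S (im_mat M)) * mat_adjoint B"
    using B_A_B by (simp add: Amat_def)
  also have "\<dots> = complex_of_real (Im z) \<cdot>\<^sub>m (B * mat_adjoint B) + B * S (im_mat M) * mat_adjoint B"
    using B Sm by (simp add: mult_add_distrib_mat[of _ N N _ N] add_mult_distrib_mat[of _ N N _ _ N] mult_smult_distrib[of _ N N _ N] mult_smult_assoc_mat[of _ N N _ N])
  also have "B * S (im_mat M) * mat_adjoint B = F Dmat" by (simp add: F_def im_M_decomp)
  finally have "Dmat = complex_of_real (Im z) \<cdot>\<^sub>m (B * mat_adjoint B) + F Dmat" .
  then have e: "Dmat $$ (i,j) = complex_of_real (Im z) * (B * mat_adjoint B) $$ (i,j) + F Dmat $$ (i,j)" if "i < N" "j < N" for i j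
    using that BB by (metis index_add_mat(1) index_smult_mat(1) carrier_matD)
  show ?thesis
    using BB carriers(1) e by (intro eq_matI) (auto simp del: index_mult_mat(1))
qed

lemma (in balanced_solution) quad_BB: "v \<in> carrier_vec N \<Longrightarrow> quad_form (B * mat_adjoint B) v = (vnorm (mat_adjoint B *\<^sub>v v))\<^sup>2"
proof -
  assume v: "v \<in> carrier_vec N"
  have "B * mat_adjoint B = mat_adjoint (mat_adjoint B) * 1\<^sub>m N * mat_adjoint B" using B by simp
  then show ?thesis using quad_form_congruence[OF one_carrier_mat carriers(3) v] carriers(3) v by simp
qed

lemma (in balanced_solution) BB_psd: "psd N (B * mat_adjoint B)"
  using psd_gram[OF carriers(3)] by simp

lemma (in balanced_solution) BB_bounds: "psd N (complex_of_real b_up \<cdot>\<^sub>m 1\<^sub>m N - B * mat_adjoint B)"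
   "psd N (B * mat_adjoint B - complex_of_real b_low \<cdot>\<^sub>m 1\<^sub>m N)"
proof -
  have h: "herm_mat N (B * mat_adjoint B)" using BB_psd by (simp add: psd_iff)
  have s: "herm_mat N (complex_of_real b_up \<cdot>\<^sub>m 1\<^sub>m N)" "herm_mat N (complex_of_real b_low \<cdot>\<^sub>m 1\<^sub>m N)" by (auto intro: herm_mat_smult)
  show "psd N (complex_of_real b_up \<cdot>\<^sub>m 1\<^sub>m N - B * mat_adjoint B)"
    by (rule psd_minus_iff[OF h s(1), THEN iffD2]) (use h s adjoint_B_bounds(1) in \<open>simp add: loewner_le_def quad_BB quad_form_scalar\<close>)
  show "psd N (B * mat_adjoint B - complex_of_real b_low \<cdot>\<^sub>m 1\<^sub>m N)"
    by (rule psd_minus_iff[OF s(2) h, THEN iffD2]) (use h s adjoint_B_bounds(2) in \<open>simp add: loewner_le_def quad_BB quad_form_scalar\<close>)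
qed

definition (in balanced_solution) "d_low = a_low / inv_bound"

lemma (in balanced_solution) d_low_pos: "0 < d_low" using a_pos inv_bound_pos by (simp add: d_low_def)

lemma (in balanced_solution) D_lower: "v \<in> carrier_vec N \<Longrightarrow> d_low * (vnorm v)\<^sup>2 \<le> quad_form Dmat v"
proof -
  assume v: "v \<in> carrier_vec N"
  have "d_low * (\<Sum>i<N. (cmod (v $ i))\<^sup>2) \<le> (\<Sum>i<N. Im (u i) * (cmod (v $ i))\<^sup>2)"
    unfolding sum_distrib_left d_low_def using d_bounds(1) by (intro sum_mono mult_right_mono) auto
  then show ?thesis unfolding Dmat_def quad_form_diag[OF v] using v by (simp add: vnorm_sq)
qed

text \<open>Since \<open>D = B A B\<^sup>* \<le> a_up B B\<^sup>*\<close>, the identity for \<open>F D\<close> gives \<open>F D \<le> (1 - Im z / a_up) D\<close>.\<close>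
lemma (in balanced_solution) F_contraction:
  assumes X: "X \<in> carrier_mat N N"
  shows "frob N (F X) \<le> (1 - Im z / a_up) * frob N X"
proof (rule positive_map_norm_le[OF F_linear F_symmetric F_positive D_herm d_low_pos D_lower _ _ X])
  have e: "0 < Im z / a_up" "Im z / a_up \<le> 1" using z a_pos c avg_im_pos C_pos by (auto simp: a_up_def)
  then show "0 \<le> 1 - Im z / a_up" by simp
  define K where "K = complex_of_real (1 - Im z / a_up) \<cdot>\<^sub>m Dmat - F Dmat"
  have BB: "B * mat_adjoint B \<in> carrier_mat N N" using B by simp
  have h: "herm_mat N K" unfolding K_def
    by (intro herm_mat_minus herm_mat_smult D_herm positive_linear_herm[OF F_linear F_positive D_herm])
  moreover have "0 \<le> quad_form K v" if v: "v \<in> carrier_vec N" for v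
  proof -
    have w: "mat_adjoint B *\<^sub>v v \<in> carrier_vec N" using carriers v by simp
    have "quad_form K v = Im z * (vnorm (mat_adjoint B *\<^sub>v v))\<^sup>2 - Im z / a_up * quad_form Dmat v"
      unfolding K_def F_D using carriers BB v
      by (simp add: quad_form_minus[of _ N] quad_form_smult[of _ N] quad_BB minus_carrier_mat algebra_simps del: of_real_diff of_real_divide)
    moreover have "Im z / a_up * quad_form Dmat v \<le> Im z / a_up * (a_up * (vnorm (mat_adjoint B *\<^sub>v v))\<^sup>2)"
      unfolding quad_D[OF v] using A_bounds(2)[OF w] e by (intro mult_left_mono) auto
    ultimately show ?thesis using a_pos by simp
  qed
  ultimately show "psd N K" by (simp add: psd_iff)
qed

text \<open>Flatness of the self-energy survives the change of frame with the constant \<open>c b_low\<^sup>2\<close>. The defect \<open>E = Im z B B\<^sup>*\<close>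
  of the eigenvector equation costs \<open>Im z b_up / d_low\<close>, which is harmless for small \<open>Im z\<close> only.\<close>
lemma (in balanced_solution) F_gap:
  assumes X: "X \<in> carrier_mat N N"
  shows "(c * b_low\<^sup>2 * d_low ^ 4 / 8 - Im z * b_up / d_low) * frob N X \<le> frob N (X - Umat * F X * Umat)"
proof -
  have BB: "B * mat_adjoint B \<in> carrier_mat N N" using B by simp
  define E where "E = complex_of_real (Im z) \<cdot>\<^sub>m (B * mat_adjoint B)"
  have E: "psd N E" unfolding E_def using BB_psd z by (intro psd_smult) auto
  have Ec: "E \<in> carrier_mat N N" using psd_carrier[OF E] .
  define tr where "tr = Re (mat_trace (B * mat_adjoint B))"
  have BB1: "hs_ip (B * mat_adjoint B) (1\<^sub>m N) = mat_trace (B * mat_adjoint B)"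
  proof -
    have "mat_adjoint (B * mat_adjoint B) = B * mat_adjoint B" using BB_psd by (simp add: psd_iff herm_mat_def)
    then show ?thesis by (simp add: hs_ip_def right_mult_one_mat[OF BB])
  qed
  have lowtr: "b_low * Re (mat_trace X) \<le> Re (mat_trace (mat_adjoint B * X * B))" if X: "psd N X" for X
  proof -
    have Xc: "X \<in> carrier_mat N N" using X psd_carrier by auto
    have "0 \<le> Re (hs_ip (B * mat_adjoint B - complex_of_real b_low \<cdot>\<^sub>m 1\<^sub>m N) X)" using hs_ip_psd_nonneg(1)[OF BB_bounds(2) X] .
    also have "hs_ip (B * mat_adjoint B - complex_of_real b_low \<cdot>\<^sub>m 1\<^sub>m N) X = hs_ip (B * mat_adjoint B) X - complex_of_real b_low * hs_ip (1\<^sub>m N) X"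
      using BB Xc hs_ip_smult_left[OF one_carrier_mat Xc] by (simp add: hs_ip_minus_left[of _ N])
    also have "hs_ip (1\<^sub>m N) X = mat_trace X" using Xc by (simp add: hs_ip_def)
    also have "hs_ip (B * mat_adjoint B) X = mat_trace (mat_adjoint B * X * B)"
    proof -
      have "hs_ip (B * mat_adjoint B) X = mat_trace (B * (mat_adjoint B * X))"
        unfolding hs_ip_def using B Xc mat_adjoint_mult[OF B carriers(3)] by (simp add: assoc_mult_mat[of _ N N _ N _ N])
      also have "\<dots> = mat_trace (mat_adjoint B * X * B)" using B Xc by (intro mat_trace_commute[of _ N N]) auto
      finally show ?thesis .
    qed
    finally show ?thesis by simp
  qed
  have trpos: "0 < tr"
  proof -
    have "0 \<le> Re (mat_trace (B * mat_adjoint B - complex_of_real b_low \<cdot>\<^sub>m 1\<^sub>m N))" by (rule psd_trace_nonneg[OF BB_bounds(2)])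
    also have "mat_trace (B * mat_adjoint B - complex_of_real b_low \<cdot>\<^sub>m 1\<^sub>m N) = mat_trace (B * mat_adjoint B) - complex_of_real b_low * of_nat N"
      using BB by (simp add: mat_trace_minus[of _ N] mat_trace_smult[of _ N])
    finally have "b_low * N \<le> tr" by (simp add: tr_def)
    moreover have "0 < b_low * N" using b_pos N_pos by simp
    ultimately show ?thesis by linarith
  qed
  have ED: "Im z * (d_low * tr) \<le> Re (hs_ip E Dmat)"
  proof -
    have "psd N (Dmat - complex_of_real d_low \<cdot>\<^sub>m 1\<^sub>m N)"
      by (rule psd_minus_iff[OF herm_mat_smult[OF herm_mat_one] D_herm, THEN iffD2])
        (use D_lower D_herm herm_mat_smult[OF herm_mat_one] in \<open>simp add: loewner_le_def quad_form_scalar\<close>)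
    then have "0 \<le> Re (hs_ip (B * mat_adjoint B) (Dmat - complex_of_real d_low \<cdot>\<^sub>m 1\<^sub>m N))" using hs_ip_psd_nonneg(1)[OF BB_psd] by blast
    also have "hs_ip (B * mat_adjoint B) (Dmat - complex_of_real d_low \<cdot>\<^sub>m 1\<^sub>m N) = hs_ip (B * mat_adjoint B) Dmat - complex_of_real d_low * mat_trace (B * mat_adjoint B)"
      using BB carriers(1) hs_ip_smult_right[OF BB one_carrier_mat]
      by (simp add: hs_ip_minus_right[of _ N] BB1)
    finally have "d_low * tr \<le> Re (hs_ip (B * mat_adjoint B) Dmat)" by (simp add: tr_def)
    moreover have "Re (hs_ip E Dmat) = Im z * Re (hs_ip (B * mat_adjoint B) Dmat)"
      unfolding E_def hs_ip_smult_left[OF BB carriers(1)] by simp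
    ultimately show ?thesis using z by simp
  qed
  have EE: "(frob N E)\<^sup>2 \<le> Im z * (Im z * (b_up * tr))"
  proof -
    have "0 \<le> Re (hs_ip (B * mat_adjoint B) (complex_of_real b_up \<cdot>\<^sub>m 1\<^sub>m N - B * mat_adjoint B))" using hs_ip_psd_nonneg(1)[OF BB_psd BB_bounds(1)] .
    also have "hs_ip (B * mat_adjoint B) (complex_of_real b_up \<cdot>\<^sub>m 1\<^sub>m N - B * mat_adjoint B) = complex_of_real b_up * mat_trace (B * mat_adjoint B) - complex_of_real ((frob N (B * mat_adjoint B))\<^sup>2)"
      unfolding hs_ip_self[OF BB, symmetric]
      using BB hs_ip_smult_right[OF BB one_carrier_mat]
      by (simp add: hs_ip_minus_right[of _ N] BB1)
    finally have "(frob N (B * mat_adjoint B))\<^sup>2 \<le> b_up * tr" by (simp add: tr_def)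
    then have "(Im z)\<^sup>2 * (frob N (B * mat_adjoint B))\<^sup>2 \<le> (Im z)\<^sup>2 * (b_up * tr)" by (intro mult_left_mono) auto
    then show ?thesis unfolding E_def frob_smult[OF BB] norm_of_real abs_of_pos[OF z] by (simp add: power2_eq_square mult_ac)
  qed
  have "(c * b_low\<^sup>2 / N * N * d_low ^ 4 / 8 - Im z * b_up / d_low) * frob N X \<le> frob N (X - mat_diag N u * F X * mat_diag N u)"
  proof (rule rotated_subsolution_gap[OF N_pos(1) F_linear F_symmetric F_positive _ d_low_pos Dmat_def _ E _ _ _ _ _ X])
    show "d_low \<le> Im (u i) \<and> Im (u i) \<le> 1" if "i < N" for i using d_bounds[OF that] by (simp add: d_low_def)
    show "F Dmat = Dmat - E" unfolding E_def by (rule F_D)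
    have p: "0 < Im z * (d_low * tr)" using z d_low_pos trpos by simp
    then show "0 < Re (hs_ip E Dmat)" using ED by linarith
    have "Im z * (Im z * (b_up * tr)) = Im z * b_up / d_low * (Im z * (d_low * tr))" using d_low_pos by simp
    also have "\<dots> \<le> Im z * b_up / d_low * Re (hs_ip E Dmat)" using ED z b_pos d_low_pos by (intro mult_left_mono) auto
    finally show "(frob N E)\<^sup>2 \<le> Im z * b_up / d_low * Re (hs_ip E Dmat)" using EE by linarith
    show "0 \<le> c * b_low\<^sup>2 / N" using c by simp
    fix X :: "complex mat" and v :: "complex vec" assume X: "psd N X" and v: "v \<in> carrier_vec N"
    have w: "mat_adjoint B *\<^sub>v v \<in> carrier_vec N" using carriers v by simp
    have t: "0 \<le> Re (mat_trace X)" by (rule psd_trace_nonneg[OF X])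
    have "c * b_low\<^sup>2 / N * Re (mat_trace X) * (vnorm v)\<^sup>2 = c * ((b_low * Re (mat_trace X)) / N) * (b_low * (vnorm v)\<^sup>2)"
      by (simp add: power2_eq_square)
    also have "\<dots> \<le> c * (Re (mat_trace (mat_adjoint B * X * B)) / N) * (vnorm (mat_adjoint B *\<^sub>v v))\<^sup>2"
      using lowtr[OF X] adjoint_B_bounds(2)[OF v] t c b_pos psd_trace_nonneg[OF psd_congruence[OF X B]]
      by (intro mult_mono mult_left_mono divide_right_mono) auto
    also have "\<dots> \<le> quad_form (S (mat_adjoint B * X * B)) (mat_adjoint B *\<^sub>v v)"
      by (rule flat_quad_form(1)[OF psd_congruence[OF X B] w])
    also have "\<dots> = quad_form (F X) v"
      unfolding F_def using quad_form_congruence[OF S_carrier[OF BXB_carrier[OF psd_carrier[OF X]]] carriers(3) v] by simp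
    finally show "c * b_low\<^sup>2 / N * Re (mat_trace X) * (vnorm v)\<^sup>2 \<le> quad_form (F X) v" .
  qed (use u in auto)
  then show ?thesis unfolding Umat_def using N_pos by simp
qed

lemma (in balanced_solution) stability_balanced:
  assumes X: "X \<in> carrier_mat N N"
  shows "stability_op S M (mat_adjoint B * X * B) = mat_adjoint B * (X - Umat * F X * Umat) * B"
proof -
  note asc = assoc_mult_mat[of _ N N _ N _ N]
  note SX = S_carrier[OF BXB_carrier[OF X]]
  define T where "T = S (mat_adjoint B * X * B)"
  have T: "T \<in> carrier_mat N N" using SX by (simp add: T_def)
  have "M * T * M = mat_adjoint B * (Umat * (B * T * mat_adjoint B) * Umat) * B"
    unfolding M_decomp Umat_def[symmetric] using B T carriers by (simp add: asc)
  then have "M * S (mat_adjoint B * X * B) * M = mat_adjoint B * (Umat * F X * Umat) * B"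
    by (simp only: T_def F_def)
  moreover have "mat_adjoint B * (X - Umat * F X * Umat) * B = mat_adjoint B * X * B - mat_adjoint B * (Umat * F X * Umat) * B"
    using B X carriers linear_opD(1)[OF F_linear X]
    by (simp add: mult_minus_distrib_mat[of _ N N _ N] minus_mult_distrib_mat[of _ N N _ _ N])
  ultimately show ?thesis by (simp add: stability_op_def)
qed

lemma (in balanced_solution) B_surj:
  assumes R: "R \<in> carrier_mat N N"
  obtains X where "X \<in> carrier_mat N N" "R = mat_adjoint B * X * B"
proof
  show "mat_adjoint Bi * R * Bi \<in> carrier_mat N N" using R Bi by simp
  have "mat_adjoint B * (mat_adjoint Bi * R * Bi) * B = (mat_adjoint B * mat_adjoint Bi) * R * (Bi * B)"
    using R B Bi by (simp add: assoc_mult_mat[of _ N N _ N _ N])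
  then show "R = mat_adjoint B * (mat_adjoint Bi * R * Bi) * B" unfolding adj_Bi_adj_B BiB using R by simp
qed

lemma (in balanced_solution) stability_transfer:
  assumes s: "\<And>X. X \<in> carrier_mat N N \<Longrightarrow> s * frob N X \<le> frob N (X - Umat * F X * Umat)" and s0: "0 \<le> s"
    and R: "R \<in> carrier_mat N N"
  shows "b_low / b_up * s * frob N R \<le> frob N (stability_op S M R)"
proof -
  obtain X where X: "X \<in> carrier_mat N N" "R = mat_adjoint B * X * B" using B_surj[OF R] .
  have Y: "X - Umat * F X * Umat \<in> carrier_mat N N"
    using X carriers linear_opD(1)[OF F_linear X(1)] by (simp add: minus_carrier_mat)
  have "b_low / b_up * s * frob N R \<le> b_low / b_up * s * (b_up * frob N X)"
    using sandwich_bounds(1)[OF X(1)] b_pos s0 unfolding X(2) by (intro mult_left_mono) auto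
  also have "\<dots> = b_low * (s * frob N X)" using b_pos by simp
  also have "\<dots> \<le> b_low * frob N (X - Umat * F X * Umat)" using s[OF X(1)] b_pos by simp
  also have "\<dots> \<le> frob N (stability_op S M R)" unfolding X(2) stability_balanced[OF X(1)] by (rule sandwich_bounds(2)[OF Y])
  finally show ?thesis .
qed

lemma (in balanced_solution) stability_contraction_lower_bound:
  assumes R: "R \<in> carrier_mat N N"
  shows "b_low / b_up * (Im z / a_up) * frob N R \<le> frob N (stability_op S M R)"
proof (rule stability_transfer[OF _ _ R])
  show "0 \<le> Im z / a_up" using z a_pos by simp
  fix X :: "complex mat" assume X: "X \<in> carrier_mat N N"
  have "(1 - (1 - Im z / a_up)) * frob N X \<le> frob N (X - mat_diag N u * F X * mat_diag N u)"
    by (rule rotated_contraction_lower_bound[where F = F, OF X linear_opD(1)[OF F_linear X] _ F_contraction[OF X]]) (use u in auto)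
  then show "Im z / a_up * frob N X \<le> frob N (X - Umat * F X * Umat)" by (simp add: Umat_def)
qed

text \<open>In the balanced frame the equation reads \<open>X - U F[X] U = Y'\<close> with a strict contraction and is solved by its Neumann series.\<close>
lemma (in balanced_solution) stability_surj:
  assumes Y: "Y \<in> carrier_mat N N"
  shows "\<exists>R\<in>carrier_mat N N. stability_op S M R = Y"
proof -
  obtain Y' where Y': "Y' \<in> carrier_mat N N" "Y = mat_adjoint B * Y' * B" using B_surj[OF Y] .
  define G where "G X = Umat * F X * Umat" for X
  have Fc: "F X \<in> carrier_mat N N" if "X \<in> carrier_mat N N" for X using linear_opD(1)[OF F_linear that] .
  have lin: "linear_op N G"
    unfolding linear_op_def G_def using linear_opD[OF F_linear] carriers(2)
    by (auto simp: mult_add_distrib_mat[of _ N N _ N] add_mult_distrib_mat[of _ N N _ _ N] mult_smult_distrib[of _ N N _ N] mult_smult_assoc_mat[of _ N N _ N])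
  have e: "0 < Im z / a_up" "Im z / a_up \<le> 1" using z a_pos c avg_im_pos C_pos by (auto simp: a_up_def)
  have "frob N (G X) \<le> (1 - Im z / a_up) * frob N X" if X: "X \<in> carrier_mat N N" for X
    unfolding G_def Umat_def using F_contraction[OF X] frob_unitary_sandwich[OF Fc[OF X], of u] u by simp
  then obtain X where X: "X \<in> carrier_mat N N" "X - G X = Y'"
    using neumann_solution[OF lin _ _ _ Y'(1), of "1 - Im z / a_up"] e by auto
  have "stability_op S M (mat_adjoint B * X * B) = Y"
    unfolding stability_balanced[OF X(1)] Y'(2) X(2)[symmetric] by (simp add: G_def)
  then show ?thesis using BXB_carrier[OF X(1)] by blast
qed

section \<open>Analyticity of the solution in the spectral parameter\<close>

lemma frob_mult_le:
  assumes "A \<in> carrier_mat n n" "X \<in> carrier_mat n n"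
  shows "frob n (A * X) \<le> frob n A * frob n X"
  using assms by (intro frob_mult_left_le vnorm_mult_le_frob) auto

lemma frob_le_of_vnorm_bound:
  assumes A: "A \<in> carrier_mat n n" and a: "0 \<le> a" and b: "\<And>v. v \<in> carrier_vec n \<Longrightarrow> vnorm (A *\<^sub>v v) \<le> a * vnorm v"
  shows "frob n A \<le> n * a"
proof -
  have "frob n (A * 1\<^sub>m n) \<le> a * frob n (1\<^sub>m n)" using A a b by (intro frob_mult_left_le) auto
  also have "\<dots> \<le> a * (real n * 1)" by (intro mult_left_mono frob_le_entries a) auto
  finally show ?thesis using A by (simp add: mult.commute)
qed

context flat_self_energy
begin

definition "G z K = z \<cdot>\<^sub>m 1\<^sub>m N + S K"

lemma G_carrier: "K \<in> carrier_mat N N \<Longrightarrow> G z K \<in> carrier_mat N N"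
  using S_carrier by (simp add: G_def)

text \<open>The solutions of the Dyson equation are fixed points of \<open>K \<mapsto> - (z + S[K])\<^sup>-\<^sup>1\<close>. Cramer's rule makes its entries visibly analytic.\<close>
definition "Phi z K = (- 1 / Determinant.det (G z K)) \<cdot>\<^sub>m adj_mat (G z K)"

lemma G_im:
  assumes K: "K \<in> carrier_mat N N" and psd: "psd N (im_mat K)" and v: "v \<in> carrier_vec N"
  shows "Im z * (vnorm v)\<^sup>2 \<le> Im ((G z K *\<^sub>v v) \<bullet>c v)"
proof -
  note SK = S_carrier[OF K]
  have ic: "im_mat K \<in> carrier_mat N N" using psd_carrier[OF psd] .
  have "S (im_mat K) = im_mat (S K)"
  proof -
    have aK: "mat_adjoint K \<in> carrier_mat N N" using K by simp
    have "S (im_mat K) = (1 / (2 * \<i>)) \<cdot>\<^sub>m S (K - mat_adjoint K)"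
      unfolding im_mat_def by (rule linear_opD(3)[OF lin]) (use K aK in \<open>simp add: minus_carrier_mat\<close>)
    also have "S (K - mat_adjoint K) = S K - mat_adjoint (S K)"
      using linear_op_minus[OF lin K aK] positive_linear_adjoint[OF lin pos K] by simp
    finally show ?thesis by (simp add: im_mat_def)
  qed
  then have "psd N (im_mat (S K))" using positivity_preservingD[OF pos psd] by simp
  then have "0 \<le> quad_form (im_mat (S K)) v" using v by (auto simp: psd_iff)
  then have "0 \<le> Im ((S K *\<^sub>v v) \<bullet>c v)" using quad_form_im_mat(1)[OF SK v] by simp
  moreover have "G z K *\<^sub>v v = z \<cdot>\<^sub>v v + S K *\<^sub>v v"
  proof -
    have "G z K *\<^sub>v v = (z \<cdot>\<^sub>m 1\<^sub>m N) *\<^sub>v v + S K *\<^sub>v v" unfolding G_def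
      using SK v by (intro add_mult_distrib_mat_vec) auto
    also have "(z \<cdot>\<^sub>m 1\<^sub>m N) *\<^sub>v v = z \<cdot>\<^sub>v v" using v by (intro eq_vecI) auto
    finally show ?thesis .
  qed
  then have "(G z K *\<^sub>v v) \<bullet>c v = z * complex_of_real ((vnorm v)\<^sup>2) + (S K *\<^sub>v v) \<bullet>c v"
    using SK v by (simp add: add_scalar_prod_distrib[of _ N] cinner_smult_left[of _ N] cinner_self)
  ultimately show ?thesis by simp
qed

lemma inverse_im:
  assumes K: "K \<in> carrier_mat N N" "psd N (im_mat K)" and L: "L \<in> carrier_mat N N" "G z K * L = (-1) \<cdot>\<^sub>m 1\<^sub>m N"
    and v: "v \<in> carrier_vec N"
  shows "Im z * (vnorm (L *\<^sub>v v))\<^sup>2 \<le> Im ((L *\<^sub>v v) \<bullet>c v)" "v \<noteq> 0\<^sub>v N \<Longrightarrow> L *\<^sub>v v \<noteq> 0\<^sub>v N"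
proof -
  define w where "w = L *\<^sub>v v"
  have w: "w \<in> carrier_vec N" using L v by (simp add: w_def)
  have Gw: "G z K *\<^sub>v w = (-1) \<cdot>\<^sub>v v"
  proof -
    have "G z K *\<^sub>v w = (G z K * L) *\<^sub>v v" unfolding w_def using assoc_mult_mat_vec[OF G_carrier[OF K(1)] L(1) v] by simp
    also have "\<dots> = (-1) \<cdot>\<^sub>v v" unfolding L(2) using v by (intro eq_vecI) auto
    finally show ?thesis .
  qed
  have "(G z K *\<^sub>v w) \<bullet>c w = - cnj (w \<bullet>c v)"
    unfolding Gw using v w cinner_commute[OF v w] by (simp add: cinner_smult_left[of _ N])
  then show "Im z * (vnorm (L *\<^sub>v v))\<^sup>2 \<le> Im ((L *\<^sub>v v) \<bullet>c v)"
    using G_im[OF K w, of z] by (simp add: w_def)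
  show "L *\<^sub>v v \<noteq> 0\<^sub>v N" if "v \<noteq> 0\<^sub>v N"
  proof
    assume "L *\<^sub>v v = 0\<^sub>v N"
    then have "(-1) \<cdot>\<^sub>v v = 0\<^sub>v N" using Gw mult_mat_vec_zero[OF G_carrier[OF K(1), of z]] by (simp add: w_def)
    then have "vnorm ((-1) \<cdot>\<^sub>v v) = 0" by simp
    then show False using that v by simp
  qed
qed

lemma inverse_bound:
  assumes K: "K \<in> carrier_mat N N" "psd N (im_mat K)" and L: "L \<in> carrier_mat N N" "G z K * L = (-1) \<cdot>\<^sub>m 1\<^sub>m N"
    and z: "0 < Im z" and v: "v \<in> carrier_vec N"
  shows "vnorm (L *\<^sub>v v) \<le> 1 / Im z * vnorm v"
proof -
  have w: "L *\<^sub>v v \<in> carrier_vec N" using L v by simp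
  have "Im z * (vnorm (L *\<^sub>v v))\<^sup>2 \<le> cmod ((L *\<^sub>v v) \<bullet>c v)"
    using inverse_im(1)[OF K L v] abs_Im_le_cmod[of "(L *\<^sub>v v) \<bullet>c v"] by linarith
  also have "\<dots> \<le> vnorm (L *\<^sub>v v) * vnorm v" by (rule cinner_le[OF w v])
  finally have "vnorm (L *\<^sub>v v) * (Im z * vnorm (L *\<^sub>v v)) \<le> vnorm (L *\<^sub>v v) * vnorm v" by (simp add: power2_eq_square algebra_simps)
  then have "Im z * vnorm (L *\<^sub>v v) \<le> vnorm v \<or> vnorm (L *\<^sub>v v) = 0"
    by (smt (verit) mult_le_cancel_left_pos vnorm_nonneg)
  then show ?thesis using z by (auto simp: field_simps)
qed

lemma Phi_props:
  assumes K: "K \<in> carrier_mat N N" "psd N (im_mat K)" and z: "0 < Im z"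
  shows "Phi z K \<in> carrier_mat N N" "G z K * Phi z K = (-1) \<cdot>\<^sub>m 1\<^sub>m N" "Determinant.det (G z K) \<noteq> 0"
    "psd N (im_mat (Phi z K))" "frob N (Phi z K) \<le> N / Im z"
proof -
  note Gc = G_carrier[OF K(1), of z]
  show d: "Determinant.det (G z K) \<noteq> 0"
  proof
    assume "Determinant.det (G z K) = 0"
    then obtain v where v: "v \<in> carrier_vec N" "v \<noteq> 0\<^sub>v N" "G z K *\<^sub>v v = 0\<^sub>v N"
      using det_0_iff_vec_prod_zero[OF Gc] by blast
    have "0 < Im z * (vnorm v)\<^sup>2" using z vnorm_pos[OF v(1,2)] by simp
    also have "\<dots> \<le> Im ((0\<^sub>v N) \<bullet>c v)" using G_im[OF K v(1), of z] unfolding v(3) .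
    also have "\<dots> = 0" using v(1) by (simp add: cinner_sum[of _ N])
    finally show False by simp
  qed
  show P: "Phi z K \<in> carrier_mat N N" using adj_mat(1)[OF Gc] by (simp add: Phi_def)
  show I: "G z K * Phi z K = (-1) \<cdot>\<^sub>m 1\<^sub>m N"
    unfolding Phi_def mult_smult_distrib[OF Gc adj_mat(1)[OF Gc]] adj_mat(2)[OF Gc] using d by (intro eq_matI) auto
  show "psd N (im_mat (Phi z K))"
    unfolding psd_iff
  proof (intro conjI ballI)
    show "herm_mat N (im_mat (Phi z K))" by (rule re_im_mat(2)[OF P])
    fix v :: "complex vec" assume v: "v \<in> carrier_vec N"
    have "0 \<le> Im z * (vnorm (Phi z K *\<^sub>v v))\<^sup>2" using z by simp
    then show "0 \<le> quad_form (im_mat (Phi z K)) v"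
      unfolding quad_form_im_mat(1)[OF P v] using inverse_im(1)[OF K P I v] by linarith
  qed
  have "frob N (Phi z K) \<le> N * (1 / Im z)"
    by (rule frob_le_of_vnorm_bound[OF P _ inverse_bound[OF K P I z]]) (use z in auto)
  then show "frob N (Phi z K) \<le> N / Im z" by simp
qed

text \<open>This is the resolvent identity for \<open>L = - (z + S[K])\<^sup>-\<^sup>1\<close>.\<close>
lemma inverse_difference:
  assumes K: "K1 \<in> carrier_mat N N" "K2 \<in> carrier_mat N N" and L: "L1 \<in> carrier_mat N N" "L2 \<in> carrier_mat N N"
    and I: "G z1 K1 * L1 = (-1) \<cdot>\<^sub>m 1\<^sub>m N" "G z2 K2 * L2 = (-1) \<cdot>\<^sub>m 1\<^sub>m N"
  shows "L1 - L2 = L1 * ((z1 - z2) \<cdot>\<^sub>m 1\<^sub>m N + S (K1 - K2)) * L2"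
proof -
  note asc = assoc_mult_mat[of _ N N _ N _ N]
  note Gc = G_carrier[OF K(1), of z1] G_carrier[OF K(2), of z2]
  note Sc = S_carrier[OF K(1)] S_carrier[OF K(2)]
  have mL: "(-1) \<cdot>\<^sub>m L1 \<in> carrier_mat N N" using L by simp
  have "G z1 K1 * ((-1) \<cdot>\<^sub>m L1) = 1\<^sub>m N"
    unfolding mult_smult_distrib[OF Gc(1) L(1)] I(1) by (intro eq_matI) auto
  from mat_mult_left_right_inverse[OF Gc(1) mL this] have "(-1) \<cdot>\<^sub>m L1 * G z1 K1 = 1\<^sub>m N" .
  then have e: "(-1) \<cdot>\<^sub>m (L1 * G z1 K1) = 1\<^sub>m N" using mult_smult_assoc_mat[OF L(1) Gc(1), of "-1"] by simp
  have LG: "L1 * G z1 K1 = (-1) \<cdot>\<^sub>m 1\<^sub>m N"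
  proof -
    have "(-1) \<cdot>\<^sub>m ((-1) \<cdot>\<^sub>m (L1 * G z1 K1)) = L1 * G z1 K1" using L Gc by (intro eq_matI) (auto simp del: index_mult_mat(1))
    then show ?thesis unfolding e by simp
  qed
  have dG: "(z1 - z2) \<cdot>\<^sub>m 1\<^sub>m N + S (K1 - K2) = G z1 K1 - G z2 K2"
    unfolding linear_op_minus[OF lin K] G_def using Sc by (intro eq_matI) (auto simp: carrier_matD[OF Sc(1)] carrier_matD[OF Sc(2)] algebra_simps)
  have "L1 * (G z1 K1 - G z2 K2) * L2 = (L1 * G z1 K1) * L2 - L1 * (G z2 K2 * L2)"
    using L Gc by (simp add: mult_minus_distrib_mat[of _ N N _ N] minus_mult_distrib_mat[of _ N N _ _ N] asc)
  also have "\<dots> = L1 - L2"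
    unfolding LG I(2) using L
    by (simp add: mult_smult_distrib[of _ N N _ N] mult_smult_assoc_mat[of _ N N _ N]) (intro eq_matI, auto)
  finally show ?thesis unfolding dG by simp
qed

lemma mde_iff:
  assumes "M \<in> carrier_mat N N"
  shows "mde_solution N S z M \<longleftrightarrow> G z M * M = (-1) \<cdot>\<^sub>m 1\<^sub>m N \<and> loewner_less N (0\<^sub>m N N) (im_mat M)"
proof -
  have g: "G z M * M \<in> carrier_mat N N" by (rule mult_carrier_mat[OF G_carrier[OF assms] assms])
  have "1\<^sub>m N + G z M * M = 0\<^sub>m N N \<longleftrightarrow> G z M * M = (-1) \<cdot>\<^sub>m 1\<^sub>m N"
  proof
    assume "1\<^sub>m N + G z M * M = 0\<^sub>m N N"
    then have "(1\<^sub>m N + G z M * M) $$ (i,j) = 0" if "i < N" "j < N" for i j using that by simp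
    then have "1\<^sub>m N $$ (i,j) + (G z M * M) $$ (i,j) = 0" if "i < N" "j < N" for i j
      using that g by (metis index_add_mat(1) carrier_matD)
    then show "G z M * M = (-1) \<cdot>\<^sub>m 1\<^sub>m N" using g by (intro eq_matI) (auto simp: add_eq_0_iff2 simp del: index_mult_mat(1))
  qed (auto intro!: eq_matI)
  then show ?thesis using assms by (simp add: mde_solution_def G_def)
qed

lemma mde_im_psd:
  assumes "mde_solution N S z M"
  shows "M \<in> carrier_mat N N" "psd N (im_mat M)"
proof -
  show M: "M \<in> carrier_mat N N" using assms by (simp add: mde_solution_def)
  have "0 \<le> quad_form (im_mat M) v" if v: "v \<in> carrier_vec N" for v
  proof (cases "v = 0\<^sub>v N")
    case True
    have "im_mat M \<in> carrier_mat N N" using re_im_mat(2)[OF M] by (simp add: herm_mat_def)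
    then show ?thesis unfolding True quad_form_def by (simp add: mult_mat_vec_zero[of _ N N] cinner_sum[of _ N])
  next
    case False
    then show ?thesis using assms v by (fastforce simp: mde_solution_def loewner_less_def)
  qed
  then show "psd N (im_mat M)" using re_im_mat(2)[OF M] by (simp add: psd_iff)
qed

lemma mdeI:
  assumes L: "L \<in> carrier_mat N N" "psd N (im_mat L)" "G z L * L = (-1) \<cdot>\<^sub>m 1\<^sub>m N" and z: "0 < Im z"
  shows "mde_solution N S z L"
  unfolding mde_iff[OF L(1)] loewner_less_def
proof (intro conjI ballI impI L(3) herm_mat_zero re_im_mat(2)[OF L(1)])
  fix v :: "complex vec" assume v: "v \<in> carrier_vec N" "v \<noteq> 0\<^sub>v N"
  have "0 < Im z * (vnorm (L *\<^sub>v v))\<^sup>2"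
    using z vnorm_pos[of "L *\<^sub>v v" N] inverse_im(2)[OF L(1,2,1,3) v] L(1) v by simp
  then show "quad_form (0\<^sub>m N N) v < quad_form (im_mat L) v"
    unfolding quad_form_im_mat(1)[OF L(1) v(1)] using inverse_im(1)[OF L(1,2,1,3) v(1)] v by simp
qed

end

lemma det_holomorphic:
  assumes "\<And>i j. i < n \<Longrightarrow> j < n \<Longrightarrow> (\<lambda>z. A z $$ (i,j)) holomorphic_on U" and "\<And>z. A z \<in> carrier_mat n n"
  shows "(\<lambda>z. Determinant.det (A z)) holomorphic_on U"
  unfolding det_def'[OF assms(2)]
proof (intro holomorphic_on_sum holomorphic_on_mult holomorphic_on_const holomorphic_on_prod)
  fix p i assume "p \<in> {p. p permutes {0..<n}}" "i \<in> {0..<n}"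
  then show "(\<lambda>z. A z $$ (i, p i)) holomorphic_on U"
    using assms(1)[of i "p i"] permutes_in_image[of p "{0..<n}" i] by simp
qed

lemma adj_mat_holomorphic:
  assumes A: "\<And>i j. i < n \<Longrightarrow> j < n \<Longrightarrow> (\<lambda>z. A z $$ (i,j)) holomorphic_on U" and c: "\<And>z. A z \<in> carrier_mat n n"
    and ij: "i < n" "j < n"
  shows "(\<lambda>z. adj_mat (A z) $$ (i,j)) holomorphic_on U"
proof -
  have "(\<lambda>z. Determinant.det (mat_delete (A z) j i)) holomorphic_on U"
  proof (rule det_holomorphic[where n = "n - 1"])
    show "mat_delete (A z) j i \<in> carrier_mat (n - 1) (n - 1)" for z by (rule mat_delete_carrier[OF c])
    fix k l assume kl: "k < n - 1" "l < n - 1"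
    have d: "dim_row (A z) = n" "dim_col (A z) = n" for z using c[of z] by auto
    have "(\<lambda>z. A z $$ (if k < j then k else Suc k, if l < i then l else Suc l)) holomorphic_on U"
      by (rule A) (use kl in auto)
    then show "(\<lambda>z. mat_delete (A z) j i $$ (k, l)) holomorphic_on U"
      using kl by (simp add: mat_delete_def d)
  qed
  then have "(\<lambda>z. (-1) ^ (j + i) * Determinant.det (mat_delete (A z) j i)) holomorphic_on U"
    by (intro holomorphic_on_mult holomorphic_on_const)
  moreover have "adj_mat (A z) $$ (i,j) = (-1) ^ (j + i) * Determinant.det (mat_delete (A z) j i)" for z
    using ij c[of z] by (simp add: adj_mat_def cofactor_def)
  ultimately show ?thesis by simp
qed

text \<open>Montel's theorem is applied to one member of the family after the other, passing to a subsequence each time.\<close>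
lemma Montel_finite_family:
  fixes F :: "'i \<Rightarrow> nat \<Rightarrow> complex \<Rightarrow> complex"
  assumes "finite I" and U: "open U" and hol: "\<And>i n. i \<in> I \<Longrightarrow> F i n holomorphic_on U"
    and bd: "\<And>i K. i \<in> I \<Longrightarrow> compact K \<Longrightarrow> K \<subseteq> U \<Longrightarrow> \<exists>B. \<forall>n. \<forall>z\<in>K. cmod (F i n z) \<le> B"
  shows "\<exists>r g. strict_mono (r :: nat \<Rightarrow> nat) \<and> (\<forall>i\<in>I. g i holomorphic_on U \<and> (\<forall>z\<in>U. (\<lambda>n. F i (r n) z) \<longlonglongrightarrow> g i z))"
  using assms(1) hol bd
proof (induction I)
  case empty
  show ?case by (rule exI[of _ id]) (auto simp: strict_mono_def)
next
  case (insert i I)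
  obtain r g where r: "strict_mono r" and g: "\<And>k. k \<in> I \<Longrightarrow> g k holomorphic_on U" "\<And>k z. k \<in> I \<Longrightarrow> z \<in> U \<Longrightarrow> (\<lambda>n. F k (r n) z) \<longlonglongrightarrow> g k z"
    using insert.IH insert.prems by (metis insertCI)
  obtain h s where h: "h holomorphic_on U" and s: "strict_mono (s :: nat \<Rightarrow> nat)" and lim: "\<And>z. z \<in> U \<Longrightarrow> (\<lambda>n. F i (r (s n)) z) \<longlonglongrightarrow> h z"
  proof (rule Montel[of U "range (\<lambda>n. F i (r n))" "\<lambda>n. F i (r n)"])
    show "open U" by fact
    show "f holomorphic_on U" if "f \<in> range (\<lambda>n. F i (r n))" for f using that insert.prems(1)[of i] by auto
    show "\<exists>B. \<forall>h\<in>range (\<lambda>n. F i (r n)). \<forall>z\<in>K. cmod (h z) \<le> B" if "compact K" "K \<subseteq> U" for K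
      using insert.prems(2)[of i K] that by auto
  qed auto
  define g' where "g' = g(i := h)"
  have "strict_mono (r \<circ> s)" using r s by (rule strict_mono_o)
  moreover have "g' k holomorphic_on U \<and> (\<forall>z\<in>U. (\<lambda>n. F k ((r \<circ> s) n) z) \<longlonglongrightarrow> g' k z)" if k: "k \<in> insert i I" for k
  proof (cases "k = i")
    case True
    then show ?thesis using h lim by (simp add: g'_def)
  next
    case False
    then have kI: "k \<in> I" using k by simp
    have "(\<lambda>n. F k (r (s n)) z) \<longlonglongrightarrow> g k z" if "z \<in> U" for z
      using LIMSEQ_subseq_LIMSEQ[OF g(2)[OF kI that] s] by (simp add: o_def)
    then show ?thesis using False g(1)[OF kI] by (simp add: g'_def)
  qed
  ultimately show ?case by blast
qed

definition (in balanced_solution) "frame X = mat_adjoint Bi * X * Bi"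

lemma (in balanced_solution) frame_props:
  assumes X: "X \<in> carrier_mat N N"
  shows "frame X \<in> carrier_mat N N" "mat_adjoint B * frame X * B = X"
proof -
  show "frame X \<in> carrier_mat N N" using X Bi by (simp add: frame_def)
  have "mat_adjoint B * (mat_adjoint Bi * X * Bi) * B = (mat_adjoint B * mat_adjoint Bi) * X * (Bi * B)"
    using X B Bi by (simp add: assoc_mult_mat[of _ N N _ N _ N])
  then show "mat_adjoint B * frame X * B = X" unfolding frame_def adj_Bi_adj_B BiB using X by simp
qed

lemma (in balanced_solution) frame_unique:
  assumes X: "X \<in> carrier_mat N N"
  shows "frame (mat_adjoint B * X * B) = X"
proof -
  have "mat_adjoint Bi * (mat_adjoint B * X * B) * Bi = (mat_adjoint Bi * mat_adjoint B) * X * (B * Bi)"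
    using X B Bi by (simp add: assoc_mult_mat[of _ N N _ N _ N])
  then show ?thesis unfolding frame_def adj_Bi_adj_B BBi using X by simp
qed

lemma (in balanced_solution) frame_add:
  assumes "X \<in> carrier_mat N N" "Y \<in> carrier_mat N N"
  shows "frame (X + Y) = frame X + frame Y"
  unfolding frame_def using assms Bi by (simp add: mult_add_distrib_mat[of _ N N _ N] add_mult_distrib_mat[of _ N N _ _ N])

lemma (in balanced_solution) frame_contraction:
  assumes X: "X \<in> carrier_mat N N"
  shows "frob N (frame (M * S X * M)) \<le> (1 - Im z / a_up) * frob N (frame X)"
proof -
  define Y where "Y = frame X"
  have Y: "Y \<in> carrier_mat N N" "X = mat_adjoint B * Y * B" using frame_props[OF X] by (auto simp: Y_def)
  note FY = linear_opD(1)[OF F_linear Y(1)]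
  have UFU: "Umat * F Y * Umat \<in> carrier_mat N N" using FY carriers by simp
  have "M * S X * M = mat_adjoint B * (Umat * F Y * Umat) * B"
  proof -
    define T where "T = S (mat_adjoint B * Y * B)"
    have T: "T \<in> carrier_mat N N" using S_carrier[OF BXB_carrier[OF Y(1)]] by (simp add: T_def)
    have "M * T * M = mat_adjoint B * (Umat * (B * T * mat_adjoint B) * Umat) * B"
      unfolding M_decomp Umat_def[symmetric] using B T carriers by (simp add: assoc_mult_mat[of _ N N _ N _ N])
    then show ?thesis by (simp only: T_def F_def Y(2))
  qed
  then have "frame (M * S X * M) = Umat * F Y * Umat" using frame_unique[OF UFU] by simp
  then show ?thesis using F_contraction[OF Y(1)] frob_unitary_sandwich[OF FY, of u] u by (simp add: Umat_def Y_def)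
qed

context flat_self_energy
begin

lemma balanced_frame:
  assumes z: "0 < Im z" and M: "mde_solution N S z M"
    and mu: "\<And>v. v \<in> carrier_vec N \<Longrightarrow> vnorm (M *\<^sub>v v) \<le> \<mu> * vnorm v"
  obtains B Bi u where "balanced_solution N S c C z M B Bi u \<mu>"
proof -
  interpret dyson_solution N S c C z M by unfold_locales (use z M in auto)
  have "0 < Im ((M *\<^sub>v v) \<bullet>c v)" if "v \<in> carrier_vec N" "v \<noteq> 0\<^sub>v N" for v
    using im_M_pos[OF that] quad_form_im_mat(1)[OF M_carrier that(1)] by simp
  then obtain B Bi u where "B \<in> carrier_mat N N" "Bi \<in> carrier_mat N N" "B * Bi = 1\<^sub>m N" "Bi * B = 1\<^sub>m N"
    "\<And>i. i < N \<Longrightarrow> cmod (u i) = 1 \<and> 0 < Im (u i)" "M = mat_adjoint B * mat_diag N u * B"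
    using balanced_decomposition[OF M_carrier] by metis
  then have "balanced_solution N S c C z M B Bi u \<mu>" by unfold_locales (use mu in auto)
  then show ?thesis using that by blast
qed

text \<open>The map \<open>X \<mapsto> M S[X] M\<close> is a contraction in the Hilbert--Schmidt norm of the balanced frame, though not
  necessarily in the original one.\<close>
lemma adapted_norm:
  assumes z: "0 < Im z" and M: "mde_solution N S z M"
  obtains nrm :: "complex mat \<Rightarrow> real" and q k1 k2 where "0 < k1" "0 < k2" "0 \<le> q" "q < 1"
    "\<And>X. 0 \<le> nrm X"
    "\<And>X. X \<in> carrier_mat N N \<Longrightarrow> k1 * nrm X \<le> frob N X"
    "\<And>X. X \<in> carrier_mat N N \<Longrightarrow> frob N X \<le> k2 * nrm X"
    "\<And>X Y. X \<in> carrier_mat N N \<Longrightarrow> Y \<in> carrier_mat N N \<Longrightarrow> nrm (X + Y) \<le> nrm X + nrm Y"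
    "\<And>X. X \<in> carrier_mat N N \<Longrightarrow> nrm (M * S X * M) \<le> q * nrm X"
proof -
  interpret d: dyson_solution N S c C z M by unfold_locales (use z M in auto)
  obtain B Bi u where "balanced_solution N S c C z M B Bi u (1 / d.a_low)"
    using balanced_frame[OF z M d.M_bound] by blast
  then interpret b: balanced_solution N S c C z M B Bi u "1 / d.a_low" .
  show ?thesis
  proof (rule that[of b.b_low b.b_up "1 - Im z / d.a_up" "\<lambda>X. frob N (b.frame X)"])
    show "0 < b.b_low" "0 < b.b_up" by (rule b.b_pos)+
    show "0 \<le> 1 - Im z / d.a_up" "1 - Im z / d.a_up < 1"
      using z d.a_pos C_pos d.avg_im_pos by (auto simp: d.a_up_def)
    fix X :: "complex mat" assume X: "X \<in> carrier_mat N N"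
    show "b.b_low * frob N (b.frame X) \<le> frob N X" using b.sandwich_bounds(2)[OF b.frame_props(1)[OF X]] b.frame_props(2)[OF X] by simp
    show "frob N X \<le> b.b_up * frob N (b.frame X)" using b.sandwich_bounds(1)[OF b.frame_props(1)[OF X]] b.frame_props(2)[OF X] by simp
    show "frob N (b.frame (M * S X * M)) \<le> (1 - Im z / d.a_up) * frob N (b.frame X)" by (rule b.frame_contraction[OF X])
    fix Y :: "complex mat" assume Y: "Y \<in> carrier_mat N N"
    show "frob N (b.frame (X + Y)) \<le> frob N (b.frame X) + frob N (b.frame Y)"
      unfolding b.frame_add[OF X Y] by (rule frob_triangle[OF b.frame_props(1)[OF X] b.frame_props(1)[OF Y]])
  qed simp
qed

fun iter :: "complex mat \<Rightarrow> nat \<Rightarrow> complex \<Rightarrow> complex mat" where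
  "iter M0 0 z = M0"
| "iter M0 (Suc n) z = Phi z (iter M0 n z)"

lemma Phi_carrier: "K \<in> carrier_mat N N \<Longrightarrow> Phi z K \<in> carrier_mat N N"
  unfolding Phi_def using adj_mat(1)[OF G_carrier] by simp

lemma iter_carrier: "M0 \<in> carrier_mat N N \<Longrightarrow> iter M0 n z \<in> carrier_mat N N"
  by (induction n) (simp_all add: Phi_carrier)

lemma iter_psd: "M0 \<in> carrier_mat N N \<Longrightarrow> psd N (im_mat M0) \<Longrightarrow> 0 < Im z \<Longrightarrow> psd N (im_mat (iter M0 n z))"
  by (induction n) (simp_all add: Phi_props(4) iter_carrier)

lemma iter_frob:
  assumes "M0 \<in> carrier_mat N N" "psd N (im_mat M0)" "0 < Im z"
  shows "frob N (iter M0 n z) \<le> frob N M0 + N / Im z"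
proof (cases n)
  case (Suc m)
  have "frob N (iter M0 n z) \<le> N / Im z" unfolding Suc iter.simps
    by (rule Phi_props(5)[OF iter_carrier[OF assms(1)] iter_psd[OF assms] assms(3)])
  then show ?thesis using frob_nonneg[of N M0] by linarith
qed (use assms(3) in simp)

lemma S_entry_tendsto:
  assumes "\<And>k. X k \<in> carrier_mat N N" "L \<in> carrier_mat N N"
    and "\<And>i j. i < N \<Longrightarrow> j < N \<Longrightarrow> (\<lambda>k. X k $$ (i,j)) \<longlonglongrightarrow> L $$ (i,j)" and ij: "i < N" "j < N"
  shows "(\<lambda>k. S (X k) $$ (i,j)) \<longlonglongrightarrow> S L $$ (i,j)"
  unfolding linear_op_entries[OF lin assms(1) ij] linear_op_entries[OF lin assms(2) ij]
  by (intro tendsto_sum tendsto_mult tendsto_const) (auto intro: assms(3))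

lemma S_entry_holomorphic:
  assumes "\<And>z. X z \<in> carrier_mat N N"
    and "\<And>i j. i < N \<Longrightarrow> j < N \<Longrightarrow> (\<lambda>z. X z $$ (i,j)) holomorphic_on U" and ij: "i < N" "j < N"
  shows "(\<lambda>z. S (X z) $$ (i,j)) holomorphic_on U"
  unfolding linear_op_entries[OF lin assms(1) ij]
  by (intro holomorphic_on_sum holomorphic_on_mult holomorphic_on_const) (auto intro: assms(2))

lemma G_entry: "K \<in> carrier_mat N N \<Longrightarrow> i < N \<Longrightarrow> j < N \<Longrightarrow> G z K $$ (i,j) = (if i = j then z else 0) + S K $$ (i,j)"
  using S_carrier[of K] by (simp add: G_def)

lemma G_entry_holomorphic:
  assumes "\<And>z. X z \<in> carrier_mat N N"
    and "\<And>i j. i < N \<Longrightarrow> j < N \<Longrightarrow> (\<lambda>z. X z $$ (i,j)) holomorphic_on U" and ij: "i < N" "j < N"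
  shows "(\<lambda>z. G z (X z) $$ (i,j)) holomorphic_on U"
  unfolding G_entry[OF assms(1) ij] using S_entry_holomorphic[OF assms]
  by (cases "i = j") (auto intro!: holomorphic_intros)

lemma iter_holomorphic:
  assumes M0: "M0 \<in> carrier_mat N N" "psd N (im_mat M0)"
  shows "i < N \<Longrightarrow> j < N \<Longrightarrow> (\<lambda>z. iter M0 n z $$ (i,j)) holomorphic_on upper_half_plane"
proof (induction n arbitrary: i j)
  case (Suc n)
  note ic = iter_carrier[OF M0(1), of n]
  have hG: "(\<lambda>z. G z (iter M0 n z) $$ (k,l)) holomorphic_on upper_half_plane" if "k < N" "l < N" for k l
    by (rule G_entry_holomorphic[OF ic Suc.IH that])
  have Gc: "G z (iter M0 n z) \<in> carrier_mat N N" for z by (rule G_carrier[OF ic])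
  have "iter M0 (Suc n) z $$ (i,j) = - 1 / Determinant.det (G z (iter M0 n z)) * adj_mat (G z (iter M0 n z)) $$ (i,j)" for z
    using adj_mat(1)[OF Gc[of z]] Suc.prems by (simp add: Phi_def)
  moreover have "(\<lambda>z. - 1 / Determinant.det (G z (iter M0 n z)) * adj_mat (G z (iter M0 n z)) $$ (i,j)) holomorphic_on upper_half_plane"
  proof (intro holomorphic_on_mult holomorphic_on_divide holomorphic_on_const)
    show "(\<lambda>z. Determinant.det (G z (iter M0 n z))) holomorphic_on upper_half_plane" by (rule det_holomorphic[OF hG Gc])
    show "(\<lambda>z. adj_mat (G z (iter M0 n z)) $$ (i,j)) holomorphic_on upper_half_plane" by (rule adj_mat_holomorphic[OF hG Gc Suc.prems])
    show "Determinant.det (G z (iter M0 n z)) \<noteq> 0" if "z \<in> upper_half_plane" for z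
      using that by (intro Phi_props(3)[OF ic iter_psd[OF M0]]) (auto simp: upper_half_plane_def)
  qed
  ultimately show ?case by simp
qed simp

lemma frob_triple: "A \<in> carrier_mat N N \<Longrightarrow> X \<in> carrier_mat N N \<Longrightarrow> Y \<in> carrier_mat N N \<Longrightarrow>
   frob N (A * X * Y) \<le> frob N A * frob N X * frob N Y"
  using frob_mult_le[of "A * X" N Y] frob_mult_le[of A N X] mult_right_mono[of "frob N (A * X)" "frob N A * frob N X" "frob N Y"]
  by (simp del: assoc_mult_mat)

text \<open>Close to a solution the fixed point map is a contraction in the norm of the balanced frame.\<close>
lemma local_contraction:
  assumes z0: "0 < Im z0" and M0: "mde_solution N S z0 M0"
  obtains r K q where "0 < r" "0 \<le> q" "q < 1"
    "\<And>z n. dist z z0 < r \<Longrightarrow> 0 < Im z \<Longrightarrow> frob N (iter M0 (Suc n) z - iter M0 n z) \<le> K * q ^ n"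
proof -
  note M0c = mde_im_psd[OF M0]
  have GM0: "G z0 M0 * M0 = (-1) \<cdot>\<^sub>m 1\<^sub>m N" using M0 mde_iff[OF M0c(1)] by simp
  obtain nrm q k1 k2 where k: "0 < k1" "0 < k2" and q: "0 \<le> q" "q < 1" and nn: "\<And>X. 0 \<le> nrm X"
    and lo: "\<And>X. X \<in> carrier_mat N N \<Longrightarrow> k1 * nrm X \<le> frob N X"
    and hi: "\<And>X. X \<in> carrier_mat N N \<Longrightarrow> frob N X \<le> k2 * nrm X"
    and tri: "\<And>X Y. X \<in> carrier_mat N N \<Longrightarrow> Y \<in> carrier_mat N N \<Longrightarrow> nrm (X + Y) \<le> nrm X + nrm Y"
    and contr: "\<And>X. X \<in> carrier_mat N N \<Longrightarrow> nrm (M0 * S X * M0) \<le> q * nrm X"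
    using adapted_norm[OF z0 M0] by metis
  obtain s where s: "0 \<le> s" and Sb: "\<And>X. X \<in> carrier_mat N N \<Longrightarrow> frob N (S X) \<le> s * frob N X"
    using linear_op_bounded[OF lin] by metis
  define m0 where "m0 = frob N M0"
  define n1 where "n1 = frob N (1\<^sub>m N)"
  have mn: "0 \<le> m0" "0 \<le> n1" by (auto simp: m0_def n1_def)
  \<comment> \<open>Within distance \<open>\<epsilon>\<close> of \<open>M0\<close>, replacing \<open>M0 S[D] M0\<close> by \<open>L1 S[D] L2\<close> costs at most half of the contraction gap
    \<open>1 - q\<close>; the radii \<open>R\<close> for the iterates and \<open>r\<close> for \<open>z\<close> keep the iteration inside this neighbourhood.\<close>
  define E where "E = 2 * m0 + 1"
  define \<epsilon> where "\<epsilon> = min 1 ((1 - q) * k1 / (2 * E * (s * k2 + 1)))"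
  define q' where "q' = (1 + q) / 2"
  define c1 where "c1 = (m0\<^sup>2 + E) * n1 / k1"
  define c4 where "c4 = 2 * N * m0 / Im z0"
  define R where "R = \<epsilon> / (2 * (c4 * s * k2 + 1))"
  define r where "r = min (Im z0 / 2) (min (\<epsilon> / (2 * (c4 * n1 + 1))) ((1 - q') * R / (c1 + 1)))"
  have E1: "1 \<le> E" using mn by (simp add: E_def)
  have sk: "0 < s * k2 + 1" using s k by (simp add: add_nonneg_pos)
  have eps: "0 < \<epsilon>" "\<epsilon> \<le> 1" unfolding \<epsilon>_def using q k E1 sk by auto
  have q': "0 \<le> q'" "q' < 1" using q by (auto simp: q'_def)
  have c14: "0 \<le> c1" "0 \<le> c4" unfolding c1_def c4_def using mn E1 k z0 by (auto intro!: divide_nonneg_pos mult_nonneg_nonneg)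
  have R0: "0 < R" unfolding R_def using eps c14 s k by (auto intro!: divide_pos_pos add_nonneg_pos mult_nonneg_nonneg)
  have r0: "0 < r" unfolding r_def using z0 eps c14 mn R0 q' by (auto intro!: divide_pos_pos add_nonneg_pos mult_nonneg_nonneg mult_pos_pos)
  have eps_small: "\<epsilon> * E * (s * k2) / k1 \<le> (1 - q) / 2"
  proof -
    have "\<epsilon> \<le> (1 - q) * k1 / (2 * E * (s * k2 + 1))" by (simp add: \<epsilon>_def)
    then have "\<epsilon> * (2 * E * (s * k2 + 1)) \<le> (1 - q) * k1" using E1 sk by (simp add: pos_le_divide_eq)
    moreover have "\<epsilon> * E * (s * k2) * 2 \<le> \<epsilon> * (2 * E * (s * k2 + 1))" using eps E1 by (simp add: algebra_simps)
    ultimately show ?thesis using k by (simp add: field_simps)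
  qed
  have step: "nrm (L1 - L2) \<le> q' * nrm (K1 - K2) + c1 * cmod (z1 - z2)"
    if K: "K1 \<in> carrier_mat N N" "K2 \<in> carrier_mat N N" and L: "L1 \<in> carrier_mat N N" "L2 \<in> carrier_mat N N"
      and I: "G z1 K1 * L1 = (-1) \<cdot>\<^sub>m 1\<^sub>m N" "G z2 K2 * L2 = (-1) \<cdot>\<^sub>m 1\<^sub>m N"
      and near: "frob N (L1 - M0) \<le> \<epsilon>" "frob N (L2 - M0) \<le> \<epsilon>" for K1 K2 L1 L2 z1 z2
  proof -
    define D where "D = K1 - K2"
    define T where "T = (z1 - z2) \<cdot>\<^sub>m 1\<^sub>m N + S D"
    have Dc: "D \<in> carrier_mat N N" using K by (simp add: D_def minus_carrier_mat)
    note SD = S_carrier[OF Dc]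
    have Tc: "T \<in> carrier_mat N N" using SD by (simp add: T_def)
    have d12: "L1 - M0 \<in> carrier_mat N N" "L2 - M0 \<in> carrier_mat N N" using L M0c by (auto simp: minus_carrier_mat)
    define W where "W = (L1 - M0) * T * L2 + M0 * T * (L2 - M0)"
    have Wc: "W \<in> carrier_mat N N" using d12 Tc L M0c by (simp add: W_def)
    have zz: "(z1 - z2) \<cdot>\<^sub>m (M0 * M0) \<in> carrier_mat N N" "M0 * S D * M0 \<in> carrier_mat N N" using M0c SD by auto
    have "L1 - L2 = L1 * T * L2" unfolding T_def D_def by (rule inverse_difference[OF K L I])
    also have "\<dots> = M0 * T * M0 + W"
    proof -
      have "(L1 - M0) * T * L2 = L1 * T * L2 - M0 * T * L2" "M0 * T * (L2 - M0) = M0 * T * L2 - M0 * T * M0"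
        using L M0c(1) Tc by (simp_all add: mult_minus_distrib_mat[of _ N N _ N] minus_mult_distrib_mat[of _ N N _ _ N])
      then show ?thesis unfolding W_def using L M0c(1) Tc by (intro eq_matI) (auto simp del: index_mult_mat(1))
    qed
    also have "M0 * T * M0 = (z1 - z2) \<cdot>\<^sub>m (M0 * M0) + M0 * S D * M0"
      unfolding T_def using M0c(1) SD
      by (simp add: mult_add_distrib_mat[of _ N N _ N] add_mult_distrib_mat[of _ N N _ _ N] mult_smult_distrib[of _ N N _ N] mult_smult_assoc_mat[of _ N N _ N])
    finally have e: "L1 - L2 = (z1 - z2) \<cdot>\<^sub>m (M0 * M0) + M0 * S D * M0 + W" .
    have "nrm (L1 - L2) \<le> nrm ((z1 - z2) \<cdot>\<^sub>m (M0 * M0)) + nrm (M0 * S D * M0) + nrm W"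
      unfolding e using tri[of "(z1 - z2) \<cdot>\<^sub>m (M0 * M0) + M0 * S D * M0" W] tri[OF zz] Wc zz by simp
    moreover have "nrm ((z1 - z2) \<cdot>\<^sub>m (M0 * M0)) \<le> cmod (z1 - z2) * m0\<^sup>2 / k1"
    proof -
      have "k1 * nrm ((z1 - z2) \<cdot>\<^sub>m (M0 * M0)) \<le> cmod (z1 - z2) * frob N (M0 * M0)" using lo[OF zz(1)] M0c(1) by (simp add: frob_smult)
      also have "\<dots> \<le> cmod (z1 - z2) * m0\<^sup>2" using frob_mult_le[OF M0c(1) M0c(1)] by (intro mult_left_mono) (auto simp: m0_def power2_eq_square)
      finally show ?thesis using k by (simp add: field_simps)
    qed
    moreover have "nrm (M0 * S D * M0) \<le> q * nrm D" by (rule contr[OF Dc])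
    moreover have "nrm W \<le> \<epsilon> * E * (cmod (z1 - z2) * n1 + s * k2 * nrm D) / k1"
    proof -
      have fT: "frob N T \<le> cmod (z1 - z2) * n1 + s * k2 * nrm D"
      proof -
        have "frob N T \<le> cmod (z1 - z2) * n1 + frob N (S D)" unfolding T_def n1_def
          using frob_triangle[of "(z1 - z2) \<cdot>\<^sub>m 1\<^sub>m N" N "S D"] SD by (simp add: frob_smult)
        also have "frob N (S D) \<le> s * frob N D" by (rule Sb[OF Dc])
        also have "s * frob N D \<le> s * (k2 * nrm D)" using hi[OF Dc] s by (rule mult_left_mono)
        finally show ?thesis by (simp add: mult.assoc)
      qed
      have fL2: "frob N L2 \<le> m0 + \<epsilon>" using frob_triangle_diff[OF L(2) M0c(1)] near(2) by (simp add: m0_def)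
      have "frob N W \<le> frob N ((L1 - M0) * T * L2) + frob N (M0 * T * (L2 - M0))"
        unfolding W_def using d12 Tc L M0c(1) by (intro frob_triangle) auto
      also have "frob N ((L1 - M0) * T * L2) \<le> frob N (L1 - M0) * frob N T * frob N L2" by (rule frob_triple[OF d12(1) Tc L(2)])
      also have "\<dots> \<le> \<epsilon> * frob N T * (m0 + \<epsilon>)" using near(1) fL2 eps by (intro mult_mono) auto
      also have "frob N (M0 * T * (L2 - M0)) \<le> frob N M0 * frob N T * frob N (L2 - M0)" by (rule frob_triple[OF M0c(1) Tc d12(2)])
      also have "\<dots> \<le> m0 * frob N T * \<epsilon>" using near(2) mn by (intro mult_mono) (auto simp: m0_def)
      also have "\<epsilon> * frob N T * (m0 + \<epsilon>) + m0 * frob N T * \<epsilon> = \<epsilon> * (2 * m0 + \<epsilon>) * frob N T" by (simp add: algebra_simps)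
      also have "\<dots> \<le> \<epsilon> * E * frob N T" unfolding E_def using eps by (intro mult_right_mono mult_left_mono) auto
      also have "\<dots> \<le> \<epsilon> * E * (cmod (z1 - z2) * n1 + s * k2 * nrm D)" using fT eps E1 by (intro mult_left_mono) auto
      finally have "k1 * nrm W \<le> \<epsilon> * E * (cmod (z1 - z2) * n1 + s * k2 * nrm D)" using lo[OF Wc] by linarith
      then show ?thesis using k by (simp add: field_simps)
    qed
    moreover have "\<epsilon> * E * (cmod (z1 - z2) * n1 + s * k2 * nrm D) / k1 = \<epsilon> * (E * n1 * cmod (z1 - z2) / k1) + \<epsilon> * E * (s * k2) / k1 * nrm D"
      using k by (simp add: field_simps)
    moreover have "\<epsilon> * (E * n1 * cmod (z1 - z2) / k1) \<le> 1 * (E * n1 * cmod (z1 - z2) / k1)"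
      using eps E1 mn k by (intro mult_right_mono) auto
    moreover have "\<epsilon> * E * (s * k2) / k1 * nrm D \<le> (1 - q) / 2 * nrm D" using eps_small nn by (rule mult_right_mono)
    moreover have "cmod (z1 - z2) * m0\<^sup>2 / k1 \<le> cmod (z1 - z2) * (m0\<^sup>2 * n1) / k1"
    proof -
      have "1 \<le> n1" unfolding n1_def using frob_entry_le[of 0 N 0 "1\<^sub>m N"] N_pos by simp
      then have "m0\<^sup>2 * 1 \<le> m0\<^sup>2 * n1" by (intro mult_left_mono) auto
      then show ?thesis using k by (intro divide_right_mono mult_left_mono) auto
    qed
    moreover have "cmod (z1 - z2) * (m0\<^sup>2 * n1) / k1 + 1 * (E * n1 * cmod (z1 - z2) / k1) = c1 * cmod (z1 - z2)"
      using k by (simp add: c1_def field_simps)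
    moreover have "q * nrm D + (1 - q) / 2 * nrm D = q' * nrm D" by (simp add: q'_def field_simps)
    ultimately show ?thesis unfolding D_def[symmetric] by linarith
  qed
  have nrm0: "nrm (M0 - M0) = 0"
  proof -
    have z: "M0 - M0 = 0\<^sub>m N N" using M0c(1) by (intro eq_matI) auto
    have "frob N (0\<^sub>m N N) = 0" by (auto simp: frob_def L2_set_def intro!: sum.neutral)
    then have "k1 * nrm (M0 - M0) \<le> 0" unfolding z using lo[of "0\<^sub>m N N"] by simp
    then show ?thesis using k nn[of "M0 - M0"] by (simp add: mult_le_0_iff)
  qed
  have frob0: "frob N (M0 - M0) \<le> \<epsilon>" using hi[of "M0 - M0"] M0c(1) nrm0 eps by (simp add: minus_carrier_mat)
  have ball: "frob N (Phi z K - M0) \<le> \<epsilon> \<and> nrm (Phi z K - M0) \<le> R"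
    if z: "dist z z0 < r" "0 < Im z" and K: "K \<in> carrier_mat N N" "psd N (im_mat K)" "nrm (K - M0) \<le> R" for z K
  proof -
    note P = Phi_props[OF K(1,2) z(2)]
    have zr: "cmod (z - z0) \<le> r" using z by (simp add: dist_norm)
    have KM: "K - M0 \<in> carrier_mat N N" using K M0c by (simp add: minus_carrier_mat)
    define T where "T = (z - z0) \<cdot>\<^sub>m 1\<^sub>m N + S (K - M0)"
    have Tc: "T \<in> carrier_mat N N" using S_carrier[OF KM] by (simp add: T_def)
    have fT: "frob N T \<le> r * n1 + s * k2 * R"
    proof -
      have "frob N T \<le> cmod (z - z0) * n1 + frob N (S (K - M0))" unfolding T_def n1_def
        using frob_triangle[of "(z - z0) \<cdot>\<^sub>m 1\<^sub>m N" N "S (K - M0)"] S_carrier[OF KM] by (simp add: frob_smult)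
      also have "frob N (S (K - M0)) \<le> s * frob N (K - M0)" by (rule Sb[OF KM])
      also have "s * frob N (K - M0) \<le> s * (k2 * R)"
      proof (rule mult_left_mono[OF _ s])
        have "k2 * nrm (K - M0) \<le> k2 * R" using K(3) k by simp
        then show "frob N (K - M0) \<le> k2 * R" using hi[OF KM] by linarith
      qed
      also have "cmod (z - z0) * n1 \<le> r * n1" using zr mn by (intro mult_right_mono) auto
      finally show ?thesis by (simp add: mult.assoc)
    qed
    have "Im z0 / 2 \<le> Im z"
    proof -
      have "\<bar>Im (z - z0)\<bar> \<le> r" using zr abs_Im_le_cmod order_trans by blast
      moreover have "r \<le> Im z0 / 2" unfolding r_def by (rule min.cobounded1)
      ultimately show ?thesis by simp
    qed
    then have "real N / Im z \<le> N / (Im z0 / 2)" using z0 by (intro divide_left_mono) auto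
    then have fP: "frob N (Phi z K) \<le> 2 * N / Im z0" using P(5) by (simp add: mult.commute)
    have "Phi z K - M0 = Phi z K * T * M0" unfolding T_def by (rule inverse_difference[OF K(1) M0c(1) P(1) M0c(1) P(2) GM0])
    then have "frob N (Phi z K - M0) \<le> frob N (Phi z K) * frob N T * m0" using frob_triple[OF P(1) Tc M0c(1)] by (simp add: m0_def)
    also have "\<dots> \<le> (2 * N / Im z0) * (r * n1 + s * k2 * R) * m0"
      using fP fT mn z0 by (intro mult_right_mono mult_mono) auto
    also have "\<dots> = c4 * n1 * r + c4 * s * k2 * R" by (simp add: c4_def algebra_simps add_divide_distrib)
    also have "c4 * n1 * r \<le> \<epsilon> / 2"
    proof -
      have p: "0 < c4 * n1 + 1" using c14 mn by (intro add_nonneg_pos mult_nonneg_nonneg) auto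
      have "r \<le> \<epsilon> / (2 * (c4 * n1 + 1))" by (simp add: r_def)
      then have "r * (2 * (c4 * n1 + 1)) \<le> \<epsilon>" using p by (simp add: pos_le_divide_eq)
      then show ?thesis using r0 by (simp add: algebra_simps)
    qed
    also have "c4 * s * k2 * R \<le> \<epsilon> / 2"
    proof -
      have p: "0 < c4 * s * k2 + 1" using c14 s k by (intro add_nonneg_pos mult_nonneg_nonneg) auto
      have "R * (2 * (c4 * s * k2 + 1)) = \<epsilon>" unfolding R_def using p by simp
      then show ?thesis using R0 by (simp add: algebra_simps)
    qed
    finally have f: "frob N (Phi z K - M0) \<le> \<epsilon>" by simp
    have "nrm (Phi z K - M0) \<le> q' * nrm (K - M0) + c1 * cmod (z - z0)"
      by (rule step[OF K(1) M0c(1) P(1) M0c(1) P(2) GM0 f frob0])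
    also have "\<dots> \<le> q' * R + c1 * r" using K(3) zr q' c14 by (intro add_mono mult_left_mono) auto
    also have "c1 * r \<le> (1 - q') * R"
    proof -
      have "r \<le> (1 - q') * R / (c1 + 1)" by (simp add: r_def)
      then have "r * (c1 + 1) \<le> (1 - q') * R" using c14 by (simp add: pos_le_divide_eq)
      then show ?thesis using r0 by (simp add: algebra_simps)
    qed
    finally show ?thesis using f by (simp add: algebra_simps)
  qed
  have inball: "nrm (iter M0 n z - M0) \<le> R \<and> frob N (iter M0 n z - M0) \<le> \<epsilon>" if z: "dist z z0 < r" "0 < Im z" for z n
  proof (induction n)
    case 0 then show ?case using nrm0 R0 frob0 by simp
  next
    case (Suc n)
    then show ?case using ball[OF z iter_carrier[OF M0c(1)] iter_psd[OF M0c z(2)]] by simp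
  qed
  have dec: "nrm (iter M0 (Suc n) z - iter M0 n z) \<le> q' ^ n * R" if z: "dist z z0 < r" "0 < Im z" for z n
  proof (induction n)
    case 0 then show ?case using inball[OF z, of 1] by simp
  next
    case (Suc n)
    note ic = iter_carrier[OF M0c(1)] and ip = iter_psd[OF M0c z(2)]
    have "nrm (iter M0 (Suc (Suc n)) z - iter M0 (Suc n) z) \<le> q' * nrm (iter M0 (Suc n) z - iter M0 n z) + c1 * cmod (z - z)"
    proof (rule step[OF ic ic ic ic])
      show "G z (iter M0 (Suc n) z) * iter M0 (Suc (Suc n)) z = (-1) \<cdot>\<^sub>m 1\<^sub>m N"
        using Phi_props(2)[OF ic ip z(2), of "Suc n"] by simp
      show "G z (iter M0 n z) * iter M0 (Suc n) z = (-1) \<cdot>\<^sub>m 1\<^sub>m N"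
        using Phi_props(2)[OF ic ip z(2), of n] by simp
    qed (use inball[OF z] in blast)+
    also have "\<dots> \<le> q' * (q' ^ n * R)" using Suc q' by (simp add: mult_left_mono del: iter.simps)
    finally show ?case by (simp add: mult.assoc)
  qed
  show ?thesis
  proof (rule that[OF r0 q'])
    fix z n assume z: "dist z z0 < r" "0 < Im z"
    have "frob N (iter M0 (Suc n) z - iter M0 n z) \<le> k2 * nrm (iter M0 (Suc n) z - iter M0 n z)"
      using iter_carrier[OF M0c(1)] by (intro hi) (simp add: minus_carrier_mat del: iter.simps)
    also have "\<dots> \<le> k2 * (q' ^ n * R)" using dec[OF z] k by (intro mult_left_mono) auto
    finally show "frob N (iter M0 (Suc n) z - iter M0 n z) \<le> (k2 * R) * q' ^ n" by (simp add: mult_ac)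
  qed
qed
end

lemma open_upper_half_plane: "open upper_half_plane" 
  and connected_upper_half_plane: "connected upper_half_plane"
proof -
  have e: "upper_half_plane = {z. Im z > 0}" by (auto simp: upper_half_plane_def)
  show "open upper_half_plane" unfolding e by (rule open_halfspace_Im_gt)
  show "connected upper_half_plane" unfolding e by (intro convex_connected convex_halfspace_Im_gt)
qed

context flat_self_energy
begin

lemma psd_limit:
  assumes X: "\<And>k. X k \<in> carrier_mat N N" "\<And>k. psd N (im_mat (X k))" and L: "L \<in> carrier_mat N N"
    and lim: "\<And>i j. i < N \<Longrightarrow> j < N \<Longrightarrow> (\<lambda>k. X k $$ (i,j)) \<longlonglongrightarrow> L $$ (i,j)"
  shows "psd N (im_mat L)"
proof -
  have "0 \<le> quad_form (im_mat L) v" if v: "v \<in> carrier_vec N" for v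
  proof (rule LIMSEQ_le_const)
    have e: "quad_form (im_mat A) v = Im (\<Sum>i<N. (\<Sum>j<N. A $$ (i,j) * v $ j) * cnj (v $ i))" if "A \<in> carrier_mat N N" for A
      unfolding quad_form_im_mat(1)[OF that v] using that v
      by (subst cinner_sum[of _ N]) (auto simp: scalar_prod_def atLeast0LessThan)
    show "(\<lambda>k. quad_form (im_mat (X k)) v) \<longlonglongrightarrow> quad_form (im_mat L) v"
      unfolding e[OF X(1)] e[OF L] by (intro tendsto_intros lim) auto
    show "\<exists>k0. \<forall>k\<ge>k0. 0 \<le> quad_form (im_mat (X k)) v" using X(2) v by (auto simp: psd_iff)
  qed
  then show ?thesis using re_im_mat(2)[OF L] by (simp add: psd_iff)
qed

text \<open>Every solution at one point extends to an analytic solution on the half-plane: the fixed point iterates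
  started from it form a normal family, and a limit solves the equation where the iteration contracts,
  hence everywhere by the identity theorem.\<close>
lemma analytic_solution_through:
  assumes z0: "0 < Im z0" and M0: "mde_solution N S z0 M0"
  obtains L where "\<And>z. z \<in> upper_half_plane \<Longrightarrow> mde_solution N S z (L z)"
    "\<And>i j. i < N \<Longrightarrow> j < N \<Longrightarrow> (\<lambda>z. L z $$ (i,j)) holomorphic_on upper_half_plane" "L z0 = M0"
proof -
  let ?H = upper_half_plane
  note M0c = mde_im_psd[OF M0]
  have GM0: "G z0 M0 * M0 = (-1) \<cdot>\<^sub>m 1\<^sub>m N" using M0 mde_iff[OF M0c(1)] by simp
  note ic = iter_carrier[OF M0c(1)]
  define I where "I = {..<N} \<times> {..<N}"
  have bd: "\<exists>B. \<forall>n. \<forall>z\<in>K. cmod (iter M0 n z $$ p) \<le> B" if p: "p \<in> I" and K: "compact K" "K \<subseteq> ?H" for p K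
  proof (cases "K = {}")
    case False
    obtain w where w: "w \<in> K" "\<And>z. z \<in> K \<Longrightarrow> Im w \<le> Im z"
      using continuous_attains_inf[OF K(1) False, of Im] continuous_on_Im[OF continuous_on_id] by auto
    have Iw: "0 < Im w" using w K by (auto simp: upper_half_plane_def)
    have "cmod (iter M0 n z $$ p) \<le> frob N M0 + N / Im w" if z: "z \<in> K" for n z
    proof -
      have Iz: "0 < Im z" using Iw w(2)[OF z] by linarith
      have "cmod (iter M0 n z $$ p) \<le> frob N (iter M0 n z)" using frob_entry_le[of "fst p" N "snd p"] p by (auto simp: I_def)
      also have "\<dots> \<le> frob N M0 + N / Im z" by (rule iter_frob[OF M0c Iz])
      also have "N / Im z \<le> N / Im w" using w(2)[OF z] Iw by (intro divide_left_mono) auto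
      finally show ?thesis by simp
    qed
    then show ?thesis by blast
  qed simp
  have fin: "finite I" by (simp add: I_def)
  have hol: "(\<lambda>z. iter M0 n z $$ p) holomorphic_on ?H" if "p \<in> I" for p n
    using iter_holomorphic[OF M0c, of "fst p" "snd p" n] that by (auto simp: I_def)
  obtain r g where r: "strict_mono (r :: nat \<Rightarrow> nat)"
    and g: "\<And>p. p \<in> I \<Longrightarrow> g p holomorphic_on ?H" "\<And>p z. p \<in> I \<Longrightarrow> z \<in> ?H \<Longrightarrow> (\<lambda>n. iter M0 (r n) z $$ p) \<longlonglongrightarrow> g p z"
    using Montel_finite_family[where F = "\<lambda>p n z. iter M0 n z $$ p", OF fin open_upper_half_plane hol bd] by blast
  define L where "L z = mat N N (\<lambda>p. g p z)" for z
  have Lc: "L z \<in> carrier_mat N N" for z by (simp add: L_def)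
  have lim: "(\<lambda>n. iter M0 (r n) z $$ (i,j)) \<longlonglongrightarrow> L z $$ (i,j)" if "z \<in> ?H" "i < N" "j < N" for z i j
    using g(2)[of "(i,j)" z] that by (simp add: L_def I_def)
  have Lhol: "(\<lambda>z. L z $$ (i,j)) holomorphic_on ?H" if "i < N" "j < N" for i j
    using g(1)[of "(i,j)"] that by (simp add: L_def I_def)
  have Lpsd: "psd N (im_mat (L z))" if z: "z \<in> ?H" for z
    by (rule psd_limit[OF ic iter_psd[OF M0c] Lc lim[OF z]]) (use z in \<open>auto simp: upper_half_plane_def\<close>)
  obtain d K q where d: "0 < d" and q: "0 \<le> q" "q < 1"
    and cauchy: "\<And>z n. dist z z0 < d \<Longrightarrow> 0 < Im z \<Longrightarrow> frob N (iter M0 (Suc n) z - iter M0 n z) \<le> K * q ^ n"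
    using local_contraction[OF z0 M0] by metis
  have entry: "(G z (L z) * L z) $$ (i,j) = (\<Sum>k<N. G z (L z) $$ (i,k) * L z $$ (k,j))" if "i < N" "j < N" for z i j
    using that Lc[of z] G_carrier[OF Lc[of z], of z] by (auto simp: scalar_prod_def atLeast0LessThan)
  have near: "(\<Sum>k<N. G z (L z) $$ (i,k) * L z $$ (k,j)) = (if i = j then -1 else 0)"
    if z: "z \<in> ball z0 d \<inter> ?H" and ij: "i < N" "j < N" for z i j
  proof -
    have zH: "z \<in> ?H" "0 < Im z" "dist z z0 < d" using z by (auto simp: upper_half_plane_def dist_commute)
    \<comment> \<open>Consecutive iterates approach each other, so the shifted subsequence has the same limit and the limit is a fixed point.\<close>
    have lim2: "(\<lambda>n. iter M0 (Suc (r n)) z $$ (k,l)) \<longlonglongrightarrow> L z $$ (k,l)" if kl: "k < N" "l < N" for k l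
    proof -
      have "(\<lambda>n. iter M0 (Suc (r n)) z $$ (k,l) - iter M0 (r n) z $$ (k,l)) \<longlonglongrightarrow> 0"
      proof (rule Lim_null_comparison)
        show "\<forall>\<^sub>F n in sequentially. cmod (iter M0 (Suc (r n)) z $$ (k,l) - iter M0 (r n) z $$ (k,l)) \<le> K * q ^ r n"
        proof (rule always_eventually, rule allI)
          fix n
          have "cmod (iter M0 (Suc (r n)) z $$ (k,l) - iter M0 (r n) z $$ (k,l)) = cmod ((iter M0 (Suc (r n)) z - iter M0 (r n) z) $$ (k,l))"
            unfolding mat_minus_index[OF ic ic kl] ..
          also have "\<dots> \<le> K * q ^ r n" using frob_entry_le[OF kl] cauchy[OF zH(3,2)] order_trans by blast
          finally show "cmod (iter M0 (Suc (r n)) z $$ (k,l) - iter M0 (r n) z $$ (k,l)) \<le> K * q ^ r n" .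
        qed
        have "(\<lambda>n. q ^ n) \<longlonglongrightarrow> 0" using q by (intro LIMSEQ_power_zero) auto
        from tendsto_mult_right_zero[OF LIMSEQ_subseq_LIMSEQ[OF this r], of K]
        show "(\<lambda>n. K * q ^ r n) \<longlonglongrightarrow> 0" by (simp add: o_def)
      qed
      from tendsto_add[OF this lim[OF zH(1) kl]] show ?thesis by simp
    qed
    have Gl: "(\<lambda>n. G z (iter M0 (r n) z) $$ (i,k)) \<longlonglongrightarrow> G z (L z) $$ (i,k)" if k: "k < N" for k
      unfolding G_entry[OF ic ij(1) k] G_entry[OF Lc ij(1) k]
      by (intro tendsto_add tendsto_const S_entry_tendsto ic Lc lim[OF zH(1)] ij k)
    have "(\<lambda>n. \<Sum>k<N. G z (iter M0 (r n) z) $$ (i,k) * iter M0 (Suc (r n)) z $$ (k,j)) \<longlonglongrightarrow> (\<Sum>k<N. G z (L z) $$ (i,k) * L z $$ (k,j))"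
      by (intro tendsto_sum tendsto_mult Gl lim2 ij) auto
    moreover have "(\<Sum>k<N. G z (iter M0 (r n) z) $$ (i,k) * iter M0 (Suc (r n)) z $$ (k,j)) = (if i = j then -1 else 0)" for n
    proof -
      have "(\<Sum>k<N. G z (iter M0 (r n) z) $$ (i,k) * iter M0 (Suc (r n)) z $$ (k,j)) = (G z (iter M0 (r n) z) * iter M0 (Suc (r n)) z) $$ (i,j)"
        using ij carrier_matD[OF ic[of "Suc (r n)" z]] carrier_matD[OF G_carrier[OF ic[of "r n" z], of z]]
        by (auto simp: scalar_prod_def atLeast0LessThan simp del: iter.simps)
      then show ?thesis using Phi_props(2)[OF ic iter_psd[OF M0c zH(2)] zH(2)] ij by simp
    qed
    ultimately show ?thesis by (simp add: LIMSEQ_const_iff)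
  qed
  have all: "(\<Sum>k<N. G z (L z) $$ (i,k) * L z $$ (k,j)) = (if i = j then -1 else 0)" if z: "z \<in> ?H" and ij: "i < N" "j < N" for z i j
  proof -
    have hol: "(\<lambda>z. \<Sum>k<N. G z (L z) $$ (i,k) * L z $$ (k,j)) holomorphic_on ?H"
      by (intro holomorphic_on_sum holomorphic_on_mult G_entry_holomorphic[OF Lc] Lhol ij) auto
    have "z0 \<in> ball z0 d \<inter> ?H" using z0 d by (simp add: upper_half_plane_def)
    then have ne: "ball z0 d \<inter> ?H \<noteq> {}" by blast
    have op: "open (ball z0 d \<inter> ?H)" using open_upper_half_plane by auto
    show ?thesis
      by (rule analytic_continuation_open[OF op open_upper_half_plane ne connected_upper_half_plane _ hol
            holomorphic_on_const[of "if i = j then -1 else 0"] near[OF _ ij] z]) auto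
  qed
  have "mde_solution N S z (L z)" if z: "z \<in> ?H" for z
  proof (rule mdeI[OF Lc Lpsd[OF z]])
    have g: "G z (L z) * L z \<in> carrier_mat N N" by (rule mult_carrier_mat[OF G_carrier[OF Lc] Lc])
    show "G z (L z) * L z = (-1) \<cdot>\<^sub>m 1\<^sub>m N"
      using all[OF z] entry carrier_matD[OF G_carrier[OF Lc]] carrier_matD[OF Lc] by (intro eq_matI) (auto simp del: index_mult_mat(1))
  qed (use z in \<open>simp add: upper_half_plane_def\<close>)
  moreover have "L z0 = M0"
  proof -
    have fix0: "Phi z0 M0 = M0"
    proof -
      note P = Phi_props[OF M0c z0]
      have z: "(z0 - z0) \<cdot>\<^sub>m 1\<^sub>m N + S (M0 - M0) = 0\<^sub>m N N"
      proof -
        have "M0 - M0 = 0\<^sub>m N N" using M0c(1) by (intro eq_matI) auto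
        then show ?thesis using linear_op_zero[OF lin] by (auto intro!: eq_matI)
      qed
      have "Phi z0 M0 - M0 = Phi z0 M0 * 0\<^sub>m N N * M0"
        using inverse_difference[OF M0c(1) M0c(1) P(1) M0c(1) P(2) GM0] unfolding z .
      also have "\<dots> = 0\<^sub>m N N" using P(1) M0c(1) by simp
      finally have "(Phi z0 M0 - M0) $$ (i,j) = 0" if "i < N" "j < N" for i j using that by simp
      then show ?thesis using mat_minus_index[OF P(1) M0c(1)] P(1) M0c(1) by (intro eq_matI) auto
    qed
    have it: "iter M0 n z0 = M0" for n by (induction n) (simp_all add: fix0)
    have z0H: "z0 \<in> ?H" using z0 by (simp add: upper_half_plane_def)
    have "L z0 $$ (i,j) = M0 $$ (i,j)" if "i < N" "j < N" for i j
      using lim[OF z0H that] unfolding it by (simp add: LIMSEQ_const_iff)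
    then show ?thesis using Lc[of z0] M0c(1) by (intro eq_matI) auto
  qed
  ultimately show ?thesis using that Lhol by blast
qed

text \<open>For large \<open>Im z\<close> solutions are small, and the difference of two of them is fixed by the contraction
  \<open>X \<mapsto> M1 S[X] M2\<close>. How large \<open>Im z\<close> has to be may depend on \<open>N\<close>.\<close>
lemma mde_unique_far:
  obtains Y where "\<And>z M1 M2. Y < Im z \<Longrightarrow> 0 < Im z \<Longrightarrow> mde_solution N S z M1 \<Longrightarrow> mde_solution N S z M2 \<Longrightarrow> M1 = M2"
proof -
  obtain s where s: "0 \<le> s" and Sb: "\<And>X. X \<in> carrier_mat N N \<Longrightarrow> frob N (S X) \<le> s * frob N X"
    using linear_op_bounded[OF lin] by metis
  have "M1 = M2" if z: "sqrt (N * N * s) < Im z" "0 < Im z" and M: "mde_solution N S z M1" "mde_solution N S z M2" for z M1 M2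
  proof -
    note c1 = mde_im_psd[OF M(1)] and c2 = mde_im_psd[OF M(2)]
    have I: "G z M1 * M1 = (-1) \<cdot>\<^sub>m 1\<^sub>m N" "G z M2 * M2 = (-1) \<cdot>\<^sub>m 1\<^sub>m N" using M mde_iff c1 c2 by auto
    have f: "frob N M1 \<le> N * (1 / Im z)" "frob N M2 \<le> N * (1 / Im z)"
      using frob_le_of_vnorm_bound[OF c1(1) _ inverse_bound[OF c1 c1(1) I(1) z(2)]]
        frob_le_of_vnorm_bound[OF c2(1) _ inverse_bound[OF c2 c2(1) I(2) z(2)]] z by auto
    define D where "D = M1 - M2"
    have Dc: "D \<in> carrier_mat N N" using c1 c2 by (simp add: D_def minus_carrier_mat)
    have SD: "S D \<in> carrier_mat N N" using S_carrier[OF Dc] .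
    have "(z - z) \<cdot>\<^sub>m 1\<^sub>m N + S D = S D" using SD by (intro eq_matI) auto
    then have "D = M1 * S D * M2"
      using inverse_difference[OF c1(1) c2(1) c1(1) c2(1) I] by (simp add: D_def)
    then have "frob N D \<le> frob N M1 * frob N (S D) * frob N M2" using frob_triple[OF c1(1) SD c2(1)] by simp
    also have "\<dots> \<le> (N * (1 / Im z)) * (s * frob N D) * (N * (1 / Im z))"
      using f Sb[OF Dc] s z by (intro mult_mono) auto
    also have "\<dots> = (N * N * s / (Im z)\<^sup>2) * frob N D" by (simp add: power2_eq_square)
    finally have le: "frob N D \<le> (N * N * s / (Im z)\<^sup>2) * frob N D" .
    have "(sqrt (N * N * s))\<^sup>2 < (Im z)\<^sup>2" using z s by (intro power_strict_mono) auto
    then have lt: "N * N * s / (Im z)\<^sup>2 < 1" using s z by simp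
    have "frob N D = 0"
    proof (rule ccontr)
      assume "frob N D \<noteq> 0"
      then have "0 < frob N D" using frob_nonneg[of N D] by linarith
      then have "(N * N * s / (Im z)\<^sup>2) * frob N D < 1 * frob N D" using lt by (intro mult_strict_right_mono)
      then show False using le by simp
    qed
    then have "D = 0\<^sub>m N N" using frob_eq_0[OF Dc] by simp
    then have "D $$ (i,j) = 0" if "i < N" "j < N" for i j using that by simp
    then show ?thesis using mat_minus_index[OF c1(1) c2(1)] c1(1) c2(1) by (intro eq_matI) (auto simp: D_def)
  qed
  then show ?thesis using that by blast
qed

text \<open>The analytic solutions through \<open>M \<i>\<close> and through \<open>M z\<close> agree where the solution is unique, hence everywhere, and
  in particular at \<open>z\<close>. So \<open>M\<close> is the analytic solution through \<open>M \<i>\<close>.\<close>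
lemma solution_holomorphic:
  fixes M :: "complex \<Rightarrow> complex mat"
  assumes M: "\<And>z. z \<in> upper_half_plane \<Longrightarrow> mde_solution N S z (M z)" and ij: "i < N" "j < N"
  shows "(\<lambda>z. M z $$ (i,j)) holomorphic_on upper_half_plane"
proof -
  let ?H = upper_half_plane
  obtain Y where Y: "\<And>z M1 M2. Y < Im z \<Longrightarrow> 0 < Im z \<Longrightarrow> mde_solution N S z M1 \<Longrightarrow> mde_solution N S z M2 \<Longrightarrow> M1 = M2"
    using mde_unique_far by blast
  define U where "U = {z. max Y 0 < Im z}"
  have U: "open U" "U \<noteq> {}" "U \<subseteq> ?H"
    unfolding U_def using open_halfspace_Im_gt[of "max Y 0"]
    by (auto simp: upper_half_plane_def intro: exI[of _ "Complex 0 (max Y 0 + 1)"])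
  have i: "\<i> \<in> ?H" "0 < Im \<i>" by (simp_all add: upper_half_plane_def)
  obtain L where L: "\<And>z. z \<in> ?H \<Longrightarrow> mde_solution N S z (L z)"
    "\<And>i j. i < N \<Longrightarrow> j < N \<Longrightarrow> (\<lambda>z. L z $$ (i,j)) holomorphic_on ?H" "L \<i> = M \<i>"
    by (rule analytic_solution_through[OF i(2) M[OF i(1)]]) (rule that)
  have "M z = L z" if z: "z \<in> ?H" for z
  proof -
    obtain L' where L': "\<And>w. w \<in> ?H \<Longrightarrow> mde_solution N S w (L' w)"
      "\<And>i j. i < N \<Longrightarrow> j < N \<Longrightarrow> (\<lambda>w. L' w $$ (i,j)) holomorphic_on ?H" "L' z = M z"
      using analytic_solution_through[of z "M z"] M[OF z] z by (auto simp: upper_half_plane_def)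
    have "L' z $$ (k,l) = L z $$ (k,l)" if kl: "k < N" "l < N" for k l
    proof (rule analytic_continuation_open[OF U(1) open_upper_half_plane U(2) connected_upper_half_plane U(3) L'(2)[OF kl] L(2)[OF kl] _ z])
      fix w assume w: "w \<in> U"
      have "L' w = L w" by (rule Y[OF _ _ L'(1) L(1)]) (use w U(3) in \<open>auto simp: U_def\<close>)
      then show "L' w $$ (k,l) = L w $$ (k,l)" by simp
    qed
    then have "L' z = L z" using mde_im_psd(1)[OF L(1)[OF z]] mde_im_psd(1)[OF L'(1)[OF z]] by (intro eq_matI) auto
    then show ?thesis using L'(3) by simp
  qed
  then show ?thesis using L(2)[OF ij] by (simp cong: holomorphic_cong)
qed

end

section \<open>Analytic continuation across a spectral gap\<close>

text \<open>This is the Schwarz--Pick inequality up to the factor 2, which is lost by applying the Schwarz lemma to the disc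
  of radius \<open>Im z\<close> around \<open>z\<close> in place of the half-plane.\<close>
lemma nevanlinna_deriv_bound:
  assumes f: "f holomorphic_on upper_half_plane" and pos: "\<And>z. z \<in> upper_half_plane \<Longrightarrow> 0 < Im (f z)"
    and z: "z \<in> upper_half_plane"
  shows "cmod (deriv f z) \<le> 2 * Im (f z) / Im z"
proof -
  define y where "y = Im z"
  have y: "0 < y" using z by (simp add: y_def upper_half_plane_def)
  define a where "a = f z"
  have a: "0 < Im a" using pos[OF z] by (simp add: a_def)
  define g where "g w = z + complex_of_real y * w" for w
  define h where "h w = (f (g w) - a) / (f (g w) - cnj a)" for w
  have gH: "g w \<in> upper_half_plane" if "cmod w < 1" for w
  proof -
    have "\<bar>Im w\<bar> < 1" using that abs_Im_le_cmod[of w] by linarith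
    then have "0 < y * (1 + Im w)" using y by (intro mult_pos_pos) auto
    then show ?thesis by (simp add: g_def upper_half_plane_def y_def[symmetric] algebra_simps)
  qed
  have nz: "f (g w) - cnj a \<noteq> 0" if "cmod w < 1" for w
  proof -
    have "0 < Im (f (g w) - cnj a)" using pos[OF gH[OF that]] a by simp
    then show ?thesis by (metis less_irrefl zero_complex.sel(2))
  qed
  have hg: "g holomorphic_on ball 0 1" unfolding g_def by (intro holomorphic_intros)
  have hfg: "(\<lambda>w. f (g w)) holomorphic_on ball 0 1"
  proof -
    have "g ` ball 0 1 \<subseteq> upper_half_plane" using gH by auto
    from holomorphic_on_compose_gen[OF hg f this] show ?thesis by (simp add: o_def)
  qed
  have hh: "h holomorphic_on ball 0 1" unfolding h_def using hfg nz by (intro holomorphic_intros) auto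
  have h0: "h 0 = 0" by (simp add: h_def g_def a_def)
  have h1: "cmod (h w) < 1" if w: "cmod w < 1" for w
  proof -
    define b where "b = f (g w)"
    have b: "0 < Im b" using pos[OF gH[OF w]] by (simp add: b_def)
    have "0 < Im b * Im a" using a b by simp
    then have "(Im b - Im a)\<^sup>2 < (Im b + Im a)\<^sup>2" by (simp add: power2_eq_square algebra_simps)
    then have "(cmod (b - a))\<^sup>2 < (cmod (b - cnj a))\<^sup>2" by (simp add: cmod_power2)
    then have "cmod (b - a) < cmod (b - cnj a)" by (rule power2_less_imp_less) simp
    then show ?thesis using nz[OF w] by (simp add: h_def b_def[symmetric] norm_divide)
  qed
  have d1: "cmod (deriv h 0) \<le> 1" by (rule Schwarz_Lemma(2)[OF hh h0 h1, of 0]) auto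
  have fd: "(f has_field_derivative deriv f z) (at z)"
    using f z open_upper_half_plane holomorphic_derivI by blast
  have "(g has_field_derivative complex_of_real y) (at 0)" unfolding g_def by (auto intro!: derivative_eq_intros)
  moreover have "(f has_field_derivative deriv f z) (at (g 0))" using fd by (simp add: g_def)
  ultimately have dfg: "((\<lambda>w. f (g w)) has_field_derivative deriv f z * complex_of_real y) (at 0)"
    by (rule DERIV_chain2[rotated])
  have ne: "a - cnj a \<noteq> 0" using nz[of 0] by (simp add: g_def a_def)
  have "(h has_field_derivative deriv f z * complex_of_real y / (a - cnj a)) (at 0)"
  proof -
    have fg0: "f (g 0) = a" by (simp add: g_def a_def)
    have "((\<lambda>w. (f (g w) - a) / (f (g w) - cnj a)) has_field_derivative
      ((deriv f z * complex_of_real y - 0) * (f (g 0) - cnj a) - (f (g 0) - a) * (deriv f z * complex_of_real y - 0)) / ((f (g 0) - cnj a) * (f (g 0) - cnj a))) (at 0)"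
      using ne fg0 by (intro DERIV_divide DERIV_diff dfg DERIV_const) auto
    then show ?thesis unfolding h_def fg0 using ne by simp
  qed
  then have "deriv h 0 = deriv f z * complex_of_real y / (a - cnj a)" by (rule DERIV_imp_deriv)
  moreover have "cmod (a - cnj a) = 2 * Im a"
  proof -
    have "a - cnj a = 2 * \<i> * complex_of_real (Im a)" by (simp add: complex_eq_iff)
    then show ?thesis using a by (simp add: norm_mult)
  qed
  ultimately have "cmod (deriv f z) * y / (2 * Im a) \<le> 1" using d1 y by (simp add: norm_divide norm_mult)
  then show ?thesis using a y by (simp add: a_def y_def field_simps)
qed

text \<open>Where \<open>Im f \<le> K Im z\<close> the function is Lipschitz, so it continues across the real segment by reflection.
  On a circle centred at a real point the crude bound \<open>A / |Im z|\<close> is compensated by the factor \<open>(z - x)\<^sup>2 - r\<^sup>2\<close>,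
  whose modulus there is \<open>2 r |Im z|\<close>, and the maximum principle carries the product inside.\<close>
lemma nevanlinna_gap_bound:
  assumes f: "f holomorphic_on upper_half_plane" and pos: "\<And>z. z \<in> upper_half_plane \<Longrightarrow> 0 < Im (f z)"
    and A: "0 \<le> A" "\<And>z. z \<in> upper_half_plane \<Longrightarrow> cmod (f z) \<le> A / Im z"
    and gap: "\<And>z. z \<in> upper_half_plane \<Longrightarrow> dist (complex_of_real x) z < R \<Longrightarrow> Im (f z) \<le> K * Im z"
    and r: "0 < r" "r < R" and y: "0 < y" "y < r"
  shows "cmod (f (Complex x y)) \<le> 2 * A / r"
proof -
  let ?H = upper_half_plane and ?x = "complex_of_real x"
  define D where "D = ball ?x R \<inter> ?H"
  have Hconv: "convex ?H" 
  proof -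
    have e: "upper_half_plane = {z. Im z > 0}" by (auto simp: upper_half_plane_def)
    show ?thesis unfolding e by (rule convex_halfspace_Im_gt)
  qed
  have Dconv: "convex D" unfolding D_def by (intro convex_Int convex_ball Hconv)
  have DH: "z \<in> ?H" "dist ?x z < R" "0 < Im z" if "z \<in> D" for z using that by (auto simp: D_def upper_half_plane_def)
  have lip: "cmod (f z - f w) \<le> (2 * K) * cmod (z - w)" if "z \<in> D" "w \<in> D" for z w
  proof (rule field_differentiable_bound[OF Dconv _ _ that])
    fix u assume u: "u \<in> D"
    show "(f has_field_derivative deriv f u) (at u within D)"
      using holomorphic_derivI[OF f open_upper_half_plane DH(1)[OF u]] by (rule has_field_derivative_at_within)
    have "cmod (deriv f u) \<le> 2 * Im (f u) / Im u" by (rule nevanlinna_deriv_bound[OF f pos DH(1)[OF u]])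
    also have "\<dots> \<le> 2 * (K * Im u) / Im u" using gap[OF DH(1,2)[OF u]] DH(3)[OF u] by (intro divide_right_mono) auto
    finally show "cmod (deriv f u) \<le> 2 * K" using DH(3)[OF u] by simp
  qed
  have uc: "uniformly_continuous_on D f"
    unfolding uniformly_continuous_on_def
  proof (intro allI impI)
    fix e :: real assume e: "0 < e"
    have K1: "0 < 2 * \<bar>K\<bar> + 1" by simp
    show "\<exists>d>0. \<forall>u\<in>D. \<forall>w\<in>D. dist w u < d \<longrightarrow> dist (f w) (f u) < e"
    proof (intro exI[of _ "e / (2 * \<bar>K\<bar> + 1)"] conjI ballI impI)
      show "0 < e / (2 * \<bar>K\<bar> + 1)" using e K1 by simp
      fix u w assume uw: "u \<in> D" "w \<in> D" "dist w u < e / (2 * \<bar>K\<bar> + 1)"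
      have "cmod (f w - f u) \<le> (2 * K) * cmod (w - u)" by (rule lip[OF uw(2,1)])
      also have "\<dots> \<le> (2 * \<bar>K\<bar> + 1) * cmod (w - u)" by (intro mult_right_mono) auto
      also have "\<dots> < e" using uw(3) K1 by (simp add: dist_norm field_simps)
      finally show "dist (f w) (f u) < e" by (simp add: dist_norm)
    qed
  qed
  obtain g where g: "uniformly_continuous_on (closure D) g" and fg: "\<And>z. z \<in> D \<Longrightarrow> f z = g z"
    using uniformly_continuous_on_extension_on_closure[OF uc] by metis
  have gcont: "continuous_on (closure D) g" by (rule uniformly_continuous_imp_continuous[OF g])
  have approach: "(\<lambda>n. z + \<i> * complex_of_real (1 / real (Suc n))) \<longlonglongrightarrow> z" for z
  proof -
    have "(\<lambda>n. 1 / real (Suc n)) \<longlonglongrightarrow> 0" using LIMSEQ_inverse_real_of_nat by (simp add: inverse_eq_divide)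
    from tendsto_add[OF tendsto_const tendsto_mult[OF tendsto_const tendsto_of_real[OF this]], of z \<i>]
    show ?thesis by simp
  qed
  have evD: "\<forall>\<^sub>F n in sequentially. z + \<i> * complex_of_real (1 / real (Suc n)) \<in> D"
    if z: "z \<in> ball ?x R" "0 \<le> Im z" for z
  proof -
    have "\<forall>\<^sub>F n in sequentially. z + \<i> * complex_of_real (1 / real (Suc n)) \<in> ball ?x R"
      using topological_tendstoD[OF approach open_ball z(1)] .
    then show ?thesis by eventually_elim (use z(2) in \<open>auto simp: D_def upper_half_plane_def add_nonneg_pos\<close>)
  qed
  have inD: "z \<in> closure D" if z: "z \<in> ball ?x R" "0 \<le> Im z" for z
  proof (rule Lim_in_closed_set[OF closed_closure _ sequentially_bot approach[of z]])
    show "\<forall>\<^sub>F n in sequentially. z + \<i> * complex_of_real (1 / real (Suc n)) \<in> closure D"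
      by (rule eventually_mono[OF evD[OF z]]) (use closure_subset[of D] in blast)
  qed
  have greal: "g z \<in> \<real>" if z: "z \<in> ball ?x R" "z \<in> \<real>" for z
  proof -
    have Iz: "Im z = 0" using z(2) by (simp add: complex_is_Real_iff)
    have zc: "z \<in> closure D" using inD z(1) Iz by simp
    let ?z = "\<lambda>n. z + \<i> * complex_of_real (1 / real (Suc n))"
    have ev: "\<forall>\<^sub>F n in sequentially. ?z n \<in> D" using evD z(1) Iz by simp
    have lg: "(\<lambda>n. g (?z n)) \<longlonglongrightarrow> g z"
    proof (rule continuous_on_tendsto_compose[OF gcont approach zc])
      show "\<forall>\<^sub>F n in sequentially. ?z n \<in> closure D"
        by (rule eventually_mono[OF ev]) (use closure_subset[of D] in blast)
    qed
    have "(\<lambda>n. Im (g (?z n))) \<longlonglongrightarrow> 0"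
    proof (rule Lim_null_comparison)
      show "\<forall>\<^sub>F n in sequentially. norm (Im (g (?z n))) \<le> K * (1 / real (Suc n))"
        using ev
      proof eventually_elim
        case (elim n)
        have "Im (g (?z n)) = Im (f (?z n))" using fg[OF elim] by simp
        moreover have "0 < Im (f (?z n))" using pos DH(1)[OF elim] by blast
        moreover have "Im (f (?z n)) \<le> K * Im (?z n)" using gap DH(1,2)[OF elim] by blast
        ultimately show ?case using Iz by simp
      qed
      show "(\<lambda>n. K * (1 / real (Suc n))) \<longlonglongrightarrow> 0"
        using tendsto_mult_right_zero[OF LIMSEQ_inverse_real_of_nat, of K] by (simp add: inverse_eq_divide)
    qed
    from LIMSEQ_unique[OF this tendsto_Im[OF lg]] show ?thesis by (simp add: complex_is_Real_iff)
  qed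
  define W where "W z = (if 0 \<le> Im z then g z else cnj (g (cnj z)))" for z
  have hW: "W holomorphic_on ball ?x R" unfolding W_def
  proof (rule Schwarz_reflection[OF open_ball])
    show "cnj ` ball ?x R \<subseteq> ball ?x R"
    proof
      fix w assume "w \<in> cnj ` ball ?x R"
      then obtain v where v: "w = cnj v" "v \<in> ball ?x R" by blast
      have "cmod (?x - cnj v) = cmod (cnj (?x - v))" by simp
      also have "\<dots> = cmod (?x - v)" by (rule complex_mod_cnj)
      finally show "w \<in> ball ?x R" using v by (simp add: dist_norm)
    qed
    have e: "ball ?x R \<inter> {z. 0 < Im z} = D" by (auto simp: D_def upper_half_plane_def)
    have "f holomorphic_on D" using f by (rule holomorphic_on_subset) (auto simp: D_def)
    then show "g holomorphic_on ball ?x R \<inter> {z. 0 < Im z}" unfolding e using fg by (simp cong: holomorphic_cong)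
    show "continuous_on (ball ?x R \<inter> {z. 0 \<le> Im z}) g" by (rule continuous_on_subset[OF gcont]) (use inD in auto)
  qed (use greal in auto)
  have Wb: "cmod (W z) \<le> A / \<bar>Im z\<bar>" if z: "z \<in> ball ?x R" "Im z \<noteq> 0" for z
  proof (cases "0 < Im z")
    case True
    then have zD: "z \<in> D" using z by (simp add: D_def upper_half_plane_def)
    then show ?thesis using True fg[OF zD] A(2)[OF DH(1)[OF zD]] by (simp add: W_def)
  next
    case False
    then have neg: "Im z < 0" using z by simp
    have "cmod (?x - cnj z) = cmod (cnj (?x - z))" by simp
    also have "\<dots> = cmod (?x - z)" by (rule complex_mod_cnj)
    finally have zD: "cnj z \<in> D" using z neg by (simp add: D_def upper_half_plane_def dist_norm)
    then show ?thesis using neg fg[OF zD] A(2)[OF DH(1)[OF zD]] by (simp add: W_def)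
  qed
  define h where "h z = W z * ((z - ?x)\<^sup>2 - complex_of_real (r\<^sup>2))" for z
  have hh: "h holomorphic_on ball ?x R" unfolding h_def by (intro holomorphic_intros hW)
  have sub: "cball ?x r \<subseteq> ball ?x R" using r by auto
  have "cmod (h (Complex x y)) \<le> 2 * A * r"
  proof (rule maximum_modulus_frontier[of h "ball ?x r"])
    show "h holomorphic_on interior (ball ?x r)" using hh by (rule holomorphic_on_subset) (use r in auto)
    show "continuous_on (closure (ball ?x r)) h"
      using holomorphic_on_imp_continuous_on[OF hh] by (rule continuous_on_subset) (use r sub in auto)
    show "Complex x y \<in> ball ?x r" using y by (simp add: dist_norm cmod_def)
    fix z assume "z \<in> frontier (ball ?x r)"
    then have zr: "cmod (z - ?x) = r" using r by (simp add: dist_norm norm_minus_commute)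
    define w where "w = z - ?x"
    have "w\<^sup>2 - complex_of_real (r\<^sup>2) = w * (w - cnj w)"
      using complex_norm_square[of w] zr by (simp add: w_def power2_eq_square algebra_simps)
    also have "w - cnj w = 2 * \<i> * complex_of_real (Im z)" by (simp add: w_def complex_eq_iff)
    finally have fac: "cmod ((z - ?x)\<^sup>2 - complex_of_real (r\<^sup>2)) = 2 * r * \<bar>Im z\<bar>"
      using zr by (simp add: w_def norm_mult)
    show "cmod (h z) \<le> 2 * A * r"
    proof (cases "Im z = 0")
      case True
      then show ?thesis using fac A r by (simp add: h_def norm_mult)
    next
      case False
      have zb: "z \<in> ball ?x R" using zr r by (simp add: dist_norm norm_minus_commute)
      have "cmod (h z) \<le> A / \<bar>Im z\<bar> * (2 * r * \<bar>Im z\<bar>)"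
        unfolding h_def norm_mult fac using Wb[OF zb False] r by (intro mult_right_mono) auto
      then show ?thesis using False by simp
    qed
  qed simp
  moreover have "h (Complex x y) = - f (Complex x y) * complex_of_real (y\<^sup>2 + r\<^sup>2)"
  proof -
    have zD: "Complex x y \<in> D" using y r by (simp add: D_def upper_half_plane_def dist_norm cmod_def)
    have "(Complex x y - ?x)\<^sup>2 = - complex_of_real (y\<^sup>2)" by (simp add: complex_eq_iff power2_eq_square)
    then show ?thesis using fg[OF zD] y by (simp add: h_def W_def algebra_simps)
  qed
  ultimately have "cmod (f (Complex x y)) * (y\<^sup>2 + r\<^sup>2) \<le> 2 * A * r" by (simp add: norm_mult del: of_real_add of_real_power)
  moreover have "cmod (f (Complex x y)) * r\<^sup>2 \<le> cmod (f (Complex x y)) * (y\<^sup>2 + r\<^sup>2)" by (intro mult_left_mono) auto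
  ultimately have "cmod (f (Complex x y)) * r * r \<le> 2 * A * r" by (simp add: power2_eq_square mult.assoc)
  then have "cmod (f (Complex x y)) * r \<le> 2 * A" using r by simp
  then show ?thesis using r by (simp add: field_simps)
qed

section \<open>The density of states away from its support\<close>

text \<open>By the Lindelof property the complement of the support is a countable union of open null sets.\<close>
lemma AE_measure_support:
  assumes "sets \<mu> = sets borel"
  shows "AE x in \<mu>. x \<in> measure_support \<mu>"
proof -
  define F where "F = {U :: real set. open U \<and> emeasure \<mu> U = 0}"
  obtain F' where F': "F' \<subseteq> F" "countable F'" "\<Union>F' = \<Union>F" using Lindelof[of F] by (auto simp: F_def)
  have "(\<Union>U\<in>F'. U) \<in> null_sets \<mu>"
    by (rule null_sets_UN'[OF F'(2)]) (use F'(1) assms in \<open>auto simp: F_def null_sets_def\<close>)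
  moreover have "- measure_support \<mu> \<subseteq> \<Union>F" by (auto simp: measure_support_def F_def)
  ultimately show ?thesis using F'(3) by (intro AE_I'[of "\<Union>F'"]) auto
qed

lemma stieltjes_im_bound:
  assumes rho: "real_distribution \<rho>" and z: "0 < Im z" and d: "0 < d"
    and dist: "\<And>t. t \<in> measure_support \<rho> \<Longrightarrow> d \<le> cmod (complex_of_real t - z)"
  shows "Im (\<integral>\<tau>. 1 / (complex_of_real \<tau> - z) \<partial>\<rho>) \<le> Im z / d\<^sup>2"
proof -
  interpret real_distribution \<rho> by (rule rho)
  have nz: "complex_of_real t - z \<noteq> 0" for t using z by (auto simp: complex_eq_iff)
  have bound: "cmod (1 / (complex_of_real t - z)) \<le> 1 / Im z" for t
  proof -
    have "Im z \<le> cmod (complex_of_real t - z)" using abs_Im_le_cmod[of "complex_of_real t - z"] by simp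
    then show ?thesis using z by (simp add: norm_divide frac_le)
  qed
  have meas: "(\<lambda>t. 1 / (complex_of_real t - z)) \<in> borel_measurable \<rho>" by measurable
  have int: "integrable \<rho> (\<lambda>t. 1 / (complex_of_real t - z))"
    by (rule integrable_const_bound[OF _ meas, of "1 / Im z"]) (use bound in auto)
  have "Im (\<integral>\<tau>. 1 / (complex_of_real \<tau> - z) \<partial>\<rho>) = (\<integral>\<tau>. Im (1 / (complex_of_real \<tau> - z)) \<partial>\<rho>)"
    by (rule integral_Im[OF int, symmetric])
  also have "\<dots> \<le> (\<integral>\<tau>. Im z / d\<^sup>2 \<partial>\<rho>)"
  proof (rule integral_mono_AE)
    show "integrable \<rho> (\<lambda>t. Im (1 / (complex_of_real t - z)))" by (rule integrable_Im[OF int])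
    show "AE t in \<rho>. Im (1 / (complex_of_real t - z)) \<le> Im z / d\<^sup>2"
      using AE_measure_support[OF events_eq_borel]
    proof eventually_elim
      case (elim t)
      have "Im (1 / (complex_of_real t - z)) = Im z / (cmod (complex_of_real t - z))\<^sup>2"
        by (simp add: Im_divide cmod_power2)
      also have "\<dots> \<le> Im z / d\<^sup>2" using dist[OF elim] d z
        by (intro divide_left_mono power_mono mult_pos_pos zero_less_power) auto
      finally show ?case .
    qed
  qed simp
  also have "\<dots> = Im z / d\<^sup>2" using prob_space by simp
  finally show ?thesis .
qed

section \<open>The quantitative stability bound\<close>

text \<open>Pairing \<open>P\<close> with \<open>v v\<^sup>* \<le> \<parallel>v\<parallel>\<^sup>2\<close> in the trace gives the claim.\<close>
lemma psd_quad_form_le_trace: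
  assumes P: "psd n P" and v: "v \<in> carrier_vec n"
  shows "quad_form P v \<le> Re (mat_trace P) * (vnorm v)\<^sup>2"
proof -
  have Pc: "P \<in> carrier_mat n n" using P psd_carrier by auto
  define V where "V = mat n n (\<lambda>(i,j). v $ i * cnj (v $ j))"
  have Vc: "V \<in> carrier_mat n n" by (simp add: V_def)
  have Vh: "herm_mat n V" unfolding herm_mat_def using Vc by (auto intro!: eq_matI simp: V_def)
  have Vq: "quad_form V w \<le> (vnorm v)\<^sup>2 * (vnorm w)\<^sup>2" if w: "w \<in> carrier_vec n" for w
  proof -
    have "V *\<^sub>v w = (w \<bullet>c v) \<cdot>\<^sub>v v"
      using v w by (intro eq_vecI) (auto simp: V_def cinner_sum[of _ n] scalar_prod_def atLeast0LessThan sum_distrib_right sum_distrib_left mult_ac)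
    then have "(V *\<^sub>v w) \<bullet>c w = (w \<bullet>c v) * (v \<bullet>c w)" using v w by (simp add: cinner_smult_left[of _ n])
    also have "v \<bullet>c w = cnj (w \<bullet>c v)" by (rule cinner_commute[OF v w])
    finally have "quad_form V w = (cmod (w \<bullet>c v))\<^sup>2"
      unfolding quad_form_def by (simp add: complex_norm_square[symmetric] del: of_real_power)
    also have "\<dots> \<le> (vnorm w * vnorm v)\<^sup>2" using cinner_le[OF w v] by (intro power_mono) auto
    finally show ?thesis by (simp add: power_mult_distrib mult.commute)
  qed
  have s: "herm_mat n (complex_of_real ((vnorm v)\<^sup>2) \<cdot>\<^sub>m 1\<^sub>m n)" by (intro herm_mat_smult herm_mat_one)
  have "psd n (complex_of_real ((vnorm v)\<^sup>2) \<cdot>\<^sub>m 1\<^sub>m n - V)"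
    by (rule psd_minus_iff[OF Vh s, THEN iffD2]) (use Vh s Vq in \<open>simp add: loewner_le_def quad_form_scalar del: of_real_power\<close>)
  then have "0 \<le> Re (hs_ip (complex_of_real ((vnorm v)\<^sup>2) \<cdot>\<^sub>m 1\<^sub>m n - V) P)" using hs_ip_psd_nonneg(1)[OF _ P] by blast
  also have "hs_ip (complex_of_real ((vnorm v)\<^sup>2) \<cdot>\<^sub>m 1\<^sub>m n - V) P = complex_of_real ((vnorm v)\<^sup>2) * mat_trace P - hs_ip V P"
  proof -
    have c: "complex_of_real ((vnorm v)\<^sup>2) \<cdot>\<^sub>m 1\<^sub>m n \<in> carrier_mat n n" by simp
    have "hs_ip (1\<^sub>m n) P = mat_trace P" using Pc by (simp add: hs_ip_def)
    then show ?thesis unfolding hs_ip_minus_left[OF c Vc Pc] hs_ip_smult_left[OF one_carrier_mat Pc] by simp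
  qed
  also have "Re \<dots> = (vnorm v)\<^sup>2 * Re (mat_trace P) - quad_form P v"
  proof -
    have "Re (hs_ip V P) = quad_form P v"
      unfolding hs_ip_sum[OF Vc Pc] quad_form_sum[OF Pc v] Re_sum
      by (intro sum.cong refl) (auto simp: V_def mult_ac)
    then show ?thesis by simp
  qed
  finally show ?thesis by (simp add: mult.commute)
qed

lemma inverse_power_le:
  fixes s s1 :: real
  assumes "0 < s" "s \<le> s1" "k \<le> n"
  shows "1 / s ^ k \<le> s1 ^ (n - k) / s ^ n"
proof -
  have "1 / s ^ k = s ^ (n - k) / s ^ n" using assms by (simp add: power_diff)
  also have "\<dots> \<le> s1 ^ (n - k) / s ^ n" using assms by (intro divide_right_mono power_mono) auto
  finally show ?thesis .
qed

context flat_self_energy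
begin

lemma stability_linear_diff:
  assumes M: "M \<in> carrier_mat N N" and R: "R1 \<in> carrier_mat N N" "R2 \<in> carrier_mat N N"
  shows "stability_op S M (R1 - R2) = stability_op S M R1 - stability_op S M R2"
proof -
  note SR = S_carrier[OF R(1)] S_carrier[OF R(2)]
  have "M * S (R1 - R2) * M = M * S R1 * M - M * S R2 * M"
    unfolding linear_op_minus[OF lin R] using M SR
    by (simp add: mult_minus_distrib_mat[of _ N N _ N] minus_mult_distrib_mat[of _ N N _ _ N])
  then show ?thesis unfolding stability_op_def using M R SR by (intro eq_matI) (auto simp del: index_mult_mat(1))
qed

lemma avg_im_trace:
  assumes M: "M \<in> carrier_mat N N"
  shows "Re (norm_trace N (im_mat M)) = Im (norm_trace N M)" "Re (mat_trace (im_mat M)) / N = Im (norm_trace N M)"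
proof -
  have aM: "mat_adjoint M \<in> carrier_mat N N" using M by simp
  have "mat_trace (im_mat M) = 1 / (2 * \<i>) * (mat_trace M - cnj (mat_trace M))"
    unfolding im_mat_def using mat_trace_smult[OF minus_carrier_mat[OF aM], of "1 / (2 * \<i>)" M] mat_trace_minus[OF M aM] mat_trace_adjoint[OF M] by simp
  also have "\<dots> = complex_of_real (Im (mat_trace M))" by (simp add: complex_eq_iff)
  finally have e: "mat_trace (im_mat M) = complex_of_real (Im (mat_trace M))" .
  show "Re (norm_trace N (im_mat M)) = Im (norm_trace N M)" "Re (mat_trace (im_mat M)) / N = Im (norm_trace N M)"
    unfolding norm_trace_def e by simp_all
qed

text \<open>The trace bounds \<open>Im \<langle>M(w) v, v\<rangle>\<close> by \<open>N \<langle>Im M(w)\<rangle> \<parallel>v\<parallel>\<^sup>2\<close>, and off the support this is at most a multiple of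
  \<open>Im w\<close>. The multiple depends on \<open>N\<close>, but it only serves to continue the function through the gap and does not
  enter the bound.\<close>
lemma solution_gap_bound:
  assumes M: "\<And>z. z \<in> upper_half_plane \<Longrightarrow> mde_solution N S z (M z)" and rho: "self_consistent_dos N M \<rho>"
    and z: "z \<in> upper_half_plane" and d: "d = infdist z (complex_of_real ` measure_support \<rho>)" "0 < d"
    and v: "v \<in> carrier_vec N"
  shows "vnorm (M z *\<^sub>v v) \<le> 16 / d * vnorm v"
proof (cases "d / 4 \<le> Im z")
  case True
  note Mc = mde_im_psd[OF M[OF z]]
  have I: "G z (M z) * M z = (-1) \<cdot>\<^sub>m 1\<^sub>m N" using M[OF z] mde_iff[OF Mc(1)] by simp
  have Iz: "0 < Im z" using z by (simp add: upper_half_plane_def)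
  have "vnorm (M z *\<^sub>v v) \<le> 1 / Im z * vnorm v" by (rule inverse_bound[OF Mc Mc(1) I Iz v])
  also have "\<dots> \<le> 16 / d * vnorm v" using True d Iz by (intro mult_right_mono) (auto simp: field_simps)
  finally show ?thesis .
next
  case False
  have Iz: "0 < Im z" using z by (simp add: upper_half_plane_def)
  \<comment> \<open>Now \<open>Im z < d / 4\<close>, so that points within \<open>d / 2\<close> of \<open>Re z\<close> keep the distance \<open>d / 4\<close> from the support. The gap
    bound is applied with the radii \<open>d / 4 < d / 2\<close> around \<open>Re z\<close>.\<close>
  have far: "d \<le> cmod (complex_of_real t - z)" if "t \<in> measure_support \<rho>" for t
    using infdist_le[of "complex_of_real t" "complex_of_real ` measure_support \<rho>" z] that unfolding d(1)
    by (simp add: dist_norm norm_minus_commute)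
  have avg: "Re (mat_trace (im_mat (M w))) / N \<le> Im w / (d / 4)\<^sup>2"
    if w: "w \<in> upper_half_plane" "dist (complex_of_real (Re z)) w < d / 2" for w
  proof -
    have Iw: "0 < Im w" using w by (simp add: upper_half_plane_def)
    have "d / 4 \<le> cmod (complex_of_real t - w)" if t: "t \<in> measure_support \<rho>" for t
    proof -
      have "cmod (complex_of_real t - z) \<le> cmod (complex_of_real t - w) + cmod (w - complex_of_real (Re z)) + cmod (complex_of_real (Re z) - z)"
        using norm_triangle_ineq[of "complex_of_real t - w" "w - complex_of_real (Re z)"] 
          norm_triangle_ineq[of "complex_of_real t - complex_of_real (Re z)" "complex_of_real (Re z) - z"] by simp
      moreover have "complex_of_real (Re z) - z = - \<i> * complex_of_real (Im z)" by (simp add: complex_eq_iff)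
      then have "cmod (complex_of_real (Re z) - z) = Im z" using Iz by (simp add: norm_mult)
      moreover have "cmod (w - complex_of_real (Re z)) < d / 2" using w(2) by (simp add: dist_norm norm_minus_commute)
      ultimately show ?thesis using far[OF t] False by linarith
    qed
    then have "Im (\<integral>\<tau>. 1 / (complex_of_real \<tau> - w) \<partial>\<rho>) \<le> Im w / (d / 4)\<^sup>2"
      using rho d(2) by (intro stieltjes_im_bound Iw) (auto simp: self_consistent_dos_def)
    then show ?thesis using rho w(1) avg_im_trace(2)[OF mde_im_psd(1)[OF M[OF w(1)]]] by (simp add: self_consistent_dos_def)
  qed
  have nr: "cmod ((M z *\<^sub>v u) \<bullet>c u) \<le> 8 / d * (vnorm u)\<^sup>2" if u: "u \<in> carrier_vec N" for u
  proof (cases "u = 0\<^sub>v N")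
    case True
    have "M z *\<^sub>v 0\<^sub>v N = 0\<^sub>v N" by (rule mult_mat_vec_zero[OF mde_im_psd(1)[OF M[OF z]]])
    then show ?thesis unfolding True by (simp add: cinner_sum[of _ N])
  next
    case False
    define f where "f w = (M w *\<^sub>v u) \<bullet>c u" for w
    have fe: "f w = (\<Sum>i<N. (\<Sum>j<N. M w $$ (i,j) * u $ j) * cnj (u $ i))" if "w \<in> upper_half_plane" for w
      unfolding f_def using mde_im_psd(1)[OF M[OF that]] u
      by (subst cinner_sum[of _ N]) (auto simp: scalar_prod_def atLeast0LessThan)
    have qf: "Im (f w) = quad_form (im_mat (M w)) u" if "w \<in> upper_half_plane" for w
      unfolding f_def using quad_form_im_mat(1)[OF mde_im_psd(1)[OF M[OF that]] u] by simp
    have "cmod (f (Complex (Re z) (Im z))) \<le> 2 * (vnorm u)\<^sup>2 / (d / 4)"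
    proof (rule nevanlinna_gap_bound[where R = "d / 2" and K = "N * (16 / d\<^sup>2) * (vnorm u)\<^sup>2"])
      have "(\<lambda>w. \<Sum>i<N. (\<Sum>j<N. M w $$ (i,j) * u $ j) * cnj (u $ i)) holomorphic_on upper_half_plane"
        by (intro holomorphic_on_sum holomorphic_on_mult holomorphic_on_const solution_holomorphic[OF M]) auto
      then show "f holomorphic_on upper_half_plane" using fe by (simp cong: holomorphic_cong)
      show "0 < Im (f w)" if "w \<in> upper_half_plane" for w
        unfolding qf[OF that] using M[OF that] u \<open>u \<noteq> 0\<^sub>v N\<close> by (fastforce simp: mde_solution_def loewner_less_def)
      show "cmod (f w) \<le> (vnorm u)\<^sup>2 / Im w" if w: "w \<in> upper_half_plane" for w
      proof -
        note Mc = mde_im_psd[OF M[OF w]]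
        have Iw: "0 < Im w" using w by (simp add: upper_half_plane_def)
        have I: "G w (M w) * M w = (-1) \<cdot>\<^sub>m 1\<^sub>m N" using M[OF w] mde_iff[OF Mc(1)] by simp
        have "cmod (f w) \<le> vnorm (M w *\<^sub>v u) * vnorm u" unfolding f_def using Mc(1) u by (intro cinner_le[of _ N]) auto
        also have "\<dots> \<le> (1 / Im w * vnorm u) * vnorm u" by (intro mult_right_mono inverse_bound[OF Mc Mc(1) I Iw u]) simp
        finally show ?thesis by (simp add: power2_eq_square)
      qed
      show "Im (f w) \<le> N * (16 / d\<^sup>2) * (vnorm u)\<^sup>2 * Im w"
        if w: "w \<in> upper_half_plane" "dist (complex_of_real (Re z)) w < d / 2" for w
      proof -
        have "Im (f w) \<le> Re (mat_trace (im_mat (M w))) * (vnorm u)\<^sup>2"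
          unfolding qf[OF w(1)] by (rule psd_quad_form_le_trace[OF mde_im_psd(2)[OF M[OF w(1)]] u])
        also have "\<dots> \<le> (N * (Im w / (d / 4)\<^sup>2)) * (vnorm u)\<^sup>2"
          using avg[OF w] N_pos by (intro mult_right_mono) (auto simp: field_simps)
        also have "\<dots> = N * (16 / d\<^sup>2) * (vnorm u)\<^sup>2 * Im w" by (simp add: power_divide)
        finally show ?thesis .
      qed
    qed (use d False Iz \<open>\<not> d / 4 \<le> Im z\<close> in auto)
    then show ?thesis by (simp add: f_def)
  qed
  have "vnorm (M z *\<^sub>v v) \<le> 2 * (8 / d * vnorm v)"
    by (rule numerical_radius_bound[OF mde_im_psd(1)[OF M[OF z]] nr v])
  then show ?thesis by simp
qed

end

context balanced_solution
begin

lemma stability_contraction_inverse_bound: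
  assumes R: "R \<in> carrier_mat N N"
  shows "frob N R \<le> (b_up / b_low) * (a_up / Im z) * frob N (stability_op S M R)"
proof -
  have "frob N R = (b_up / b_low) * (a_up / Im z) * (b_low / b_up * (Im z / a_up) * frob N R)"
    using b_pos z a_pos by simp
  also have "\<dots> \<le> (b_up / b_low) * (a_up / Im z) * frob N (stability_op S M R)"
    using stability_contraction_lower_bound[OF R] b_pos z a_pos by (intro mult_left_mono) auto
  finally show ?thesis .
qed

definition "gap = c * b_low\<^sup>2 * d_low ^ 4 / 8"

lemma gap_pos: "0 < gap" using c b_pos d_low_pos by (simp add: gap_def)

text \<open>For small \<open>Im z\<close> the spectral gap applies; for larger \<open>Im z\<close> the contraction rate \<open>Im z / a_up\<close> suffices.\<close>
lemma stability_rotation_inverse_bound: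
  assumes R: "R \<in> carrier_mat N N"
  shows "frob N R \<le> ((b_up / b_low) * (2 / gap) + (b_up / b_low) * (a_up * (2 * b_up / (gap * d_low)))) * frob N (stability_op S M R)"
proof -
  have nn: "0 \<le> (b_up / b_low) * (2 / gap)" "0 \<le> (b_up / b_low) * (a_up * (2 * b_up / (gap * d_low)))"
    using b_pos gap_pos a_pos d_low_pos by simp_all
  have "frob N R \<le> (b_up / b_low) * (2 / gap) * frob N (stability_op S M R)
     \<or> frob N R \<le> (b_up / b_low) * (a_up * (2 * b_up / (gap * d_low))) * frob N (stability_op S M R)"
  proof (cases "Im z * b_up / d_low \<le> gap / 2")
    case True
    have "b_low / b_up * (gap / 2) * frob N R \<le> frob N (stability_op S M R)"
    proof (rule stability_transfer[OF _ _ R])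
      fix X :: "complex mat" assume X: "X \<in> carrier_mat N N"
      have "gap / 2 * frob N X \<le> (gap - Im z * b_up / d_low) * frob N X" using True by (intro mult_right_mono) auto
      also have "\<dots> \<le> frob N (X - Umat * F X * Umat)" using F_gap[OF X] by (simp add: gap_def)
      finally show "gap / 2 * frob N X \<le> frob N (X - Umat * F X * Umat)" .
    qed (use gap_pos in simp)
    then have "(b_up / b_low) * (2 / gap) * (b_low / b_up * (gap / 2) * frob N R)
       \<le> (b_up / b_low) * (2 / gap) * frob N (stability_op S M R)"
      using b_pos gap_pos by (intro mult_left_mono) auto
    moreover have "(b_up / b_low) * (2 / gap) * (b_low / b_up * (gap / 2) * frob N R) = frob N R"
      using b_pos gap_pos by simp
    ultimately show ?thesis by simp
  next
    case False
    then have "gap * d_low / (2 * b_up) \<le> Im z" using b_pos d_low_pos by (simp add: field_simps)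
    then have "a_up / Im z \<le> a_up / (gap * d_low / (2 * b_up))"
      using b_pos d_low_pos gap_pos a_pos z by (intro divide_left_mono) auto
    then have "(b_up / b_low) * (a_up / Im z) * frob N (stability_op S M R)
       \<le> (b_up / b_low) * (a_up * (2 * b_up / (gap * d_low))) * frob N (stability_op S M R)"
      using b_pos by (intro mult_right_mono mult_left_mono) auto
    then show ?thesis using stability_contraction_inverse_bound[OF R] by linarith
  qed
  then show ?thesis
    using mult_nonneg_nonneg[OF nn(1) frob_nonneg[of N "stability_op S M R"]]
      mult_nonneg_nonneg[OF nn(2) frob_nonneg[of N "stability_op S M R"]] unfolding distrib_right by linarith
qed

end

context flat_self_energy
begin

lemma stability_inverse_bound:
  assumes M: "M \<in> carrier_mat N N" and Q: "0 \<le> Q"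
    and low: "\<And>R. R \<in> carrier_mat N N \<Longrightarrow> frob N R \<le> Q * frob N (stability_op S M R)"
    and surj: "\<And>Y. Y \<in> carrier_mat N N \<Longrightarrow> \<exists>R\<in>carrier_mat N N. stability_op S M R = Y"
  shows "bij_betw (stability_op S M) (carrier_mat N N) (carrier_mat N N)"
    and "sp_norm N (inv_into (carrier_mat N N) (stability_op S M)) \<le> Q"
proof -
  have maps: "stability_op S M R \<in> carrier_mat N N" if "R \<in> carrier_mat N N" for R
    unfolding stability_op_def by (intro minus_carrier_mat mult_carrier_mat[OF mult_carrier_mat[OF M S_carrier[OF that]] M])
  have inj: "inj_on (stability_op S M) (carrier_mat N N)"
  proof (rule inj_onI)
    fix X Y assume X: "X \<in> carrier_mat N N" and Y: "Y \<in> carrier_mat N N" and e: "stability_op S M X = stability_op S M Y"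
    have XY: "X - Y \<in> carrier_mat N N" using Y by (rule minus_carrier_mat)
    have f0: "frob N (0\<^sub>m N N) = 0" using frob_sq[of N "0\<^sub>m N N"] by simp
    have "stability_op S M (X - Y) = 0\<^sub>m N N"
      unfolding stability_linear_diff[OF M X Y] e using maps[OF Y] by simp
    then have "frob N (X - Y) \<le> 0" using low[OF XY] f0 by simp
    then have "frob N (X - Y) = 0" using frob_nonneg[of N "X - Y"] by linarith
    then have z: "X - Y = 0\<^sub>m N N" by (rule frob_eq_0[OF XY])
    show "X = Y"
    proof (rule eq_matI)
      fix i j assume ij: "i < dim_row Y" "j < dim_col Y"
      have "(X - Y) $$ (i,j) = 0" unfolding z using ij Y by simp
      then show "X $$ (i,j) = Y $$ (i,j)" using ij by simp
    qed (use X Y in auto)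
  qed
  show bij: "bij_betw (stability_op S M) (carrier_mat N N) (carrier_mat N N)"
    unfolding bij_betw_def using inj maps surj by (auto simp: image_iff)
  show "sp_norm N (inv_into (carrier_mat N N) (stability_op S M)) \<le> Q"
    unfolding sp_norm_def
  proof (rule cSUP_least)
    show "carrier_mat N N \<noteq> {}" using one_carrier_mat by blast
    fix Y :: "complex mat" assume Y: "Y \<in> carrier_mat N N"
    define R where "R = inv_into (carrier_mat N N) (stability_op S M) Y"
    have R: "R \<in> carrier_mat N N" unfolding R_def
      using bij Y by (simp add: bij_betw_def inv_into_into)
    have RY: "stability_op S M R = Y" unfolding R_def
      using bij Y by (simp add: bij_betw_def f_inv_into_f)
    have "frob N R \<le> Q * frob N Y" using low[OF R] RY by simp
    then have "hs_norm N R \<le> Q * hs_norm N Y"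
      unfolding hs_norm_frob[OF R] hs_norm_frob[OF Y] using N_pos by (simp add: divide_right_mono)
    moreover have "0 \<le> hs_norm N Y" unfolding hs_norm_frob[OF Y] by simp
    ultimately show "hs_norm N (inv_into (carrier_mat N N) (stability_op S M) Y) / hs_norm N Y \<le> Q"
      unfolding R_def[symmetric] using Q by (cases "hs_norm N Y = 0") (auto simp: pos_divide_le_eq)
  qed
qed

end

text \<open>The left side is \<open>b_up / b_low\<close> times \<open>a_up / Im z\<close> for the balanced frame with \<open>\<mu> = 16 / d\<close>, with \<open>m\<close> for \<open>inv_bound\<close>.\<close>
lemma gap_regime_estimate:
  fixes c :: real
  assumes c: "0 < c" "c \<le> C" and d: "0 < d" "d \<le> d1" and t: "\<tau> \<le> \<eta> / d\<^sup>2" "0 < \<eta>" and m: "0 < m" "m \<le> m1"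
  shows "(C / c * (16 / d)) / (c / (C * m)) * ((\<eta> + C * \<tau>) / \<eta>) \<le> 16 * C\<^sup>2 * m1 / c\<^sup>2 * (d1\<^sup>2 + C) * (1 / d ^ 3)"
proof -
  have C: "0 < C" using c by simp
  have "\<tau> / \<eta> \<le> 1 / d\<^sup>2" using t by (simp add: pos_divide_le_eq)
  then have "C * (\<tau> / \<eta>) \<le> C * (1 / d\<^sup>2)" using C by (intro mult_left_mono) auto
  moreover have "(\<eta> + C * \<tau>) / \<eta> = 1 + C * (\<tau> / \<eta>)" using t by (simp add: add_divide_distrib)
  moreover have "1 \<le> d1\<^sup>2 / d\<^sup>2" using d by (simp add: power_mono)
  ultimately have 1: "(\<eta> + C * \<tau>) / \<eta> \<le> (d1\<^sup>2 + C) / d\<^sup>2" by (simp add: add_divide_distrib)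
  have "(C / c * (16 / d)) / (c / (C * m)) * ((\<eta> + C * \<tau>) / \<eta>) = 16 * C\<^sup>2 * m / c\<^sup>2 / d * ((\<eta> + C * \<tau>) / \<eta>)"
    by (simp add: power2_eq_square mult_ac)
  also have "\<dots> \<le> 16 * C\<^sup>2 * m / c\<^sup>2 / d * ((d1\<^sup>2 + C) / d\<^sup>2)"
    using c C m d by (intro mult_left_mono[OF 1]) auto
  also have "\<dots> \<le> 16 * C\<^sup>2 * m1 / c\<^sup>2 / d * ((d1\<^sup>2 + C) / d\<^sup>2)"
    using c C m d by (intro mult_right_mono divide_right_mono mult_left_mono) auto
  also have "\<dots> = 16 * C\<^sup>2 * m1 / c\<^sup>2 * (d1\<^sup>2 + C) * (1 / d ^ 3)"
    by (simp add: power2_eq_square power3_eq_cube)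
  finally show ?thesis .
qed

text \<open>The variables stand for \<open>a_low\<close>, \<open>a_up\<close>, \<open>b_up\<close>, \<open>b_low\<close>, \<open>d_low\<close> and \<open>gap\<close> of the balanced frame with
  \<open>\<mu> = 1 / a_low\<close>, and \<open>m\<close> for \<open>inv_bound\<close>. In the second summand the \<open>a_up\<close> cancels against the \<open>a_low\<close> in \<open>b_up\<close>, so that large \<open>Im z\<close> does no harm.\<close>
lemma bulk_regime_estimate:
  fixes c :: real
  assumes c: "0 < c" "c \<le> C" and s: "0 < s" "c * s \<le> a" and a: "a' \<le> C / c * a" and m: "0 < m" "m \<le> m1"
    and bup: "bup = C / c * (1 / a)" and blow: "blow = c / (C * m)" and dl: "dl = a / m" and g: "g = c * blow\<^sup>2 * dl ^ 4 / 8"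
    and l: "l = c / (C * m1)" and g1: "g1 = c * l\<^sup>2 * (c / m1) ^ 4 / 8"
  shows "bup / blow * (2 / g) + bup / blow * (a' * (2 * bup / (g * dl)))
     \<le> (C / c\<^sup>2) / l * (2 / g1) * (1 / s ^ 5) + (C / c\<^sup>2) / l * (2 * (C\<^sup>2 / c\<^sup>2) / (g1 * (c / m1))) * (1 / s ^ 6)"
proof -
  have C: "0 < C" and m1: "0 < m1" using c m by auto
  have a0: "0 < a" using mult_pos_pos[OF c(1) s(1)] s(2) by linarith
  have l0: "0 < l" "l \<le> blow" using c C m m1 unfolding l blow by (auto intro!: divide_left_mono mult_left_mono)
  have dl0: "c * s / m1 \<le> dl" "0 < c * s / m1"
    using s m c m1 a0 unfolding dl by (auto intro!: frac_le)
  have g0: "g1 * s ^ 4 \<le> g" "0 < g1"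
  proof -
    have "c * l\<^sup>2 * (c * s / m1) ^ 4 / 8 \<le> c * blow\<^sup>2 * dl ^ 4 / 8"
      using c l0 dl0 by (intro divide_right_mono mult_mono power_mono) auto
    then show "g1 * s ^ 4 \<le> g" unfolding g g1 by (simp add: power_mult_distrib power_divide)
    show "0 < g1" using c l0 m1 unfolding g1 by simp
  qed
  have gs: "0 < g1 * s ^ 4" using g0 s by simp
  have g': "0 < g" using gs g0 by linarith
  have dl': "0 < dl" using dl0 by linarith
  have bu: "0 < bup" unfolding bup using C c a0 by simp
  have bl: "0 < blow" using l0 by simp
  have bs: "bup \<le> (C / c\<^sup>2) * (1 / s)"
  proof -
    have "1 / a \<le> 1 / (c * s)" using s c a0 by (intro divide_left_mono) auto
    then have "C / c * (1 / a) \<le> C / c * (1 / (c * s))" using C c by (intro mult_left_mono) auto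
    then show ?thesis unfolding bup by (simp add: power2_eq_square)
  qed
  have r: "bup / blow \<le> (C / c\<^sup>2) * (1 / s) / l" using bs bu l0 C c s by (intro frac_le) auto
  have ab: "a' * bup \<le> C\<^sup>2 / c\<^sup>2"
  proof -
    have "a' * bup \<le> (C / c * a) * bup" using a bu by (intro mult_right_mono) auto
    also have "\<dots> = C\<^sup>2 / c\<^sup>2" unfolding bup using a0 by (simp add: power2_eq_square)
    finally show ?thesis .
  qed
  have r0: "0 \<le> bup / blow" "0 \<le> (C / c\<^sup>2) * (1 / s) / l" using bu bl C c s l0 by auto
  have "bup / blow * (2 / g) \<le> (C / c\<^sup>2) * (1 / s) / l * (2 / (g1 * s ^ 4))"
    using r r0 g' gs g0 by (intro mult_mono divide_left_mono) auto
  also have "\<dots> = (C / c\<^sup>2) / l * (2 / g1) * (1 / s ^ 5)" using s by (simp add: eval_nat_numeral)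
  finally have A: "bup / blow * (2 / g) \<le> (C / c\<^sup>2) / l * (2 / g1) * (1 / s ^ 5)" .
  have "a' * (2 * bup / (g * dl)) = 2 * (a' * bup) / (g * dl)" by simp
  also have "\<dots> \<le> 2 * (C\<^sup>2 / c\<^sup>2) / (g * dl)" using ab g' dl' by (intro divide_right_mono) auto
  also have "\<dots> \<le> 2 * (C\<^sup>2 / c\<^sup>2) / ((g1 * s ^ 4) * (c * s / m1))"
    using g' gs g0 dl0 dl' by (intro divide_left_mono mult_mono mult_pos_pos) auto
  finally have B1: "a' * (2 * bup / (g * dl)) \<le> 2 * (C\<^sup>2 / c\<^sup>2) / ((g1 * s ^ 4) * (c * s / m1))" .
  have "bup / blow * (a' * (2 * bup / (g * dl))) \<le> bup / blow * (2 * (C\<^sup>2 / c\<^sup>2) / ((g1 * s ^ 4) * (c * s / m1)))"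
    using B1 r0(1) by (rule mult_left_mono)
  also have "\<dots> \<le> (C / c\<^sup>2) * (1 / s) / l * (2 * (C\<^sup>2 / c\<^sup>2) / ((g1 * s ^ 4) * (c * s / m1)))"
    using r gs dl0(2) g0(2) s(1) by (intro mult_right_mono divide_nonneg_pos mult_pos_pos) auto
  also have "\<dots> = (C / c\<^sup>2) / l * (2 * (C\<^sup>2 / c\<^sup>2) / (g1 * (c / m1))) * (1 / s ^ 6)"
    using s by (simp add: eval_nat_numeral)
  finally have B: "bup / blow * (a' * (2 * bup / (g * dl))) \<le> (C / c\<^sup>2) / l * (2 * (C\<^sup>2 / c\<^sup>2) / (g1 * (c / m1))) * (1 / s ^ 6)" .
  from A B show ?thesis by simp
qed

context flat_self_energy
begin

lemma stability_gap_regime: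
  assumes M: "\<And>z. z \<in> upper_half_plane \<Longrightarrow> mde_solution N S z (M z)" and rho: "self_consistent_dos N M \<rho>"
    and zU: "z \<in> upper_half_plane" "cmod z \<le> C'" and d: "d = infdist z (complex_of_real ` measure_support \<rho>)" "0 < d"
    and m1: "m1 = C' + 2 * C / sqrt c"
  defines "Q \<equiv> 16 * C\<^sup>2 * m1 / c\<^sup>2 * ((16 * m1)\<^sup>2 + C) * (1 / d ^ 3)"
  shows "d \<le> 16 * m1" "bij_betw (stability_op S (M z)) (carrier_mat N N) (carrier_mat N N)"
    "sp_norm N (inv_into (carrier_mat N N) (stability_op S (M z))) \<le> Q"
proof -
  have Iz: "0 < Im z" using zU by (simp add: upper_half_plane_def)
  have Mb: "vnorm (M z *\<^sub>v v) \<le> 16 / d * vnorm v" if "v \<in> carrier_vec N" for v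
    by (rule solution_gap_bound[OF M rho zU(1) d that])
  obtain B Bi u where bal: "balanced_solution N S c C z (M z) B Bi u (16 / d)"
    by (rule balanced_frame[OF Iz M[OF zU(1)] Mb])
  interpret balanced_solution N S c C z "M z" B Bi u "16 / d" by (rule bal)
  have ib: "inv_bound \<le> m1" unfolding inv_bound_def m1 using zU by simp
  show d1: "d \<le> 16 * m1"
  proof -
    have u0: "unit_vec N 0 \<in> carrier_vec N" by simp
    have v1: "vnorm (unit_vec N 0) = 1" using N_pos by simp
    have "1 \<le> inv_bound * vnorm (M z *\<^sub>v unit_vec N 0)" using M_lower_bound[OF u0] v1 by simp
    also have "\<dots> \<le> inv_bound * (16 / d)" using Mb[OF u0] v1 inv_bound_pos by (intro mult_left_mono) auto
    finally have "d \<le> 16 * inv_bound" using d by (simp add: field_simps)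
    then show ?thesis using ib by simp
  qed
  have tau: "avg_im \<le> Im z / d\<^sup>2"
  proof -
    have "d \<le> cmod (complex_of_real t - z)" if "t \<in> measure_support \<rho>" for t
      using infdist_le[of "complex_of_real t" "complex_of_real ` measure_support \<rho>" z] that unfolding d(1)
      by (simp add: dist_norm norm_minus_commute)
    then have "Im (\<integral>\<tau>. 1 / (complex_of_real \<tau> - z) \<partial>\<rho>) \<le> Im z / d\<^sup>2"
      using rho d(2) by (intro stieltjes_im_bound Iz) (auto simp: self_consistent_dos_def)
    then show ?thesis using rho zU(1) avg_im_trace(2)[OF M_carrier] by (simp add: self_consistent_dos_def avg_im_def)
  qed
  have cc: "c \<le> C" by (rule c(2))
  have "(b_up / b_low) * (a_up / Im z) \<le> Q"
    unfolding Q_def b_up_def b_low_def a_up_def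
    by (rule gap_regime_estimate[OF c(1) cc d(2) d1 tau Iz inv_bound_pos ib])
  then have low: "frob N R \<le> Q * frob N (stability_op S (M z) R)" if R: "R \<in> carrier_mat N N" for R
    using stability_contraction_inverse_bound[OF R] 
    by (meson frob_nonneg mult_right_mono order_trans)
  have Q: "0 \<le> Q" unfolding Q_def using ib inv_bound_pos C_pos d by simp
  show "bij_betw (stability_op S (M z)) (carrier_mat N N) (carrier_mat N N)"
    "sp_norm N (inv_into (carrier_mat N N) (stability_op S (M z))) \<le> Q"
    by (rule stability_inverse_bound[OF M_carrier Q low stability_surj]; assumption)+
qed

lemma stability_bulk_regime:
  assumes zU: "z \<in> upper_half_plane" "cmod z \<le> C'" and M: "mde_solution N S z M"
    and s: "0 < s" "s \<le> Re (mat_trace (im_mat M)) / N"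
    and m1: "m1 = C' + 2 * C / sqrt c" and l: "l = c / (C * m1)" and g1: "g1 = c * l\<^sup>2 * (c / m1) ^ 4 / 8"
  defines "Q \<equiv> (C / c\<^sup>2) / l * (2 / g1) * (1 / s ^ 5) + (C / c\<^sup>2) / l * (2 * (C\<^sup>2 / c\<^sup>2) / (g1 * (c / m1))) * (1 / s ^ 6)"
  shows "bij_betw (stability_op S M) (carrier_mat N N) (carrier_mat N N)"
    "sp_norm N (inv_into (carrier_mat N N) (stability_op S M)) \<le> Q"
proof -
  have Iz: "0 < Im z" using zU by (simp add: upper_half_plane_def)
  interpret D: dyson_solution N S c C z M by unfold_locales (use Iz M in auto)
  obtain B Bi u where bal: "balanced_solution N S c C z M B Bi u (1 / D.a_low)"
    by (rule balanced_frame[OF Iz M D.M_bound])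
  interpret balanced_solution N S c C z M B Bi u "1 / D.a_low" by (rule bal)
  have ib: "D.inv_bound \<le> m1" unfolding D.inv_bound_def m1 using zU by simp
  have "c * s \<le> c * D.avg_im" using s(2) c by (intro mult_left_mono) (auto simp: D.avg_im_def)
  then have al: "c * s \<le> D.a_low" using Iz unfolding D.a_low_def by linarith
  have Qb: "b_up / b_low * (2 / gap) + b_up / b_low * (D.a_up * (2 * b_up / (gap * d_low))) \<le> Q"
    unfolding Q_def
    by (rule bulk_regime_estimate[OF c s(1) al D.a_ratio D.inv_bound_pos ib b_up_def b_low_def d_low_def gap_def l g1])
  have low: "frob N R \<le> Q * frob N (stability_op S M R)" if R: "R \<in> carrier_mat N N" for R
    using stability_rotation_inverse_bound[OF R] mult_right_mono[OF Qb frob_nonneg[of N "stability_op S M R"]] by linarith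
  have Q: "0 \<le> Q" unfolding Q_def l g1 using ib D.inv_bound_pos C_pos c s by simp
  show "bij_betw (stability_op S M) (carrier_mat N N) (carrier_mat N N)"
    "sp_norm N (inv_into (carrier_mat N N) (stability_op S M)) \<le> Q"
    by (rule stability_inverse_bound[OF D.M_carrier Q low stability_surj]; assumption)+
qed

end

theorem lemma8p3p1:
  shows "\<exists>\<kappa>::real. \<kappa> = 100 \<and>
    (\<forall>c C C' :: real. 0 < c \<and> c \<le> C \<longrightarrow>
      (\<exists>K::real. \<forall>(N::nat) (S :: complex mat \<Rightarrow> complex mat)
          (M :: complex \<Rightarrow> complex mat) (\<rho> :: real measure).
        1 \<le> N \<and> linear_op N S \<and> hs_symmetric N S \<and> positivity_preserving N S \<and>
        flat_op N c C S \<and>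
        (\<forall>z\<in>upper_half_plane. mde_solution N S z (M z)) \<and>
        self_consistent_dos N M \<rho> \<longrightarrow>
        (\<forall>z\<in>upper_half_plane. cmod z \<le> C' \<longrightarrow>
          bij_betw (stability_op S (M z)) (carrier_mat N N) (carrier_mat N N) \<and>
          sp_norm N (inv_into (carrier_mat N N) (stability_op S (M z)))
            \<le> K / (dos_extension N M z
                    + infdist z (complex_of_real ` measure_support \<rho>)) powr \<kappa>)))"
proof (rule exI[of _ 100], intro conjI refl allI impI)
  fix c C C' :: real
  assume cC: "0 < c \<and> c \<le> C"
  define m1 where "m1 = C' + 2 * C / sqrt c"
  define l where "l = c / (C * m1)"
  define g1 where "g1 = c * l\<^sup>2 * (c / m1) ^ 4 / 8"
  define s1 where "s1 = 2 / sqrt c"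
  define kA where "kA = 16 * C\<^sup>2 * m1 / c\<^sup>2 * ((16 * m1)\<^sup>2 + C)"
  define k1 where "k1 = (C / c\<^sup>2) / l * (2 / g1)"
  define k2 where "k2 = (C / c\<^sup>2) / l * (2 * (C\<^sup>2 / c\<^sup>2) / (g1 * (c / m1)))"
  \<comment> \<open>The regimes give the powers 3, 5 and 6 of the inverse of \<open>\<rho>(z) + d\<close>; this sum is at most \<open>2 (16 m1)\<close> or \<open>s1\<close>,
    which supplies the missing powers.\<close>
  define K where "K = kA * (8 * (2 * (16 * m1)) ^ 97) + (k1 * s1 ^ 95 + k2 * s1 ^ 94)"
  show "\<exists>K::real. \<forall>(N::nat) (S :: complex mat \<Rightarrow> complex mat)
          (M :: complex \<Rightarrow> complex mat) (\<rho> :: real measure).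
        1 \<le> N \<and> linear_op N S \<and> hs_symmetric N S \<and> positivity_preserving N S \<and>
        flat_op N c C S \<and>
        (\<forall>z\<in>upper_half_plane. mde_solution N S z (M z)) \<and>
        self_consistent_dos N M \<rho> \<longrightarrow>
        (\<forall>z\<in>upper_half_plane. cmod z \<le> C' \<longrightarrow>
          bij_betw (stability_op S (M z)) (carrier_mat N N) (carrier_mat N N) \<and>
          sp_norm N (inv_into (carrier_mat N N) (stability_op S (M z)))
            \<le> K / (dos_extension N M z
                    + infdist z (complex_of_real ` measure_support \<rho>)) powr 100)"
  proof (intro exI[of _ K] allI impI ballI)
    fix N :: nat and S :: "complex mat \<Rightarrow> complex mat" and M :: "complex \<Rightarrow> complex mat" and \<rho> :: "real measure"
      and z :: complex
    assume H: "1 \<le> N \<and> linear_op N S \<and> hs_symmetric N S \<and> positivity_preserving N S \<and>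
        flat_op N c C S \<and> (\<forall>z\<in>upper_half_plane. mde_solution N S z (M z)) \<and> self_consistent_dos N M \<rho>"
      and zU: "z \<in> upper_half_plane" "cmod z \<le> C'"
    have Iz: "0 < Im z" using zU by (simp add: upper_half_plane_def)
    have M: "\<And>z. z \<in> upper_half_plane \<Longrightarrow> mde_solution N S z (M z)" and rho: "self_consistent_dos N M \<rho>"
      using H by auto
    interpret dyson_solution N S c C z "M z" by unfold_locales (use H cC Iz zU in auto)
    define r where "r = dos_extension N M z"
    define d where "d = infdist z (complex_of_real ` measure_support \<rho>)"
    have r: "r = avg_im / pi"
      unfolding r_def dos_extension_def avg_im_trace(1)[OF M_carrier] avg_im_def avg_im_trace(2)[OF M_carrier] ..
    have r0: "0 < r" using avg_im_pos by (simp add: r)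
    have d0: "0 \<le> d" by (simp add: d_def infdist_nonneg)
    have s0: "0 < r + d" using r0 d0 by simp
    have m1: "0 < m1"
    proof -
      have "inv_bound \<le> m1" unfolding inv_bound_def m1_def using zU by simp
      then show ?thesis using inv_bound_pos by linarith
    qed
    have l0: "0 < l" using cC m1 by (simp add: l_def)
    have g0: "0 < g1" using cC m1 l0 by (simp add: g1_def)
    have k: "0 \<le> kA" "0 \<le> k1" "0 \<le> k2" "0 \<le> s1"
      using cC m1 l0 g0 by (simp_all add: kA_def k1_def k2_def s1_def)
    have pw: "(r + d) powr 100 = (r + d) ^ 100" using s0 by simp
    have "bij_betw (stability_op S (M z)) (carrier_mat N N) (carrier_mat N N)
       \<and> sp_norm N (inv_into (carrier_mat N N) (stability_op S (M z))) \<le> K / (r + d) ^ 100"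
    proof (cases "r \<le> d")
      case True
      then have dp: "0 < d" using r0 by simp
      note g = stability_gap_regime[OF M rho zU d_def dp m1_def]
      have "((r + d) / 2) ^ 3 \<le> d ^ 3" using True s0 by (intro power_mono) auto
      then have "1 / d ^ 3 \<le> 1 / ((r + d) / 2) ^ 3" using s0 by (intro divide_left_mono mult_pos_pos zero_less_power dp) auto
      also have "\<dots> = 8 * (1 / (r + d) ^ 3)" by (simp add: power_divide)
      also have "\<dots> \<le> 8 * ((2 * (16 * m1)) ^ (100 - 3) / (r + d) ^ 100)"
        using True g(1) by (intro mult_left_mono inverse_power_le s0) auto
      finally have "kA * (1 / d ^ 3) \<le> kA * (8 * ((2 * (16 * m1)) ^ (100 - 3) / (r + d) ^ 100))"
        using k by (intro mult_left_mono)
      also have "\<dots> = kA * (8 * (2 * (16 * m1)) ^ 97) / (r + d) ^ 100" by simp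
      also have "\<dots> \<le> K / (r + d) ^ 100"
        using k s0 unfolding K_def by (intro divide_right_mono) simp_all
      finally show ?thesis using g(2,3) unfolding kA_def by linarith
    next
      case False
      \<comment> \<open>Here \<open>\<langle>Im M\<rangle> = \<pi> r\<close>, and \<open>2 \<le> \<pi>\<close> absorbs the sum.\<close>
      have "r + d \<le> 2 * r" using False by simp
      also have "\<dots> \<le> pi * r" using pi_ge_two r0 by (intro mult_right_mono) auto
      also have "\<dots> = avg_im" by (simp add: r)
      finally have sl: "r + d \<le> Re (mat_trace (im_mat (M z))) / N" by (simp add: avg_im_def)
      have "r + d \<le> 1 / sqrt c" using sl avg_im_le by (simp add: avg_im_def)
      also have "\<dots> \<le> s1" unfolding s1_def using cC by (intro divide_right_mono) auto
      finally have s1: "r + d \<le> s1" .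
      note g = stability_bulk_regime[OF zU M[OF zU(1)] s0 sl m1_def l_def g1_def]
      have "k1 * (1 / (r + d) ^ 5) + k2 * (1 / (r + d) ^ 6)
         \<le> k1 * (s1 ^ (100 - 5) / (r + d) ^ 100) + k2 * (s1 ^ (100 - 6) / (r + d) ^ 100)"
        using k by (intro add_mono mult_left_mono inverse_power_le s0 s1) auto
      also have "\<dots> = (k1 * s1 ^ 95 + k2 * s1 ^ 94) / (r + d) ^ 100" by (simp add: add_divide_distrib)
      also have "\<dots> \<le> K / (r + d) ^ 100"
        using k s0 m1 unfolding K_def by (intro divide_right_mono) simp_all
      finally show ?thesis using g unfolding k1_def k2_def by linarith
    qed
    then show "bij_betw (stability_op S (M z)) (carrier_mat N N) (carrier_mat N N) \<and>
          sp_norm N (inv_into (carrier_mat N N) (stability_op S (M z)))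
            \<le> K / (dos_extension N M z
                    + infdist z (complex_of_real ` measure_support \<rho>)) powr 100"
      unfolding r_def[symmetric] d_def[symmetric] pw .
  qed
qed

end
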